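(* For every integer $n\ge 0$, \[ M2\mathrm{spt}(3n+1)\equiv 0 \pmod 3,\qquad M2\mathrm{spt}(5n+1)\equiv 0 \pmod 5,\qquad M2\mathrm{spt}(5n+3)\equiv 0\pmod 5 . \]
   Context: $M2\mathrm{spt}(n)$ denotes the total number of smallest parts, summed over all partitions of $n$ that have no repeated odd parts and whose smallest part is even. Equivalently, \[ \sum_{n\ge1} M2\mathrm{spt}(n)q^n=\sum_{n=1}^\infty \frac{q^{2n}(-q^{2n+1};q^2)_\infty}{(1-q^{2n})^2(q^{2n+2};q^2)_\infty}, \] where $(a;q)_\infty=\prod_{k\ge0}(1-aq^k)$. *)

theory Defs
  imports Main "HOL-Library.Multiset"
begin

definition M2_partitions :: "nat \<Rightarrow> nat multiset set" where
  "M2_partitions n = {P. P \<noteq> {#} \<and> (\<forall>i\<in>#P. 0 < i) \<and> sum_mset P = n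
      \<and> (\<forall>i\<in>#P. odd i \<longrightarrow> count P i = 1)
      \<and> even (Min (set_mset P))}"

definition M2spt :: "nat \<Rightarrow> nat" where
  "M2spt n = (\<Sum>P\<in>M2_partitions n. count P (Min (set_mset P)))"

end

theory Submission
  imports Defs "HOL-Computational_Algebra.Formal_Laurent_Series" "HOL-Library.Numeral_Type"
begin

text \<open>
  Put \<open>F = \<Sum> (-1)^n M2spt(n) q^n\<close> and \<open>psi = \<Sum> q^(2 n^2 + n)\<close>, the latter over all integers. A finite
  Bailey-pair identity gives \<open>psi F = E + L_1\<close>, where \<open>E = \<Sum> sigma(n) q^(2 n)\<close> and \<open>L_k\<close> is the Appell-type
  series \<open>\<Sum> (2 j + 1)^k q^(n (2 n + 2 j + 1))\<close> over \<open>n \<ge> 1\<close> and \<open>j \<ge> 0\<close>.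

  The two-variable generating function of the \<open>L_k\<close>, multiplied by the cube of a theta function in
  \<open>w\<close>, solves a functional equation under \<open>w \<mapsto> q^2 w\<close> and is therefore a multiple of another theta
  function. Taylor expansion at \<open>w = 1\<close> shows that, with \<open>\<theta> = q d/dq\<close> and
  \<open>\<nabla> h = 8 \<theta> h - (1 + 8 \<theta> psi / psi) h\<close>, both \<open>\<nabla> L_1 + L_3\<close> and \<open>\<nabla> L_3 + L_5\<close> are polynomials in
  Eisenstein series. By Fermat, \<open>L_3 = L_1\<close> modulo 3 and \<open>L_5 = L_1\<close> modulo 5, so \<open>E + L_1\<close> satisfies a
  linear differential equation in \<open>\<nabla>\<close> over the prime field; its right-hand side vanishes because the
  exponents \<open>T = 2 n^2 + n\<close> of \<open>psi\<close> satisfy \<open>T^2 = T\<close> modulo 3 and \<open>T^3 - 4 T^2 + 3 T = 0\<close> modulo 5.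
  Since \<open>\<nabla> (psi g) = psi (8 \<theta> - 1) g\<close>, it becomes one with constant coefficients for \<open>F\<close>: modulo 3 it reads \<open>(8 n - 1) (8 n) F_n = 0\<close>, modulo 5
  it reads \<open>(8 n - 1)^2 ((8 n - 1)^2 - 1) F_n = 0\<close>.
\<close>

section \<open>Locally finite sums of power series\<close>

text \<open>The signs in \<open>F\<close> come from \<open>q \<mapsto> -q\<close>, which gives odd
  parts the factor \<open>1 - q^s\<close> and thereby matches the Bailey pair. The 8 in
  \<open>nabla\<close> comes from \<open>(4 n + x)^2 = 8 (2 n^2 + n x) + x^2\<close>: weighting
  \<open>q^(2 n^2 + n x) w^x\<close> by \<open>(4 n + x)^2 - c\<close> applies
  \<open>8 \<theta> + (w d/dw)^2 - c\<close>, which couples \<open>L_k\<close> to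
  \<open>L_(k+2)\<close>. The boundary terms of the functional equation then vanish when
  \<open>(8 \<theta> + 1) psi = c psi\<close>, and this fixes \<open>c\<close>. Two obstacles shape
  the rest. The series in \<open>w\<close> contains \<open>\<Sum> (x^2 - c) w^x\<close> over odd
  \<open>x > 0\<close>, which is not locally finite; so the theta factors act on sequences of
  coefficients until three differences, clearing the pole of order three at \<open>w^2 = 1\<close>,
  make everything summable. Secondly, the Taylor identities carry factors 3 and 15, so direct
  reduction modulo 3 or 5 would erase terms in \<open>L_k\<close>. Over the integers, Ramanujan's
  differential equations trade an Eisenstein series for derivatives of lower ones, the bad prime
  cancels, and only then is the identity reduced.\<close>

definition fsummable :: "('i \<Rightarrow> 'a::comm_ring_1 fps) \<Rightarrow> bool" where
  "fsummable a \<longleftrightarrow> (\<forall>N. finite {i. a i $ N \<noteq> 0})"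

text \<open>If infinitely many \<open>a i\<close> have a nonzero coefficient at \<open>N\<close>,
  the sum defaults to 0; negation and reindexing preserve supports and so respect this
  default.\<close>

definition fsum :: "('i \<Rightarrow> 'a::comm_ring_1 fps) \<Rightarrow> 'a fps" where
  "fsum a = Abs_fps (\<lambda>N. \<Sum>i | a i $ N \<noteq> 0. a i $ N)"

lemma fsummableI:
  assumes "\<And>N. finite (S N)" "\<And>N i. a i $ N \<noteq> 0 \<Longrightarrow> i \<in> S N"
  shows "fsummable a"
  unfolding fsummable_def
proof
  fix N show "finite {i. a i $ N \<noteq> 0}"
    by (rule finite_subset[OF _ assms(1)[of N]]) (use assms(2) in auto)
qed

lemma fsum_nth:
  assumes "finite S" "\<And>i. a i $ N \<noteq> 0 \<Longrightarrow> i \<in> S"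
  shows "fsum a $ N = (\<Sum>i\<in>S. a i $ N)"
  unfolding fsum_def fps_nth_Abs_fps
  by (rule sum.mono_neutral_left) (use assms in auto)

text \<open>Coefficient \<open>N\<close> of \<open>a i * b i\<close> only sees the coefficients of
  \<open>a i\<close> up to \<open>N\<close>, so \<open>b\<close> may vary freely with
  \<open>i\<close>.\<close>

lemma fsummable_mult_right:
  fixes a b :: "'i \<Rightarrow> 'a::comm_ring_1 fps"
  assumes "fsummable a"
  shows "fsummable (\<lambda>i. a i * b i)"
proof (rule fsummableI)
  fix N
  show "finite (\<Union>M\<in>{..N}. {i. a i $ M \<noteq> 0})"
    using assms by (auto simp: fsummable_def)
  fix i assume "(a i * b i) $ N \<noteq> 0"
  then obtain M where "M \<le> N" "a i $ M * b i $ (N - M) \<noteq> 0"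
    unfolding fps_mult_nth by (metis (no_types, lifting) atLeastAtMost_iff sum.neutral)
  then show "i \<in> (\<Union>M\<in>{..N}. {i. a i $ M \<noteq> 0})"
    by auto (metis mult_zero_left atMost_iff)
qed

lemma fsummable_mult_left:
  fixes a b :: "'i \<Rightarrow> 'a::comm_ring_1 fps"
  assumes "fsummable a"
  shows "fsummable (\<lambda>i. b i * a i)"
  using fsummable_mult_right[OF assms, of b] by (simp add: mult.commute)

lemma fsummable_add:
  assumes "fsummable a" "fsummable b"
  shows "fsummable (\<lambda>i. a i + b i)"
  by (rule fsummableI[where S = "\<lambda>N. {i. a i $ N \<noteq> 0} \<union> {i. b i $ N \<noteq> 0}"])
     (use assms in \<open>auto simp: fsummable_def\<close>)

lemma fsummable_diff:
  assumes "fsummable a" "fsummable b"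
  shows "fsummable (\<lambda>i. a i - b i)"
  by (rule fsummableI[where S = "\<lambda>N. {i. a i $ N \<noteq> 0} \<union> {i. b i $ N \<noteq> 0}"])
     (use assms in \<open>auto simp: fsummable_def\<close>)

lemma fsummable_uminus: "fsummable a \<Longrightarrow> fsummable (\<lambda>i. - a i)"
  by (auto simp: fsummable_def)

lemma fsummable_comp:
  assumes "fsummable a" "inj h"
  shows "fsummable (\<lambda>i. a (h i))"
  unfolding fsummable_def
proof
  fix N
  have "{i. a (h i) $ N \<noteq> 0} = h -` {i. a i $ N \<noteq> 0}" by auto
  then show "finite {i. a (h i) $ N \<noteq> 0}"
    using assms finite_vimageI by (fastforce simp: fsummable_def)
qed

lemma fsummable_if: "fsummable a \<Longrightarrow> fsummable (\<lambda>i. if P i then a i else 0)"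
  by (rule fsummableI[where S = "\<lambda>N. {i. a i $ N \<noteq> 0}"])
     (auto simp: fsummable_def split: if_splits)

lemma fsummable_finite: "finite {i. a i \<noteq> 0} \<Longrightarrow> fsummable a"
  by (rule fsummableI[where S = "\<lambda>N. {i. a i \<noteq> 0}"]) auto

lemma fsum_finite:
  assumes "finite S" "\<And>i. i \<notin> S \<Longrightarrow> a i = 0"
  shows "fsum a = (\<Sum>i\<in>S. a i)"
proof (rule fps_ext)
  fix N
  show "fsum a $ N = (\<Sum>i\<in>S. a i) $ N"
    unfolding fps_sum_nth by (rule fsum_nth) (use assms in \<open>auto, metis fps_zero_nth\<close>)
qed

lemma fsum_add:
  assumes "fsummable a" "fsummable b"
  shows "fsum (\<lambda>i. a i + b i) = fsum a + fsum b"
proof (rule fps_ext)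
  fix N
  let ?S = "{i. a i $ N \<noteq> 0} \<union> {i. b i $ N \<noteq> 0}"
  have fin: "finite ?S" using assms by (auto simp: fsummable_def)
  show "fsum (\<lambda>i. a i + b i) $ N = (fsum a + fsum b) $ N"
  proof -
    have "fsum (\<lambda>i. a i + b i) $ N = (\<Sum>i\<in>?S. (a i + b i) $ N)"
      by (rule fsum_nth[OF fin]) auto
    moreover have "fsum a $ N = (\<Sum>i\<in>?S. a i $ N)" "fsum b $ N = (\<Sum>i\<in>?S. b i $ N)"
      by (rule fsum_nth[OF fin]; auto)+
    ultimately show ?thesis by (simp add: sum.distrib)
  qed
qed

lemma fsum_uminus: "fsum (\<lambda>i. - a i) = - fsum a"
  by (rule fps_ext) (simp add: fsum_def sum_negf)

lemma fsum_diff: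
  assumes "fsummable a" "fsummable b"
  shows "fsum (\<lambda>i. a i - b i) = fsum a - fsum b"
  using fsum_add[OF assms(1) fsummable_uminus[OF assms(2)]] by (simp add: fsum_uminus)

lemma fsum_cmult:
  fixes a :: "'i \<Rightarrow> 'a::comm_ring_1 fps"
  assumes "fsummable a"
  shows "fsum (\<lambda>i. c * a i) = c * fsum a"
proof (rule fps_ext)
  fix N
  \<comment> \<open>One index set for all degrees up to \<open>N\<close>, so that the convolution
    and the sum over \<open>i\<close> can be exchanged.\<close>
  let ?S = "\<Union>M\<in>{..N}. {i. a i $ M \<noteq> 0}"
  have fin: "finite ?S" using assms by (auto simp: fsummable_def)
  have "i \<in> ?S" if "(c * a i) $ N \<noteq> 0" for i
  proof -
    from that obtain M where "M \<le> N" "c $ M * a i $ (N - M) \<noteq> 0"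
      unfolding fps_mult_nth by (metis (no_types, lifting) atLeastAtMost_iff sum.neutral)
    then have "N - M \<le> N" "a i $ (N - M) \<noteq> 0" by auto
    then show ?thesis by blast
  qed
  then have "fsum (\<lambda>i. c * a i) $ N = (\<Sum>i\<in>?S. (c * a i) $ N)"
    by (rule fsum_nth[OF fin])
  also have "\<dots> = (\<Sum>M=0..N. c $ M * (\<Sum>i\<in>?S. a i $ (N - M)))"
    unfolding fps_mult_nth sum_distrib_left by (rule sum.swap)
  also have "\<dots> = (\<Sum>M=0..N. c $ M * fsum a $ (N - M))"
  proof (rule sum.cong[OF refl])
    fix M assume "M \<in> {0..N}"
    then have "fsum a $ (N - M) = (\<Sum>i\<in>?S. a i $ (N - M))"
      by (intro fsum_nth[OF fin]) auto
    then show "c $ M * (\<Sum>i\<in>?S. a i $ (N - M)) = c $ M * fsum a $ (N - M)" by simp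
  qed
  finally show "fsum (\<lambda>i. c * a i) $ N = (c * fsum a) $ N"
    by (simp add: fps_mult_nth)
qed

lemma fsum_cmult_right:
  fixes a :: "'i \<Rightarrow> 'a::comm_ring_1 fps"
  assumes "fsummable a"
  shows "fsum (\<lambda>i. a i * c) = fsum a * c"
  using fsum_cmult[OF assms, of c] by (simp add: mult.commute)

lemma fsum_reindex:
  assumes "bij_betw h A B" "\<And>i. i \<notin> A \<Longrightarrow> a i = 0" "\<And>j. j \<notin> B \<Longrightarrow> b j = 0"
    "\<And>i. i \<in> A \<Longrightarrow> a i = b (h i)"
  shows "fsum a = fsum b"
proof (rule fps_ext)
  fix N
  have "{j. b j $ N \<noteq> 0} = h ` {i. a i $ N \<noteq> 0}"
  proof safe
    fix j assume j: "b j $ N \<noteq> 0"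
    then have "j \<in> B" using assms(3) by fastforce
    then obtain i where "i \<in> A" "j = h i" using assms(1) by (auto simp: bij_betw_def)
    then show "j \<in> h ` {i. a i $ N \<noteq> 0}" using j assms(4) by auto
  next
    fix i assume i: "a i $ N \<noteq> 0" "b (h i) $ N = 0"
    then have "i \<in> A" using assms(2) by fastforce
    then show False using i assms(4) by auto
  qed
  moreover have "inj_on h {i. a i $ N \<noteq> 0}"
    using assms(1,2) unfolding bij_betw_def inj_on_def by fastforce
  ultimately have "(\<Sum>j | b j $ N \<noteq> 0. b j $ N) = (\<Sum>i | a i $ N \<noteq> 0. b (h i) $ N)"
    by (simp add: sum.reindex)
  also have "\<dots> = (\<Sum>i | a i $ N \<noteq> 0. a i $ N)"
    by (rule sum.cong) (use assms(2,4) in \<open>auto, metis fps_zero_nth\<close>)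
  finally show "fsum a $ N = fsum b $ N"
    by (simp add: fsum_def)
qed

lemma fsum_bij:
  assumes "bij h"
  shows "fsum (\<lambda>i. a (h i)) = fsum a"
  by (rule fsum_reindex[where h = h and A = UNIV and B = UNIV]) (use assms in auto)

lemma fsummable_pair:
  assumes "fsummable (\<lambda>(i, j). a i j)"
  shows "fsummable (a i)" "fsummable (\<lambda>i. fsum (a i))"
proof -
  have fin: "finite {(i, j). a i j $ N \<noteq> 0}" for N
    using assms by (simp add: fsummable_def case_prod_unfold)
  show "fsummable (a i)"
    by (rule fsummableI[where S = "\<lambda>N. snd ` {(i, j). a i j $ N \<noteq> 0}"])
       (use fin in \<open>auto intro!: image_eqI[where x = "(i, _)"]\<close>)
  show "fsummable (\<lambda>i. fsum (a i))"
  proof (rule fsummableI[where S = "\<lambda>N. fst ` {(i, j). a i j $ N \<noteq> 0}"])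
    fix N i assume "fsum (a i) $ N \<noteq> 0"
    then obtain j where "a i j $ N \<noteq> 0"
      by (auto simp: fsum_def) (meson mem_Collect_eq sum.neutral)
    then show "i \<in> fst ` {(i, j). a i j $ N \<noteq> 0}" by force
  qed (use fin in auto)
qed

text \<open>Fubini for locally finite families: at degree \<open>N\<close> the support lies in a
  finite rectangle spanned by its projections.\<close>

lemma fsum_pair:
  assumes "fsummable (\<lambda>(i, j). a i j)"
  shows "fsum (\<lambda>i. fsum (a i)) = fsum (\<lambda>(i, j). a i j)"
proof (rule fps_ext)
  fix N
  define S where "S = {(i, j). a i j $ N \<noteq> 0}"
  have fin: "finite S"
    using assms by (simp add: fsummable_def case_prod_unfold S_def)
  have 1: "fsum (a i) $ N = (\<Sum>j\<in>snd ` S. a i j $ N)" for i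
    by (rule fsum_nth) (use fin in \<open>auto simp: S_def intro!: image_eqI[where x = "(i, _)"]\<close>)
  have "fsum (\<lambda>i. fsum (a i)) $ N = (\<Sum>i\<in>fst ` S. fsum (a i) $ N)"
  proof (rule fsum_nth)
    fix i assume "fsum (a i) $ N \<noteq> 0"
    then obtain j where "a i j $ N \<noteq> 0"
      unfolding 1 by (meson sum.neutral)
    then show "i \<in> fst ` S" by (force simp: S_def)
  qed (use fin in auto)
  also have "\<dots> = (\<Sum>(i, j)\<in>fst ` S \<times> snd ` S. a i j $ N)"
    by (simp add: 1 sum.cartesian_product)
  also have "\<dots> = fsum (\<lambda>(i, j). a i j) $ N"
  proof -
    have "fsum (\<lambda>(i, j). a i j) $ N = (\<Sum>ij\<in>fst ` S \<times> snd ` S. (case ij of (i, j) \<Rightarrow> a i j) $ N)"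
    proof (rule fsum_nth)
      fix ij assume "(case ij of (i, j) \<Rightarrow> a i j) $ N \<noteq> 0"
      then have "ij \<in> S" by (simp add: S_def case_prod_unfold)
      then show "ij \<in> fst ` S \<times> snd ` S" by (cases ij) force
    qed (use fin in auto)
    then show ?thesis by (simp add: case_prod_unfold)
  qed
  finally show "fsum (\<lambda>i. fsum (a i)) $ N = fsum (\<lambda>(i, j). a i j) $ N" .
qed

lemma fsum_swap:
  assumes "fsummable (\<lambda>(i, j). a i j)"
  shows "fsum (\<lambda>i. fsum (\<lambda>j. a i j)) = fsum (\<lambda>j. fsum (\<lambda>i. a i j))"
proof -
  have "bij (\<lambda>(j, i). (i, j))"
    by (rule bijI) (auto simp: inj_def surj_def)
  note sw = this
  have "fsummable (\<lambda>(j, i). a i j)"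
    using fsummable_comp[OF assms bij_is_inj[OF sw]]
    by (simp add: case_prod_unfold)
  from fsum_pair[OF this] fsum_pair[OF assms] fsum_bij[OF sw, of "\<lambda>(i, j). a i j"]
  show ?thesis by (simp add: case_prod_unfold)
qed

lemma fsummable_mult_pair:
  fixes a :: "'i \<Rightarrow> 'a::comm_ring_1 fps" and b :: "'j \<Rightarrow> 'a fps"
  assumes "fsummable a" "fsummable b"
  shows "fsummable (\<lambda>(i, j). a i * b j)"
proof (rule fsummableI)
  fix N
  show "finite ((\<Union>M\<in>{..N}. {i. a i $ M \<noteq> 0}) \<times> (\<Union>M\<in>{..N}. {i. b i $ M \<noteq> 0}))"
    using assms by (auto simp: fsummable_def)
  fix ij assume "(case ij of (i, j) \<Rightarrow> a i * b j) $ N \<noteq> 0"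
  then obtain M where M: "M \<le> N" "a (fst ij) $ M * b (snd ij) $ (N - M) \<noteq> 0"
    unfolding fps_mult_nth case_prod_unfold
    by (metis (no_types, lifting) atLeastAtMost_iff sum.neutral)
  then have "N - M \<in> {..N}" "a (fst ij) $ M \<noteq> 0" "b (snd ij) $ (N - M) \<noteq> 0" by auto
  with M(1) show "ij \<in> (\<Union>M\<in>{..N}. {i. a i $ M \<noteq> 0}) \<times> (\<Union>M\<in>{..N}. {i. b i $ M \<noteq> 0})"
    by (cases ij) fastforce
qed

lemma fsum_mult:
  fixes a :: "'i \<Rightarrow> 'a::comm_ring_1 fps" and b :: "'j \<Rightarrow> 'a fps"
  assumes "fsummable a" "fsummable b"
  shows "fsum a * fsum b = fsum (\<lambda>(i, j). a i * b j)"
  using fsum_pair[OF fsummable_mult_pair[OF assms]]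
  by (simp add: fsum_cmult[OF assms(2)] fsum_cmult_right[OF assms(1)])

section \<open>The derivation \<open>q d/dq\<close> on power series\<close>

lemma fps_XD_nth: "fps_XD f $ n = of_nat n * (f :: 'a::comm_ring_1 fps) $ n"
  by (simp add: fps_XD_def fps_mult_fps_X_deriv_shift)

lemma fps_XD_mult: "fps_XD (f * g) = fps_XD f * g + f * fps_XD (g :: 'a::comm_ring_1 fps)"
  by (simp add: fps_XD_def algebra_simps)

lemma fps_XD_simps [simp]:
  fixes f g :: "'a::comm_ring_1 fps"
  shows "fps_XD (f + g) = fps_XD f + fps_XD g" "fps_XD (f - g) = fps_XD f - fps_XD g"
    "fps_XD (- f) = - fps_XD f" "fps_XD 0 = 0" "fps_XD 1 = 0" "fps_XD (numeral k) = 0"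
    "fps_XD (fps_const c) = 0"
  by (simp_all add: fps_XD_def algebra_simps)

lemma fps_XD_X_power: "fps_XD (fps_X ^ m) = (of_nat m * fps_X ^ m :: 'a::comm_ring_1 fps)"
  by (rule fps_ext) (simp add: fps_XD_nth fps_of_nat[symmetric])

lemma fsum_XD: "fsummable a \<Longrightarrow> fps_XD (fsum a) = fsum (\<lambda>i. fps_XD (a i))"
proof (rule fps_ext)
  fix N assume "fsummable a"
  then have "finite {i. a i $ N \<noteq> 0}" by (simp add: fsummable_def)
  from fsum_nth[OF this, of "\<lambda>i. fps_XD (a i)" N]
  show "fps_XD (fsum a) $ N = fsum (\<lambda>i. fps_XD (a i)) $ N"
    by (simp add: fps_XD_nth fsum_def sum_distrib_left) (metis mult_zero_right)
qed

lemma fsummable_XD: "fsummable a \<Longrightarrow> fsummable (\<lambda>i. fps_XD (a i))"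
  by (rule fsummableI[where S = "\<lambda>N. {i. a i $ N \<noteq> 0}"])
     (auto simp: fsummable_def fps_XD_nth)

lemma fsummable_X_power:
  assumes "\<And>N. finite {i. e i \<le> N}"
  shows "fsummable (\<lambda>i. fps_X ^ e i * b i)"
proof (rule fsummable_mult_right, rule fsummableI)
  show "finite {i. e i \<le> N}" for N by fact
qed (auto split: if_splits)

section \<open>A finite Bailey-pair identity\<close>

text \<open>In standard notation \<open>(q^2;q^2)_n\<close>; the odd variant that follows is
  \<open>(q;q^2)_n\<close>.\<close>

definition qpoch :: "'a::comm_ring_1 \<Rightarrow> nat \<Rightarrow> 'a" where
  "qpoch q n = (\<Prod>k=1..n. 1 - q ^ (2 * k))"

definition qpoch_odd :: "'a::comm_ring_1 \<Rightarrow> nat \<Rightarrow> 'a" where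
  "qpoch_odd q n = (\<Prod>k=1..n. 1 - q ^ (2 * k - 1))"

lemma qpoch_0 [simp]: "qpoch q 0 = 1" "qpoch_odd q 0 = 1"
  by (simp_all add: qpoch_def qpoch_odd_def)

lemma qpoch_Suc: "qpoch q (Suc n) = qpoch q n * (1 - q ^ (2 * n + 2))"
  by (simp add: qpoch_def)

lemma qpoch_odd_Suc: "qpoch_odd q (Suc n) = qpoch_odd q n * (1 - q ^ (2 * n + 1))"
  by (simp add: qpoch_odd_def)

definition bailey_term :: "'a::field \<Rightarrow> nat \<Rightarrow> nat \<Rightarrow> 'a" where
  "bailey_term q n r = q ^ (2 * r ^ 2) / (qpoch q (n - r) * qpoch q (n + r))"

locale generic_q =
  fixes q :: "'a::field"
  assumes q0: "q \<noteq> 0" and q1: "\<And>k. 0 < k \<Longrightarrow> q ^ k \<noteq> 1"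
begin

lemma qpoch_nz [simp]: "qpoch q n \<noteq> 0" "qpoch_odd q n \<noteq> 0"
  using q1 by (auto simp: qpoch_def qpoch_odd_def)

text \<open>The bilateral sum of \<open>q^(2 r^2 + r) / ((q^2;q^2)_(n-r) (q^2;q^2)_(n+r))\<close>
  with \<open>r\<close> and \<open>-r\<close> combined.\<close>

definition bailey_sum :: "nat \<Rightarrow> 'a" where
  "bailey_sum n = bailey_term q n 0 + (\<Sum>r=1..n. bailey_term q n r * (q ^ r + 1 / q ^ r))"

text \<open>The certificate was found by q-Zeilberger's method after symmetrizing the summand
  in \<open>r \<mapsto> -r\<close>.\<close>

definition cert :: "nat \<Rightarrow> nat \<Rightarrow> 'a" where
  "cert n r = q ^ (2 * n) * (q ^ (2 * r ^ 2) / (qpoch q (n - r) * qpoch q (n + r - 1)))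
     * (1 / q ^ (r + 1) - 1 / q ^ (3 * r))"

text \<open>The inner range of the telescoping. The index \<open>r = 0\<close> is separate because
  it is unpaired, and \<open>r = n + 1\<close> because there truncated subtraction would give
  \<open>bailey_term q n r\<close> a spurious nonzero value.\<close>

lemma cert_step:
  assumes "1 \<le> r" "r \<le> n"
  shows "(1 - q ^ (2 * (n + 1))) * (1 - q ^ (2 * n + 1)) * (bailey_term q (n + 1) r * (q ^ r + 1 / q ^ r))
     - bailey_term q n r * (q ^ r + 1 / q ^ r) = cert (n + 1) (r + 1) - cert (n + 1) r"
proof -
  obtain m where m: "n = r + m" using assms(2) by (metis le_add_diff_inverse)
  \<comment> \<open>Apart from the common factor \<open>q^(2 r^2)\<close>, every power of
    \<open>q\<close> is now a monomial in \<open>u\<close>, \<open>N\<close> and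
    \<open>q\<close>.\<close>
  define u N A B where "u = q ^ r" and "N = q ^ (2 * n + 2)" and "A = qpoch q m" and "B = qpoch q (n + r)"
  have nz: "u \<noteq> 0" "A \<noteq> 0" "B \<noteq> 0" "N \<noteq> 0" "q \<noteq> 0" by (simp_all add: u_def A_def B_def N_def q0)
  have nz2: "1 - q ^ (2 * m + 2) \<noteq> 0" "1 - q ^ (2 * (n + r) + 2) \<noteq> 0"
    using q1[of "2 * m + 2"] q1[of "2 * (n + r) + 2"] by auto
  have e1: "q ^ (2 * m + 2) = N / u ^ 2"
    by (simp add: N_def u_def m q0 field_simps flip: power_mult power_add)
  have e2: "q ^ (2 * (n + r) + 2) = N * u ^ 2"
    by (simp add: N_def u_def m q0 field_simps flip: power_mult power_add)
  have e3: "q ^ (2 * n + 1) = N / q"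
    by (simp add: N_def q0 field_simps flip: power_mult power_add power_Suc)
  have e4: "q ^ (2 * (r + 1) ^ 2) = q ^ (2 * r ^ 2) * u ^ 4 * q ^ 2"
    by (simp add: u_def power2_eq_square algebra_simps flip: power_mult power_add)
  have e5: "q ^ (r + 1 + 1) = u * q ^ 2" "q ^ (3 * (r + 1)) = u ^ 3 * q ^ 3" "q ^ (r + 1) = u * q"
     "q ^ (3 * r) = u ^ 3"
    by (simp_all add: u_def mult.commute power2_eq_square power_add flip: power_mult)
  have b1: "bailey_term q (n + 1) r = q ^ (2 * r ^ 2) / (A * (1 - N / u ^ 2) * (B * (1 - N * u ^ 2)))"
    using e1 e2 by (simp add: bailey_term_def m A_def B_def qpoch_Suc add.commute add.left_commute)
  have b2: "bailey_term q n r = q ^ (2 * r ^ 2) / (A * B)"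
    by (simp add: bailey_term_def m A_def B_def)
  have c1: "cert (n + 1) (r + 1) = N * (q ^ (2 * r ^ 2) * u ^ 4 * q ^ 2 / (A * (B * (1 - N * u ^ 2))))
       * (1 / (u * q ^ 2) - 1 / (u ^ 3 * q ^ 3))"
    unfolding cert_def e4 e5 using e2
    by (simp add: m A_def B_def N_def qpoch_Suc add.commute add.left_commute)
  have c2: "cert (n + 1) r = N * (q ^ (2 * r ^ 2) / (A * (1 - N / u ^ 2) * B))
       * (1 / (u * q) - 1 / u ^ 3)"
    unfolding cert_def e5 using e1
    by (simp add: m A_def B_def N_def qpoch_Suc add.commute add.left_commute)
  define D where "D = u ^ 2 - N"
  define E where "E = 1 - N * u ^ 2"
  have D: "D \<noteq> 0" "1 - N / u ^ 2 = D / u ^ 2"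
    using nz2 nz unfolding e1 D_def by (auto simp: field_simps)
  have E: "E \<noteq> 0" using nz2 unfolding e2 E_def by blast
  \<comment> \<open>With \<open>q^(2 r^2) / (A B)\<close> divided out, a rational identity in
    \<open>u\<close>, \<open>N\<close>, \<open>q\<close> remains; \<open>D\<close> and
    \<open>E\<close> keep its denominators opaque.\<close>
  have "(1 - N) * (1 - N / q) * (1 / (D / u ^ 2 * E) * (u + 1 / u)) - (u + 1 / u)
     = N * (u ^ 4 * q ^ 2 / E) * (1 / (u * q ^ 2) - 1 / (u ^ 3 * q ^ 3)) - N * (1 / (D / u ^ 2)) * (1 / (u * q) - 1 / u ^ 3)"
    using D(1) E nz apply (simp add: divide_simps)
    unfolding D_def E_def by algebra
  then have *: "Q / (A * B) * ((1 - N) * (1 - N / q) * (1 / (D / u ^ 2 * E) * (u + 1 / u)) - (u + 1 / u))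
     = Q / (A * B) * (N * (u ^ 4 * q ^ 2 / E) * (1 / (u * q ^ 2) - 1 / (u ^ 3 * q ^ 3)) - N * (1 / (D / u ^ 2)) * (1 / (u * q) - 1 / u ^ 3))" for Q
    by (rule arg_cong)
  have l: "Q / (A * B) * (x * (1 / (D / u ^ 2 * E) * y) - y) = x * (Q / (A * (D / u\<^sup>2) * (B * E)) * y) - Q / (A * B) * y" for Q x y
    using nz D(1) E by (simp add: divide_simps) algebra
  have r: "Q / (A * B) * (N * (u ^ 4 * q ^ 2 / E) * x - N * (1 / (D / u ^ 2)) * y)
    = N * (Q * u ^ 4 * q ^ 2 / (A * (B * E))) * x - N * (Q / (A * (D / u ^ 2) * B)) * y" for Q x y
    using nz D(1) E by (simp add: divide_simps) algebra
  have "q ^ (2 * (n + 1)) = N" by (simp add: N_def)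
  then show ?thesis
    unfolding b1 b2 c1 c2 e3 D(2) E_def[symmetric] u_def[symmetric]
    using *[of "q ^ (2 * r ^ 2)"] by (simp only: l r)
qed

lemma cert_top:
  "(1 - q ^ (2 * (n + 1))) * (1 - q ^ (2 * n + 1)) * (bailey_term q (n + 1) (n + 1) * (q ^ (n + 1) + 1 / q ^ (n + 1)))
     = - cert (n + 1) (n + 1)"
proof -
  define u B where "u = q ^ (n + 1)" and "B = qpoch q (2 * n + 1)"
  have nz: "u \<noteq> 0" "B \<noteq> 0" "q \<noteq> 0" by (simp_all add: u_def B_def q0)
  have nz2: "1 - u ^ 4 \<noteq> 0"
    using q1[of "(n + 1) * 4"] unfolding u_def power_mult[symmetric] by simp
  have "2 * (2 * n + 1) + 2 = (n + 1) * 4" by simp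
  then have e4: "q ^ (2 * (2 * n + 1) + 2) = u ^ 4"
    by (simp only: u_def power_mult)
  have e: "q ^ (2 * (n + 1)) = u ^ 2" "q ^ (2 * n + 1) = u ^ 2 / q"
     "q ^ (n + 1 + 1) = u * q" "q ^ (3 * (n + 1)) = u ^ 3"
    by (simp_all add: u_def q0 field_simps flip: power_mult power_add power_Suc)
  have b: "bailey_term q (n + 1) (n + 1) = q ^ (2 * (n + 1) ^ 2) / (B * (1 - u ^ 4))"
    using qpoch_Suc[of q "2 * n + 1"] e4 by (simp add: bailey_term_def B_def mult_2)
  have c: "cert (n + 1) (n + 1) = u ^ 2 * (q ^ (2 * (n + 1) ^ 2) / B) * (1 / (u * q) - 1 / u ^ 3)"
    unfolding cert_def e by (simp add: B_def mult_2)
  have "(1 - u ^ 2) * (1 - u ^ 2 / q) * (Q / (B * (1 - u ^ 4)) * (u + 1 / u))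
      = - (u ^ 2 * (Q / B) * (1 / (u * q) - 1 / u ^ 3))" for Q
    using nz nz2 by (simp add: divide_simps) algebra
  then show ?thesis
    unfolding b c e u_def[symmetric] .
qed

lemma cert_0:
  "(1 - q ^ (2 * (n + 1))) * (1 - q ^ (2 * n + 1)) * bailey_term q (n + 1) 0 - bailey_term q n 0 = cert (n + 1) 1"
proof -
  define N A where "N = q ^ (2 * n + 2)" and "A = qpoch q n"
  have nz: "A \<noteq> 0" "q \<noteq> 0" "1 - N \<noteq> 0" using q1[of "2 * n + 2"] by (auto simp: A_def N_def q0)
  have e: "q ^ (2 * n + 1) = N / q" "q ^ (2 * (n + 1)) = N"
    by (simp_all add: N_def q0 field_simps)
  have "bailey_term q (n + 1) 0 = 1 / (A * (1 - N)) ^ 2" "bailey_term q n 0 = 1 / A ^ 2"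
    by (simp_all add: bailey_term_def qpoch_Suc A_def N_def power2_eq_square)
  moreover have "cert (n + 1) 1 = N * (q ^ 2 / (A * (A * (1 - N)))) * (1 / q ^ 2 - 1 / q ^ 3)"
    unfolding cert_def e by (simp add: qpoch_Suc A_def N_def power2_eq_square)
  ultimately show ?thesis
    unfolding e using nz by (simp add: divide_simps) algebra
qed

text \<open>The certificates telescope, and \<open>cert_0\<close> and \<open>cert_top\<close> are
  exactly the two ends, so nothing inhomogeneous is left.\<close>

lemma bailey_sum_rec: "(1 - q ^ (2 * (n + 1))) * (1 - q ^ (2 * n + 1)) * bailey_sum (n + 1) = bailey_sum n"
proof -
  define c where "c = (1 - q ^ (2 * (n + 1))) * (1 - q ^ (2 * n + 1))"
  have "c * bailey_sum (n + 1) - bailey_sum n = (c * bailey_term q (n + 1) 0 - bailey_term q n 0)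
      + (\<Sum>r=1..n. c * (bailey_term q (n + 1) r * (q ^ r + 1 / q ^ r)) - bailey_term q n r * (q ^ r + 1 / q ^ r))
      + c * (bailey_term q (n + 1) (n + 1) * (q ^ (n + 1) + 1 / q ^ (n + 1)))"
    by (simp add: bailey_sum_def sum_subtractf sum_distrib_left algebra_simps)
  also have "(\<Sum>r=1..n. c * (bailey_term q (n + 1) r * (q ^ r + 1 / q ^ r)) - bailey_term q n r * (q ^ r + 1 / q ^ r))
      = (\<Sum>r=1..n. cert (n + 1) (r + 1) - cert (n + 1) r)"
    unfolding c_def by (intro sum.cong refl cert_step) auto
  also have "\<dots> = cert (n + 1) (n + 1) - cert (n + 1) 1"
    using sum_Suc_diff[of 1 n "cert (n + 1)"] by simp
  finally show ?thesis
    using cert_0[of n] cert_top[of n] unfolding c_def by simp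
qed

text \<open>The product is \<open>(q;q)_(2n)\<close>, so this is the \<open>beta\<close> side of a
  Bailey pair relative to 1 in base \<open>q^2\<close>.\<close>

lemma bailey_sum_eq: "bailey_sum n * (qpoch q n * qpoch_odd q n) = 1"
proof (induction n)
  case 0
  show ?case by (simp add: bailey_sum_def bailey_term_def)
next
  case (Suc n)
  have "bailey_sum (Suc n) * (qpoch q (Suc n) * qpoch_odd q (Suc n))
    = ((1 - q ^ (2 * (n + 1))) * (1 - q ^ (2 * n + 1)) * bailey_sum (n + 1)) * (qpoch q n * qpoch_odd q n)"
    by (simp add: qpoch_Suc qpoch_odd_Suc)
  then show ?case using Suc by (simp only: bailey_sum_rec)
qed

text \<open>The effect of cutting the products off at \<open>B\<close>; it tends to 1 for fixed
  \<open>r\<close>.\<close>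

definition theta_ratio :: "nat \<Rightarrow> nat \<Rightarrow> 'a" where
  "theta_ratio B r = qpoch q B ^ 2 / (qpoch q (B - r) * qpoch q (B + r))"

text \<open>A finite conjugate Bailey pair: passing from \<open>B\<close> to \<open>B + 1\<close>
  changes the right side by exactly the new summand.\<close>

lemma telescope:
  assumes "1 \<le> r" "r \<le> B"
  shows "(\<Sum>n=r..B. q ^ (2 * n) * qpoch q (n - 1) ^ 2 / (qpoch q (n - r) * qpoch q (n + r)))
    = q ^ (2 * r) / (1 - q ^ (2 * r)) ^ 2 * theta_ratio B r"
  using assms(2)
proof (induction B rule: dec_induct)
  case base
  obtain k where r: "r = Suc k" using assms(1) by (cases r) auto
  show ?case using q1[of "2 * k + 2"] by (simp add: theta_ratio_def r qpoch_Suc power_mult_distrib)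
next
  case (step B)
  obtain m where m: "B = r + m" using step by (metis le_add_diff_inverse)
  define u N A C D where "u = q ^ (2 * r)" and "N = q ^ (2 * B + 2)" and "A = qpoch q m"
     and "C = qpoch q (B + r)" and "D = qpoch q B"
  have nz: "u \<noteq> 0" "A \<noteq> 0" "C \<noteq> 0" "D \<noteq> 0" by (simp_all add: u_def A_def C_def D_def q0)
  have e: "q ^ (2 * m + 2) = N / u" "q ^ (2 * (B + r) + 2) = N * u"
    by (simp_all add: N_def u_def m q0 field_simps flip: power_mult power_add)
  have nz2: "1 - u \<noteq> 0" "1 - N / u \<noteq> 0" "1 - N * u \<noteq> 0" "1 - N \<noteq> 0"
    unfolding e[symmetric] using q1[of "2 * r"] q1[of "2 * m + 2"] q1[of "2 * (B + r) + 2"] q1[of "2 * B + 2"] assms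
    by (auto simp: u_def N_def)
  then have nz3: "u \<noteq> N" using nz by auto
  have "theta_ratio (Suc B) r = (D * (1 - N)) ^ 2 / (A * (1 - N / u) * (C * (1 - N * u)))"
    using e by (simp add: theta_ratio_def m qpoch_Suc A_def C_def D_def N_def add.commute add.left_commute Suc_diff_le)
  moreover have "theta_ratio B r = D ^ 2 / (A * C)"
    by (simp add: theta_ratio_def m A_def C_def D_def)
  moreover have "q ^ (2 * Suc B) * qpoch q (Suc B - 1) ^ 2 / (qpoch q (Suc B - r) * qpoch q (Suc B + r))
     = N * D ^ 2 / (A * (1 - N / u) * (C * (1 - N * u)))"
    using e by (simp add: m qpoch_Suc A_def C_def D_def N_def add.commute add.left_commute Suc_diff_le)
  moreover have "u / (1 - u) ^ 2 * (D ^ 2 / (A * C)) + N * D ^ 2 / (A * (1 - N / u) * (C * (1 - N * u)))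
     = u / (1 - u) ^ 2 * ((D * (1 - N)) ^ 2 / (A * (1 - N / u) * (C * (1 - N * u))))"
    using nz nz2 nz3 by (simp add: divide_simps) algebra
  ultimately show ?case
    using step by (simp add: u_def)
qed

text \<open>The Bailey pair enters twice: at \<open>n = B\<close> it evaluates the truncated theta
  series as \<open>(q^2;q^2)_B / (q;q^2)_B\<close>, and at every \<open>n\<close> it expands the
  summand of \<open>f\<close>. Exchanging the double sum leaves \<open>telescope\<close>. As
  \<open>B\<close> grows this becomes \<open>F psi = E + L_1\<close>.\<close>

lemma finite_identity:
  fixes B :: nat
  defines "f \<equiv> \<Sum>n=1..B. q ^ (2 * n) / (1 - q ^ (2 * n)) ^ 2 * (\<Prod>k\<in>{n<..B}. (1 - q ^ (2 * k - 1)) / (1 - q ^ (2 * k)))"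
  shows "f * (theta_ratio B 0 + (\<Sum>r=1..B. q ^ (2 * r ^ 2) * (q ^ r + 1 / q ^ r) * theta_ratio B r))
    = (\<Sum>n=1..B. q ^ (2 * n) / (1 - q ^ (2 * n)) ^ 2)
      + (\<Sum>r=1..B. q ^ (2 * r ^ 2) * (q ^ r + 1 / q ^ r) * (q ^ (2 * r) / (1 - q ^ (2 * r)) ^ 2) * theta_ratio B r)"
proof -
  have nz: "1 - q ^ (2 * n) \<noteq> 0" if "n \<ge> 1" for n using q1[of "2 * n"] that by auto
  have pr: "(\<Prod>k\<in>{n<..B}. (1 - q ^ (2 * k - 1)) / (1 - q ^ (2 * k)))
     = qpoch_odd q B / qpoch q B * (qpoch q n / qpoch_odd q n)" if "n \<le> B" for n
    using that
  proof (induction B rule: dec_induct)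
    case (step m)
    have "{n<..Suc m} = insert (Suc m) {n<..m}" using step by auto
    then show ?case using step by (simp add: qpoch_Suc qpoch_odd_Suc mult_ac)
  qed simp
  have "qpoch q B ^ 2 * bailey_sum B = theta_ratio B 0 + (\<Sum>r=1..B. q ^ (2 * r ^ 2) * (q ^ r + 1 / q ^ r) * theta_ratio B r)"
    by (simp add: bailey_sum_def bailey_term_def theta_ratio_def sum_distrib_left algebra_simps add_divide_distrib)
  then have T: "theta_ratio B 0 + (\<Sum>r=1..B. q ^ (2 * r ^ 2) * (q ^ r + 1 / q ^ r) * theta_ratio B r) = qpoch q B / qpoch_odd q B"
  proof -
    have "bailey_sum B = 1 / (qpoch q B * qpoch_odd q B)" using bailey_sum_eq[of B] by (simp add: field_simps)
    then show ?thesis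
      unfolding \<open>qpoch q B ^ 2 * bailey_sum B = _\<close>[symmetric] by (simp add: power2_eq_square)
  qed
  have "f * (qpoch q B / qpoch_odd q B)
      = (\<Sum>n=1..B. q ^ (2 * n) * qpoch q (n - 1) ^ 2 * bailey_sum n)"
    unfolding f_def sum_distrib_right
  proof (rule sum.cong[OF refl])
    fix n assume n: "n \<in> {1..B}"
    then obtain m where m: "n = Suc m" by (cases n) auto
    have "bailey_sum n = 1 / (qpoch q n * qpoch_odd q n)" using bailey_sum_eq[of n] by (simp add: field_simps)
    moreover have "qpoch q n = qpoch q (n - 1) * (1 - q ^ (2 * n))" using m by (simp add: qpoch_Suc)
    moreover have "x / y ^ 2 * (C * y / D) = x * C ^ 2 * (1 / (C * y * D))"
      if "y \<noteq> 0" "C \<noteq> 0" "D \<noteq> 0" for x y C D :: 'a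
      using that by (simp add: field_simps power2_eq_square)
    ultimately have "q ^ (2 * n) / (1 - q ^ (2 * n)) ^ 2 * (qpoch q n / qpoch_odd q n)
      = q ^ (2 * n) * qpoch q (n - 1) ^ 2 * bailey_sum n"
      using nz[of n] n by simp
    then show "q ^ (2 * n) / (1 - q ^ (2 * n)) ^ 2 * (\<Prod>k\<in>{n<..B}. (1 - q ^ (2 * k - 1)) / (1 - q ^ (2 * k)))
        * (qpoch q B / qpoch_odd q B) = q ^ (2 * n) * qpoch q (n - 1) ^ 2 * bailey_sum n"
    proof -
      have "n \<le> B" using n by simp
      from pr[OF this] show ?thesis
        using \<open>q ^ (2 * n) / _ * _ = _\<close> by (simp only:) simp
    qed
  qed
  also have "\<dots> = (\<Sum>n=1..B. q ^ (2 * n) * qpoch q (n - 1) ^ 2 * bailey_term q n 0)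
     + (\<Sum>n=1..B. \<Sum>r=1..n. q ^ (2 * n) * qpoch q (n - 1) ^ 2 * (bailey_term q n r * (q ^ r + 1 / q ^ r)))"
    by (simp add: bailey_sum_def distrib_left sum.distrib sum_distrib_left)
  also have "(\<Sum>n=1..B. q ^ (2 * n) * qpoch q (n - 1) ^ 2 * bailey_term q n 0) = (\<Sum>n=1..B. q ^ (2 * n) / (1 - q ^ (2 * n)) ^ 2)"
  proof (rule sum.cong[OF refl])
    fix n assume n: "n \<in> {1..B}"
    then obtain m where m: "n = Suc m" by (cases n) auto
    show "q ^ (2 * n) * qpoch q (n - 1) ^ 2 * bailey_term q n 0 = q ^ (2 * n) / (1 - q ^ (2 * n)) ^ 2"
    proof -
      have "qpoch q n = qpoch q (n - 1) * (1 - q ^ (2 * n))" using m by (simp add: qpoch_Suc)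
      then show ?thesis by (simp add: bailey_term_def power2_eq_square)
    qed
  qed
  also have "(\<Sum>n=1..B. \<Sum>r=1..n. q ^ (2 * n) * qpoch q (n - 1) ^ 2 * (bailey_term q n r * (q ^ r + 1 / q ^ r)))
     = (\<Sum>r=1..B. \<Sum>n=r..B. q ^ (2 * n) * qpoch q (n - 1) ^ 2 * (bailey_term q n r * (q ^ r + 1 / q ^ r)))"
  proof -
    have "{1..n} = {r. r \<in> {1..B} \<and> r \<le> n}" if "n \<in> {1..B}" for n using that by auto
    moreover have "{n. n \<in> {1..B} \<and> r \<le> n} = {r..B}" if "r \<in> {1..B}" for r using that by auto
    ultimately show ?thesis
      using sum.swap_restrict[of "{1..B}" "{1..B}"
          "\<lambda>n r. q ^ (2 * n) * qpoch q (n - 1) ^ 2 * (bailey_term q n r * (q ^ r + 1 / q ^ r))" "\<lambda>n r. r \<le> n"]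
      by simp
  qed
  also have "\<dots> = (\<Sum>r=1..B. q ^ (2 * r ^ 2) * (q ^ r + 1 / q ^ r) * (q ^ (2 * r) / (1 - q ^ (2 * r)) ^ 2) * theta_ratio B r)"
  proof (rule sum.cong[OF refl])
    fix r assume "r \<in> {1..B}"
    then have r: "1 \<le> r" "r \<le> B" by auto
    have "(\<Sum>n=r..B. q ^ (2 * n) * qpoch q (n - 1) ^ 2 * (bailey_term q n r * (q ^ r + 1 / q ^ r)))
      = q ^ (2 * r ^ 2) * (q ^ r + 1 / q ^ r) * (\<Sum>n=r..B. q ^ (2 * n) * qpoch q (n - 1) ^ 2 / (qpoch q (n - r) * qpoch q (n + r)))"
      by (simp add: bailey_term_def sum_distrib_left algebra_simps add_divide_distrib)
    then show "(\<Sum>n=r..B. q ^ (2 * n) * qpoch q (n - 1) ^ 2 * (bailey_term q n r * (q ^ r + 1 / q ^ r)))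
      = q ^ (2 * r ^ 2) * (q ^ r + 1 / q ^ r) * (q ^ (2 * r) / (1 - q ^ (2 * r)) ^ 2) * theta_ratio B r"
      unfolding telescope[OF r] by (simp add: algebra_simps)
  qed
  finally show ?thesis unfolding T .
qed

end

section \<open>Transfer from Laurent series to power series\<close>

lemma fps_to_fls_sum: "fps_to_fls (sum f A) = (\<Sum>x\<in>A. fps_to_fls (f x))"
  by (induction A rule: infinite_finite_induct) auto

lemma fps_to_fls_prod: "fps_to_fls (prod f A) = (\<Prod>x\<in>A. fps_to_fls (f x :: 'a::comm_ring_1 fps))"
  by (induction A rule: infinite_finite_induct) (auto simp: fls_times_fps_to_fls)

lemma fps_to_fls_inverse:
  "f $ 0 \<noteq> 0 \<Longrightarrow> fps_to_fls (inverse f) = inverse (fps_to_fls (f :: rat fps))"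
  by (simp add: fls_inverse_fps_to_fls subdegree_eq_0)

text \<open>The identity involves \<open>q^(-r)\<close> and division, hence a field; the embedding
  of power series into Laurent series is injective and brings the result back.\<close>

interpretation fls_q: generic_q "fls_X :: rat fls"
proof
  show "(fls_X :: rat fls) ^ k \<noteq> 1" if "0 < k" for k
  proof
    assume "(fls_X :: rat fls) ^ k = 1"
    then have "fps_to_fls (fps_X ^ k :: rat fps) = fps_to_fls 1"
      by (simp only: fps_to_fls_power fps_X_to_fls fps_one_to_fls)
    then have "(fps_X ^ k :: rat fps) = 1" by (simp only: fps_to_fls_eq_iff)
    then have "(fps_X ^ k :: rat fps) $ 0 = 1 $ 0" by (rule arg_cong)
    then show False using that by simp
  qed
qed simp

text \<open>Smallest-part counts for parts at most \<open>2 B\<close>, with \<open>q\<close>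
  replaced by \<open>-q\<close>; \<open>fpart_nth\<close> makes this precise.\<close>

definition fpart :: "nat \<Rightarrow> rat fps" where
  "fpart B = (\<Sum>n=1..B. fps_X ^ (2 * n) * inverse ((1 - fps_X ^ (2 * n)) ^ 2) *
     (\<Prod>k\<in>{n<..B}. (1 - fps_X ^ (2 * k - 1)) * inverse (1 - fps_X ^ (2 * k))))"

definition fps_theta_ratio :: "nat \<Rightarrow> nat \<Rightarrow> rat fps" where
  "fps_theta_ratio B r = qpoch fps_X B ^ 2 * inverse (qpoch fps_X (B - r) * qpoch fps_X (B + r))"

lemma qpoch_nth_0 [simp]: "qpoch (fps_X :: rat fps) n $ 0 = 1"
  by (induction n) (simp_all add: qpoch_Suc)

lemma fps_to_fls_qpoch: "fps_to_fls (qpoch fps_X n) = qpoch (fls_X :: rat fls) n"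
  by (simp add: qpoch_def fps_to_fls_prod fps_to_fls_power)

lemma fps_to_fls_fps_theta_ratio: "fps_to_fls (fps_theta_ratio B r) = fls_q.theta_ratio B r"
  by (simp add: fps_theta_ratio_def fls_q.theta_ratio_def fls_times_fps_to_fls fps_to_fls_power fps_to_fls_inverse
        fps_to_fls_qpoch divide_inverse)

lemma fps_finite_identity:
  "fpart B * (fps_theta_ratio B 0 + (\<Sum>r=1..B. (fps_X ^ (2 * r ^ 2 + r) + fps_X ^ (2 * r ^ 2 - r)) * fps_theta_ratio B r))
    = (\<Sum>n=1..B. fps_X ^ (2 * n) * inverse ((1 - fps_X ^ (2 * n)) ^ 2))
      + (\<Sum>r=1..B. (fps_X ^ (2 * r ^ 2 + r) + fps_X ^ (2 * r ^ 2 - r)) *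
          (fps_X ^ (2 * r) * inverse ((1 - fps_X ^ (2 * r)) ^ 2)) * fps_theta_ratio B r)"
proof -
  have e: "fps_to_fls (fps_X ^ (2 * r ^ 2 + r) + fps_X ^ (2 * r ^ 2 - r)) =
    fls_X ^ (2 * r ^ 2) * ((fls_X :: rat fls) ^ r + 1 / fls_X ^ r)" for r :: nat
  proof -
    have "r \<le> 2 * r ^ 2" by (simp add: power2_eq_square)
    then have *: "z ^ (2 * r ^ 2 + r) + z ^ (2 * r ^ 2 - r) = z ^ (2 * r ^ 2) * (z ^ r + 1 / z ^ r)"
      if "z \<noteq> 0" for z :: "rat fls"
      using that by (simp add: power_diff power_add algebra_simps)
    show ?thesis
      unfolding fps_to_fls_plus fps_to_fls_power fps_X_to_fls by (rule *) (rule fls_q.q0)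
  qed
  have i: "fps_to_fls (fps_X ^ (2 * r) * inverse ((1 - fps_X ^ (2 * r)) ^ 2)) =
     (fls_X :: rat fls) ^ (2 * r) / (1 - fls_X ^ (2 * r)) ^ 2" if "r \<in> {1..B}" for r
    using that by (simp add: fls_times_fps_to_fls fps_to_fls_power fps_to_fls_inverse divide_inverse)
  have p: "fps_to_fls (\<Prod>k\<in>{n<..B}. (1 - fps_X ^ (2 * k - 1)) * inverse (1 - fps_X ^ (2 * k)))
     = (\<Prod>k\<in>{n<..B}. (1 - (fls_X :: rat fls) ^ (2 * k - 1)) / (1 - fls_X ^ (2 * k)))" for n
    unfolding fps_to_fls_prod
    by (rule prod.cong)
       (auto simp: fls_times_fps_to_fls fps_to_fls_power fps_to_fls_inverse divide_inverse)
  have f: "fps_to_fls (fpart B) = (\<Sum>n=1..B. (fls_X :: rat fls) ^ (2 * n) / (1 - fls_X ^ (2 * n)) ^ 2 *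
     (\<Prod>k\<in>{n<..B}. (1 - fls_X ^ (2 * k - 1)) / (1 - fls_X ^ (2 * k))))"
    unfolding fpart_def fps_to_fls_sum
  proof (rule sum.cong[OF refl])
    fix n assume n: "n \<in> {1..B}"
    show "fps_to_fls (fps_X ^ (2 * n) * inverse ((1 - fps_X ^ (2 * n)) ^ 2) *
        (\<Prod>k\<in>{n<..B}. (1 - fps_X ^ (2 * k - 1)) * inverse (1 - fps_X ^ (2 * k))))
      = (fls_X :: rat fls) ^ (2 * n) / (1 - fls_X ^ (2 * n)) ^ 2 *
        (\<Prod>k\<in>{n<..B}. (1 - fls_X ^ (2 * k - 1)) / (1 - fls_X ^ (2 * k)))"
      by (simp only: fls_times_fps_to_fls[of "_ * _" "prod _ _"] i[OF n] p)
  qed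
  have g: "fps_to_fls (fps_theta_ratio B 0 + (\<Sum>r=1..B. (fps_X ^ (2 * r ^ 2 + r) + fps_X ^ (2 * r ^ 2 - r)) * fps_theta_ratio B r))
    = fls_q.theta_ratio B 0 + (\<Sum>r=1..B. fls_X ^ (2 * r ^ 2) * ((fls_X :: rat fls) ^ r + 1 / fls_X ^ r) * fls_q.theta_ratio B r)"
    unfolding fps_to_fls_plus[of "fps_theta_ratio B 0"] fps_to_fls_sum fls_times_fps_to_fls e fps_to_fls_fps_theta_ratio by (rule refl)
  have h: "fps_to_fls (\<Sum>n=1..B. fps_X ^ (2 * n) * inverse ((1 - fps_X ^ (2 * n)) ^ 2))
     = (\<Sum>n=1..B. (fls_X :: rat fls) ^ (2 * n) / (1 - fls_X ^ (2 * n)) ^ 2)"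
    unfolding fps_to_fls_sum by (rule sum.cong[OF refl]) (rule i)
  have k: "fps_to_fls (\<Sum>r=1..B. (fps_X ^ (2 * r ^ 2 + r) + fps_X ^ (2 * r ^ 2 - r)) *
          (fps_X ^ (2 * r) * inverse ((1 - fps_X ^ (2 * r)) ^ 2)) * fps_theta_ratio B r)
     = (\<Sum>r=1..B. fls_X ^ (2 * r ^ 2) * ((fls_X :: rat fls) ^ r + 1 / fls_X ^ r) *
         (fls_X ^ (2 * r) / (1 - fls_X ^ (2 * r)) ^ 2) * fls_q.theta_ratio B r)"
    unfolding fps_to_fls_sum
  proof (rule sum.cong[OF refl])
    fix r assume r: "r \<in> {1..B}"
    show "fps_to_fls ((fps_X ^ (2 * r ^ 2 + r) + fps_X ^ (2 * r ^ 2 - r)) *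
          (fps_X ^ (2 * r) * inverse ((1 - fps_X ^ (2 * r)) ^ 2)) * fps_theta_ratio B r)
      = fls_X ^ (2 * r ^ 2) * ((fls_X :: rat fls) ^ r + 1 / fls_X ^ r) *
         (fls_X ^ (2 * r) / (1 - fls_X ^ (2 * r)) ^ 2) * fls_q.theta_ratio B r"
      by (simp only: fls_times_fps_to_fls[of _ "fps_theta_ratio B r"] fls_times_fps_to_fls[of "_ + _"] i[OF r] e fps_to_fls_fps_theta_ratio)
  qed
  show ?thesis
    unfolding fps_to_fls_eq_iff[symmetric] fls_times_fps_to_fls[of "fpart B"] g f
      fps_to_fls_plus[of "sum _ _" "sum _ _"] h k
    by (rule fls_q.finite_identity)
qed

section \<open>The limit of the finite identity\<close>

lemma fsum_Suc:
  fixes g :: "nat \<Rightarrow> 'a::comm_ring_1 fps"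
  assumes "fsummable g"
  shows "fsum g = g 0 + fsum (\<lambda>l. g (Suc l))"
proof -
  let ?a = "\<lambda>l::nat. if l = 0 then g 0 else 0" and ?b = "\<lambda>l::nat. if l = 0 then 0 else g l"
  have a: "fsummable ?a" by (rule fsummable_finite) (rule finite_subset[of _ "{0}"], auto)
  have b: "fsummable ?b"
    by (rule fsummableI[where S = "\<lambda>N. {i. g i $ N \<noteq> 0}"]) (use assms in \<open>auto simp: fsummable_def split: if_splits\<close>)
  have "fsum g = fsum (\<lambda>l. ?a l + ?b l)" by (rule arg_cong[of _ _ fsum]) auto
  also have "\<dots> = fsum ?a + fsum ?b" by (rule fsum_add[OF a b])
  also have "fsum ?a = g 0" using fsum_finite[of "{0}" ?a] by simp
  also have "fsum ?b = fsum (\<lambda>l. g (Suc l))"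
    by (rule fsum_reindex[where h = "\<lambda>l. l - 1" and A = "{0<..}" and B = UNIV])
       (auto intro!: bij_betwI[where g = Suc])
  finally show ?thesis .
qed

lemma fsummable_powser:
  fixes c :: "nat \<Rightarrow> 'a::comm_ring_1 fps"
  assumes "d > 0"
  shows "fsummable (\<lambda>l. c l * fps_X ^ (d * l))"
proof -
  have "{l. d * l \<le> N} \<subseteq> {..N}" for N
  proof
    fix l assume "l \<in> {l. d * l \<le> N}"
    then have "d * l \<le> N" by simp
    moreover have "l \<le> d * l" using assms by (cases d) auto
    ultimately have "l \<le> N" by (meson le_trans)
    then show "l \<in> {..N}" by simp
  qed
  then have "finite {l. d * l \<le> N}" for N by (meson finite_atMost finite_subset)
  from fsummable_X_power[OF this, of c] show ?thesis by (simp add: mult.commute)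
qed

text \<open>Multiplication by \<open>1 - q^d\<close> takes first differences of \<open>c\<close>:
  from \<open>l + 1\<close> to 1, and from 1 to 0.\<close>

lemma one_minus_mult_powser:
  fixes c :: "nat \<Rightarrow> 'a::comm_ring_1 fps"
  assumes "d > 0"
  shows "(1 - fps_X ^ d) * fsum (\<lambda>l. c l * fps_X ^ (d * l))
    = c 0 + fsum (\<lambda>l. (c (Suc l) - c l) * fps_X ^ (d * Suc l))"
proof -
  note s = fsummable_powser[OF assms]
  have s': "fsummable (\<lambda>l. c (Suc l) * fps_X ^ (d * Suc l))"
    using fsummable_comp[OF s[of c], of Suc] by simp
  have s'': "fsummable (\<lambda>l. c l * fps_X ^ (d * Suc l))"
    using fsummable_mult_right[OF s[of c], of "\<lambda>_. fps_X ^ d"] by (simp add: power_add algebra_simps)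
  have "(1 - fps_X ^ d) * fsum (\<lambda>l. c l * fps_X ^ (d * l))
     = fsum (\<lambda>l. c l * fps_X ^ (d * l)) - fps_X ^ d * fsum (\<lambda>l. c l * fps_X ^ (d * l))"
    by (simp add: algebra_simps)
  also have "\<dots> = c 0 + fsum (\<lambda>l. c (Suc l) * fps_X ^ (d * Suc l)) - fsum (\<lambda>l. c l * fps_X ^ (d * Suc l))"
    using fsum_Suc[OF s[of c]] fsum_cmult[OF s[of c], of "fps_X ^ d"] by (simp add: power_add mult_ac)
  also have "\<dots> = c 0 + fsum (\<lambda>l. (c (Suc l) - c l) * fps_X ^ (d * Suc l))"
    using fsum_diff[OF s' s''] by (simp add: left_diff_distrib)
  finally show ?thesis .
qed

lemma geometric_sq:
  assumes "d > 0"
  shows "inverse ((1 - fps_X ^ d) ^ 2) = (fsum (\<lambda>l. of_nat (l + 1) * fps_X ^ (d * l)) :: rat fps)"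
proof -
  have "fsum (\<lambda>l. (1 - 1) * fps_X ^ (d * Suc l)) = (0 :: rat fps)"
    by (simp add: fsum_def fps_eq_iff)
  then have 1: "(1 - fps_X ^ d) * fsum (\<lambda>l. 1 * fps_X ^ (d * l)) = (1 :: rat fps)"
    using one_minus_mult_powser[OF assms, of "\<lambda>_. 1 :: rat fps"] by simp
  have "(1 - fps_X ^ d) * fsum (\<lambda>l. of_nat (l + 1) * fps_X ^ (d * l)) = fsum (\<lambda>l. 1 * fps_X ^ (d * l) :: rat fps)"
    unfolding one_minus_mult_powser[OF assms, of "\<lambda>l. of_nat (l + 1) :: rat fps"]
      fsum_Suc[OF fsummable_powser[OF assms, of "\<lambda>_. 1 :: rat fps"]] by simp
  then have "(1 - fps_X ^ d) ^ 2 * fsum (\<lambda>l. of_nat (l + 1) * fps_X ^ (d * l)) = (1 :: rat fps)"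
    using 1 by (simp add: power2_eq_square mult.assoc)
  moreover have "inverse ((1 - fps_X ^ d) ^ 2 :: rat fps) * (1 - fps_X ^ d) ^ 2 = 1"
    by (rule inverse_mult_eq_1) (use assms in simp)
  ultimately have "inverse ((1 - fps_X ^ d) ^ 2) = inverse ((1 - fps_X ^ d) ^ 2) *
      ((1 - fps_X ^ d) ^ 2 * fsum (\<lambda>l. of_nat (l + 1) * fps_X ^ (d * l) :: rat fps))"
    by simp
  also have "\<dots> = fsum (\<lambda>l. of_nat (l + 1) * fps_X ^ (d * l))"
    unfolding mult.assoc[symmetric] \<open>inverse _ * _ = 1\<close> by simp
  finally show ?thesis .
qed

text \<open>Since \<open>(l + 1) + l = 2 l + 1\<close>, this is the origin of the odd weights in
  \<open>lam\<close>.\<close>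

lemma one_plus_geometric_sq:
  assumes "d > 0"
  shows "(1 + fps_X ^ d) * inverse ((1 - fps_X ^ d) ^ 2) = (fsum (\<lambda>l. of_nat (2 * l + 1) * fps_X ^ (d * l)) :: rat fps)"
proof -
  note s = fsummable_powser[OF assms]
  have s'': "fsummable (\<lambda>l. of_nat (l + 1) * fps_X ^ (d * Suc l) :: rat fps)"
    using fsummable_mult_right[OF s[of "\<lambda>l. of_nat (l + 1)"], of "\<lambda>_. fps_X ^ d"] by (simp add: power_add algebra_simps)
  have "fsum (\<lambda>l. of_nat l * fps_X ^ (d * l) :: rat fps) = fsum (\<lambda>l. of_nat (l + 1) * fps_X ^ (d * Suc l))"
    unfolding fsum_Suc[OF s[of of_nat]] by simp
  also have "\<dots> = fps_X ^ d * fsum (\<lambda>l. of_nat (l + 1) * fps_X ^ (d * l))"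
    unfolding fsum_cmult[OF s[of "\<lambda>l. of_nat (l + 1)"], of "fps_X ^ d", symmetric] by (simp add: power_add mult_ac)
  finally have "(1 + fps_X ^ d) * inverse ((1 - fps_X ^ d) ^ 2) =
     (fsum (\<lambda>l. of_nat (l + 1) * fps_X ^ (d * l)) + fsum (\<lambda>l. of_nat l * fps_X ^ (d * l)) :: rat fps)"
    unfolding geometric_sq[OF assms] by (simp add: algebra_simps)
  also have "\<dots> = fsum (\<lambda>l. of_nat (l + 1) * fps_X ^ (d * l) + of_nat l * fps_X ^ (d * l))"
    by (rule fsum_add[symmetric]) (rule s)+
  also have "(\<lambda>l. of_nat (l + 1) * fps_X ^ (d * l) + of_nat l * fps_X ^ (d * l) :: rat fps) =
      (\<lambda>l. of_nat (2 * l + 1) * fps_X ^ (d * l))"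
    by (rule ext) (simp add: algebra_simps)
  finally show ?thesis .
qed

definition psi :: "'a::comm_ring_1 fps" where
  "psi = fsum (\<lambda>n::int. fps_X ^ nat (2 * n ^ 2 + n))"

definition lam :: "nat \<Rightarrow> 'a::comm_ring_1 fps" where
  "lam k = fsum (\<lambda>(n, j). of_nat ((2 * j + 1) ^ k) * fps_X ^ (Suc n * (2 * Suc n + 2 * j + 1)))"

text \<open>Equals \<open>\<Sum> sigma_k(n) q^(b n)\<close>: for odd \<open>k\<close>, up to
  scaling, the Eisenstein series of weight \<open>k + 1\<close> at \<open>q^b\<close> without its
  constant term.\<close>

definition eis :: "nat \<Rightarrow> nat \<Rightarrow> 'a::comm_ring_1 fps" where
  "eis b k = fsum (\<lambda>(m, l). of_nat (Suc m ^ k) * fps_X ^ (b * (Suc m * Suc l)))"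

lemma fsummable_X_power_bounded:
  fixes b :: "'i \<Rightarrow> 'a::comm_ring_1 fps"
  assumes "\<And>N i. e i \<le> N \<Longrightarrow> i \<in> S N" "\<And>N. finite (S N)"
  shows "fsummable (\<lambda>i. b i * fps_X ^ e i)"
proof -
  have "finite {i. e i \<le> N}" for N by (rule finite_subset[OF _ assms(2)[of N]]) (use assms(1) in auto)
  from fsummable_X_power[OF this, of b] show ?thesis by (simp add: mult.commute)
qed

text \<open>Shows both that \<open>nat\<close> loses nothing in the exponents of \<open>psi\<close>
  and that few exponents lie below a bound.\<close>

lemma abs_le_quadratic: "\<bar>n\<bar> \<le> 2 * n ^ 2 + (n::int)"
proof -
  have "\<bar>n\<bar> * 1 \<le> \<bar>n\<bar> * \<bar>n\<bar>" if "n \<noteq> 0" by (rule mult_left_mono) (use that in auto)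
  then have "\<bar>n\<bar> \<le> n ^ 2" by (cases "n = 0") (auto simp: power2_eq_square abs_mult)
  then show ?thesis by linarith
qed

lemma fsummable_psi: "fsummable (\<lambda>n::int. b n * fps_X ^ nat (2 * n ^ 2 + n) :: 'a::comm_ring_1 fps)"
proof (rule fsummable_X_power_bounded[where S = "\<lambda>N. {- int N..int N}"])
  fix N and n :: int
  assume "nat (2 * n ^ 2 + n) \<le> N"
  then show "n \<in> {- int N..int N}" using abs_le_quadratic[of n] by auto
qed simp

lemma fsummable_lam: "fsummable (\<lambda>(n, j). b n j * fps_X ^ (Suc n * (2 * Suc n + 2 * j + 1)) :: 'a::comm_ring_1 fps)"
proof -
  have "fsummable (\<lambda>p. (case p of (n, j) \<Rightarrow> b n j) * fps_X ^ (case p of (n, j) \<Rightarrow> Suc n * (2 * Suc n + 2 * j + 1)) :: 'a fps)"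
  proof (rule fsummable_X_power_bounded[where S = "\<lambda>N. {..N} \<times> {..N}"])
    fix N and p :: "nat \<times> nat"
    assume "(case p of (n, j) \<Rightarrow> Suc n * (2 * Suc n + 2 * j + 1)) \<le> N"
    then show "p \<in> {..N} \<times> {..N}"
      by (cases p) (auto simp: algebra_simps)
  qed simp
  then show ?thesis by (simp add: case_prod_unfold)
qed

lemma fsummable_eis: "b > 0 \<Longrightarrow> fsummable (\<lambda>(m, l). c m l * fps_X ^ (b * (Suc m * Suc l)) :: 'a::comm_ring_1 fps)"
proof -
  assume b: "b > 0"
  have "fsummable (\<lambda>p. (case p of (m, l) \<Rightarrow> c m l) * fps_X ^ (case p of (m, l) \<Rightarrow> b * (Suc m * Suc l)) :: 'a fps)"
  proof (rule fsummable_X_power_bounded[where S = "\<lambda>N. {..N} \<times> {..N}"])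
    fix N and p :: "nat \<times> nat"
    assume *: "(case p of (m, l) \<Rightarrow> b * (Suc m * Suc l)) \<le> N"
    obtain m l where p: "p = (m, l)" by (cases p)
    have "1 * (Suc m * Suc l) \<le> b * (Suc m * Suc l)" by (rule mult_le_mono1) (use b in simp)
    then show "p \<in> {..N} \<times> {..N}" using * by (auto simp: p)
  qed simp
  then show ?thesis by (simp add: case_prod_unfold)
qed

section \<open>Passage to the limit modulo powers of \<open>q\<close>\<close>

lemma X_power_dvd_iff: "fps_X ^ m dvd (f :: rat fps) \<longleftrightarrow> (\<forall>k<m. f $ k = 0)"
proof
  assume "fps_X ^ m dvd f"
  then show "\<forall>k<m. f $ k = 0" by (auto simp: dvd_def fps_X_power_mult_nth)
next
  assume "\<forall>k<m. f $ k = 0"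
  then have "f = fps_X ^ m * fps_shift m f"
    by (auto simp: fps_eq_iff fps_X_power_mult_nth)
  then show "fps_X ^ m dvd f" by (rule dvdI)
qed

lemma dvd_mult_minus_1:
  fixes a b d :: "'a::comm_ring_1"
  assumes "d dvd a - 1" "d dvd b - 1"
  shows "d dvd a * b - 1"
proof -
  have "a * b - 1 = (a - 1) * b + (b - 1)" by (simp add: algebra_simps)
  then show ?thesis using assms by (metis dvd_add dvd_mult2)
qed

lemma dvd_inverse_minus_1:
  fixes a d :: "rat fps"
  assumes "d dvd a - 1" "a $ 0 = 1"
  shows "d dvd inverse a - 1"
proof -
  have "inverse a - 1 = - inverse a * (a - 1)"
    using inverse_mult_eq_1[of a] assms(2) by (simp add: algebra_simps)
  then show ?thesis using assms(1) by (metis dvd_mult)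
qed

lemma qpoch_shift:
  "\<exists>z. qpoch fps_X (m + k) = qpoch fps_X m * z \<and> z $ 0 = 1 \<and> (fps_X :: rat fps) ^ (2 * m + 2) dvd z - 1"
proof (induction k)
  case 0
  then show ?case by (intro exI[of _ 1]) simp
next
  case (Suc k)
  then obtain z where z: "qpoch fps_X (m + k) = qpoch fps_X m * z" "z $ 0 = 1"
    "(fps_X :: rat fps) ^ (2 * m + 2) dvd z - 1" by blast
  have "(fps_X :: rat fps) ^ (2 * m + 2) dvd (1 - fps_X ^ (2 * (m + k) + 2)) - 1"
    by (simp add: X_power_dvd_iff)
  from dvd_mult_minus_1[OF z(3) this] z(1,2) show ?case
    by (intro exI[of _ "z * (1 - fps_X ^ (2 * (m + k) + 2))"]) (simp add: qpoch_Suc mult_ac)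
qed

text \<open>The ratio is \<open>z / y\<close>, where \<open>z\<close> collects the factors between
  \<open>B - r\<close> and \<open>B\<close>, and \<open>y\<close> those between \<open>B\<close> and
  \<open>B + r\<close>.\<close>

lemma fps_theta_ratio_approx:
  assumes "r \<le> B"
  shows "fps_X ^ (2 * (B - r) + 2) dvd fps_theta_ratio B r - 1"
proof -
  obtain z where z: "qpoch fps_X (B - r + r) = qpoch fps_X (B - r) * z" "z $ 0 = 1"
    "(fps_X :: rat fps) ^ (2 * (B - r) + 2) dvd z - 1" using qpoch_shift by blast
  obtain y where y: "qpoch fps_X (B + r) = qpoch fps_X B * y" "y $ 0 = 1"
    "(fps_X :: rat fps) ^ (2 * B + 2) dvd y - 1" using qpoch_shift by blast
  have "(fps_X :: rat fps) ^ (2 * (B - r) + 2) dvd fps_X ^ (2 * B + 2)"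
    by (rule le_imp_power_dvd) simp
  then have y': "(fps_X :: rat fps) ^ (2 * (B - r) + 2) dvd y - 1" using y(3) dvd_trans by blast
  define u v where "u = (qpoch fps_X (B - r) :: rat fps)" and "v = (qpoch fps_X B :: rat fps)"
  have v: "v = u * z" using z(1) assms by (simp add: u_def v_def)
  have u0: "inverse u * u = 1" "inverse v * v = 1"
    by (rule inverse_mult_eq_1; simp add: u_def v_def)+
  have "fps_theta_ratio B r = v * v * (inverse u * (inverse v * inverse y))"
    unfolding fps_theta_ratio_def y(1) by (simp add: fps_inverse_mult u_def v_def power2_eq_square mult_ac)
  also have "\<dots> = (inverse v * v) * (inverse u * v) * inverse y" by (simp only: mult_ac)
  also have "\<dots> = (inverse u * u) * z * inverse y"
    unfolding u0(2) by (simp only: v mult_ac mult_1)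
  finally have "fps_theta_ratio B r = z * inverse y" unfolding u0 by simp
  then show ?thesis
    using dvd_mult_minus_1[OF z(3) dvd_inverse_minus_1[OF y' y(2)]] by simp
qed

lemma psi_nth:
  assumes "N \<le> B"
  shows "psi $ N = (1 + (\<Sum>r=1..B. fps_X ^ (2 * r ^ 2 + r) + fps_X ^ (2 * r ^ 2 - r)) :: rat fps) $ N"
proof -
  have split: "(\<Sum>n\<in>{- int B..int B}. g n) = g 0 + (\<Sum>r=1..B. g (int r) + g (- int r))" for g :: "int \<Rightarrow> rat fps" and B
  proof (induction B)
    case (Suc B)
    have "{- int (Suc B)..int (Suc B)} = insert (int (Suc B)) (insert (- int (Suc B)) {- int B..int B})" by auto
    then have "(\<Sum>n\<in>{- int (Suc B)..int (Suc B)}. g n) = g (int (Suc B)) + (g (- int (Suc B)) + (\<Sum>n\<in>{- int B..int B}. g n))"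
      by simp
    with Suc show ?case by (simp add: algebra_simps)
  qed simp
  have e: "nat (2 * (- int r) ^ 2 + - int r) = 2 * r ^ 2 - r" "nat (2 * (int r) ^ 2 + int r) = 2 * r ^ 2 + r" for r
    by (simp_all add: nat_diff_distrib' nat_mult_distrib nat_power_eq nat_add_distrib)
  have "psi $ N = (\<Sum>n\<in>{- int B..int B}. (fps_X ^ nat (2 * n ^ 2 + n) :: rat fps) $ N)"
    unfolding psi_def
  proof (rule fsum_nth)
    fix n :: int assume "(fps_X ^ nat (2 * n ^ 2 + n) :: rat fps) $ N \<noteq> 0"
    then have "N = nat (2 * n ^ 2 + n)" by (simp split: if_splits)
    then show "n \<in> {- int B..int B}" using abs_le_quadratic[of n] assms by auto
  qed simp
  also have "\<dots> = (\<Sum>n\<in>{- int B..int B}. fps_X ^ nat (2 * n ^ 2 + n) :: rat fps) $ N"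
    by (simp add: fps_sum_nth)
  also have "(\<Sum>n\<in>{- int B..int B}. fps_X ^ nat (2 * n ^ 2 + n) :: rat fps) =
     1 + (\<Sum>r=1..B. fps_X ^ (2 * r ^ 2 + r) + fps_X ^ (2 * r ^ 2 - r))"
    unfolding split e by simp
  finally show ?thesis .
qed

lemma fsum_nth_initial:
  fixes g :: "nat \<Rightarrow> rat fps"
  assumes "N \<le> B" "\<And>n. fps_X ^ Suc n dvd g n"
  shows "fsum g $ N = (\<Sum>n<B. g n) $ N"
  unfolding fps_sum_nth
proof (rule fsum_nth)
  fix n assume "g n $ N \<noteq> 0"
  then have "\<not> N < Suc n" using assms(2)[of n, unfolded X_power_dvd_iff] by blast
  then show "n \<in> {..<B}" using assms(1) by auto
qed simp

lemma eis_2_1: "eis 2 1 = fsum (\<lambda>n. fps_X ^ (2 * Suc n) * inverse ((1 - fps_X ^ (2 * Suc n)) ^ 2) :: rat fps)"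
proof -
  have "fps_X ^ (2 * Suc n) * inverse ((1 - fps_X ^ (2 * Suc n)) ^ 2)
    = (fsum (\<lambda>m. of_nat (Suc m) * fps_X ^ (2 * (Suc m * Suc n))) :: rat fps)" for n
  proof -
    have "fsum (\<lambda>m. fps_X ^ (2 * Suc n) * (of_nat (m + 1) * fps_X ^ (2 * Suc n * m)) :: rat fps)
      = fps_X ^ (2 * Suc n) * fsum (\<lambda>m. of_nat (m + 1) * fps_X ^ (2 * Suc n * m))"
      by (rule fsum_cmult) (rule fsummable_powser, simp)
    moreover have "(\<lambda>m. fps_X ^ (2 * Suc n) * (of_nat (m + 1) * fps_X ^ (2 * Suc n * m)) :: rat fps) =
       (\<lambda>m. of_nat (Suc m) * fps_X ^ (2 * (Suc m * Suc n)))"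
    proof
      fix m
      have "2 * (Suc m * Suc n) = 2 * Suc n + 2 * Suc n * m" by (simp add: algebra_simps)
      then show "fps_X ^ (2 * Suc n) * (of_nat (m + 1) * fps_X ^ (2 * Suc n * m) :: rat fps)
        = of_nat (Suc m) * fps_X ^ (2 * (Suc m * Suc n))"
        by (simp only: power_add mult_ac Suc_eq_plus1)
    qed
    ultimately show ?thesis
      using geometric_sq[of "2 * Suc n"] by (simp only:) simp
  qed
  moreover have "fsummable (\<lambda>(m, l). of_nat (Suc m) * fps_X ^ (2 * (Suc m * Suc l)) :: rat fps)"
    using fsummable_eis[of 2 "\<lambda>m l. of_nat (Suc m)"] by simp
  ultimately show ?thesis
    unfolding eis_def by (simp only: fsum_swap[symmetric] fsum_pair[symmetric] power_one_right)
qed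

text \<open>The factor \<open>q^(2 r)\<close> merges the two theta terms into
  \<open>q^(2 r^2 + r) (1 + q^(2 r))\<close>, which suits
  \<open>one_plus_geometric_sq\<close>.\<close>

lemma lam_1: "lam 1 = fsum (\<lambda>n. (fps_X ^ (2 * Suc n ^ 2 + Suc n) + fps_X ^ (2 * Suc n ^ 2 - Suc n)) *
          (fps_X ^ (2 * Suc n) * inverse ((1 - fps_X ^ (2 * Suc n)) ^ 2)) :: rat fps)"
proof -
  have "(fps_X ^ (2 * r ^ 2 + r) + fps_X ^ (2 * r ^ 2 - r)) *
          (fps_X ^ (2 * r) * inverse ((1 - fps_X ^ (2 * r)) ^ 2))
    = (fsum (\<lambda>j. of_nat (2 * j + 1) * fps_X ^ (r * (2 * r + 2 * j + 1))) :: rat fps)" if "r = Suc n" for r n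
  proof -
    have "r \<le> 2 * r ^ 2" by (simp add: power2_eq_square)
    then have "(fps_X ^ (2 * r ^ 2 + r) + fps_X ^ (2 * r ^ 2 - r)) * fps_X ^ (2 * r) =
       (fps_X ^ (2 * r ^ 2 + r) * (1 + fps_X ^ (2 * r)) :: rat fps)"
      by (simp add: algebra_simps flip: power_add)
    then have "(fps_X ^ (2 * r ^ 2 + r) + fps_X ^ (2 * r ^ 2 - r)) *
          (fps_X ^ (2 * r) * inverse ((1 - fps_X ^ (2 * r)) ^ 2))
       = fps_X ^ (2 * r ^ 2 + r) * ((1 + fps_X ^ (2 * r)) * inverse ((1 - fps_X ^ (2 * r)) ^ 2) :: rat fps)"
      by (simp only: mult.assoc[symmetric])
    also have "\<dots> = fps_X ^ (2 * r ^ 2 + r) * fsum (\<lambda>l. of_nat (2 * l + 1) * fps_X ^ (2 * r * l))"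
      using one_plus_geometric_sq[of "2 * r"] that by simp
    also have "\<dots> = fsum (\<lambda>l. fps_X ^ (2 * r ^ 2 + r) * (of_nat (2 * l + 1) * fps_X ^ (2 * r * l)))"
      by (rule fsum_cmult[symmetric]) (rule fsummable_powser, use that in simp)
    also have "(\<lambda>l. fps_X ^ (2 * r ^ 2 + r) * (of_nat (2 * l + 1) * fps_X ^ (2 * r * l)) :: rat fps)
       = (\<lambda>j. of_nat (2 * j + 1) * fps_X ^ (r * (2 * r + 2 * j + 1)))"
    proof
      fix l
      have "r * (2 * r + 2 * l + 1) = (2 * r ^ 2 + r) + 2 * r * l"
        by (simp add: algebra_simps power2_eq_square)
      then show "fps_X ^ (2 * r ^ 2 + r) * (of_nat (2 * l + 1) * fps_X ^ (2 * r * l) :: rat fps)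
        = of_nat (2 * l + 1) * fps_X ^ (r * (2 * r + 2 * l + 1))"
        by (simp only: power_add mult_ac)
    qed
    finally show ?thesis .
  qed
  moreover have "fsummable (\<lambda>(n, j). of_nat (2 * j + 1) * fps_X ^ (Suc n * (2 * Suc n + 2 * j + 1)) :: rat fps)"
    using fsummable_lam[of "\<lambda>n j. of_nat (2 * j + 1)"] by simp
  ultimately show ?thesis
    unfolding lam_def by (simp only: fsum_pair[symmetric] power_one_right)
qed

text \<open>For \<open>r\<close> near \<open>B\<close> the ratio is far from 1, but it is multiplied
  by \<open>q^(2 r^2 - r)\<close>; the orders \<open>2 r^2 - r\<close> and
  \<open>2 (B - r) + 2\<close> always add up to more than \<open>B\<close>, so below that degree
  every ratio may be replaced by 1.\<close>

lemma psi_mult_limit: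
  assumes F: "\<And>B N. N \<le> B \<Longrightarrow> F $ N = fpart B $ N"
  shows "psi * F = eis 2 1 + lam 1"
proof (rule fps_ext)
  fix N :: nat
  define B where "B = N"
  define g where "g = (\<lambda>r. fps_X ^ (2 * r ^ 2 + r) + fps_X ^ (2 * r ^ 2 - r) :: rat fps)"
  define h where "h = (\<lambda>r. fps_X ^ (2 * r) * inverse ((1 - fps_X ^ (2 * r)) ^ 2) :: rat fps)"
  have sh: "(\<Sum>r=1..B. k r) = (\<Sum>n<B. k (Suc n))" for k :: "nat \<Rightarrow> rat fps"
    by (metis One_nat_def lessThan_atLeast0 sum.shift_bounds_Suc_ivl atLeastLessThanSuc_atLeastAtMost)
  have g: "fps_X ^ Suc N dvd g r * (fps_theta_ratio B r - 1)" if "r \<in> {1..B}" for r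
  proof -
    have "fps_X ^ (2 * r ^ 2 - r) dvd g r"
      unfolding g_def by (intro dvd_add le_imp_power_dvd) auto
    with fps_theta_ratio_approx[of r B] that have "fps_X ^ (2 * r ^ 2 - r) * fps_X ^ (2 * (B - r) + 2) dvd g r * (fps_theta_ratio B r - 1)"
      by (intro mult_dvd_mono) auto
    moreover have "Suc N \<le> (2 * r ^ 2 - r) + (2 * (B - r) + 2)"
    proof -
      have "r \<le> r ^ 2" by (simp add: power2_eq_square)
      then show ?thesis using that by (auto simp: B_def)
    qed
    then have "(fps_X :: rat fps) ^ Suc N dvd fps_X ^ ((2 * r ^ 2 - r) + (2 * (B - r) + 2))"
      by (rule le_imp_power_dvd)
    ultimately show ?thesis
      unfolding power_add[of _ "2 * r ^ 2 - r"] using dvd_trans by blast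
  qed
  have t0: "fps_theta_ratio B 0 = 1"
    unfolding fps_theta_ratio_def power2_eq_square diff_zero add_0_right by (rule inverse_mult_eq_1') simp
  have E: "fpart B * (1 + (\<Sum>r=1..B. g r * fps_theta_ratio B r)) = (\<Sum>n=1..B. h n) + (\<Sum>r=1..B. g r * h r * fps_theta_ratio B r)"
    using fps_finite_identity[of B] unfolding t0 g_def h_def .
  have "fpart B * (1 + (\<Sum>r=1..B. g r)) - ((\<Sum>n=1..B. h n) + (\<Sum>r=1..B. g r * h r))
    = (\<Sum>r=1..B. h r * (g r * (fps_theta_ratio B r - 1))) - fpart B * (\<Sum>r=1..B. g r * (fps_theta_ratio B r - 1))"
    using E by (simp add: algebra_simps sum.distrib sum_subtractf)
  moreover have dv: "fps_X ^ Suc N dvd (\<Sum>r=1..B. h r * (g r * (fps_theta_ratio B r - 1))) - fpart B * (\<Sum>r=1..B. g r * (fps_theta_ratio B r - 1))"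
    by (intro dvd_diff dvd_mult dvd_sum g)
  moreover have "x $ N = y $ N" if "x - y = z" "z $ N = 0" for x y z :: "rat fps"
    using that by (metis eq_iff_diff_eq_0 fps_sub_nth)
  ultimately have D: "(fpart B * (1 + (\<Sum>r=1..B. g r))) $ N = ((\<Sum>n=1..B. h n) + (\<Sum>r=1..B. g r * h r)) $ N"
    using dv[unfolded X_power_dvd_iff, rule_format, of N] by blast
  have "(psi * F) $ N = (fpart B * (1 + (\<Sum>r=1..B. g r))) $ N"
    unfolding fps_mult_nth mult.commute[of psi]
  proof (rule sum.cong[OF refl])
    fix i assume "i \<in> {0..N}"
    then show "F $ i * psi $ (N - i) = fpart B $ i * (1 + (\<Sum>r=1..B. g r)) $ (N - i)"
      using F[of i B] psi_nth[of "N - i" B] by (simp add: B_def g_def)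
  qed
  also have "\<dots> = (eis 2 1 + lam 1) $ N"
  proof -
    have "fps_X ^ Suc n dvd h (Suc n)" for n
      unfolding h_def by (rule dvd_trans[OF le_imp_power_dvd dvd_triv_left]) simp
    moreover from this have "fps_X ^ Suc n dvd g (Suc n) * h (Suc n)" for n by simp
    ultimately have "fsum (\<lambda>n. h (Suc n)) $ N = (\<Sum>n<B. h (Suc n)) $ N"
        "fsum (\<lambda>n. g (Suc n) * h (Suc n)) $ N = (\<Sum>n<B. g (Suc n) * h (Suc n)) $ N"
      by (intro fsum_nth_initial; simp add: B_def)+
    moreover have "eis 2 1 = fsum (\<lambda>n. h (Suc n))" "lam 1 = fsum (\<lambda>n. g (Suc n) * h (Suc n))"
      unfolding eis_2_1 lam_1 h_def g_def by (rule refl)+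
    ultimately show ?thesis unfolding D unfolding sh by simp
  qed
  finally show "(psi * F) $ N = (eis 2 1 + lam 1) $ N" .
qed

section \<open>The functional equation of an Appell sum\<close>

definition alt :: "int \<Rightarrow> 'a::comm_ring_1" where
  "alt i = (if even i then 1 else - 1)"

definition tri :: "int \<Rightarrow> nat" where
  "tri i = nat (i * (i - 1) div 2)"

lemma tri_int: "2 * int (tri i) = i * (i - 1)"
proof -
  have "even (i * (i - 1))" by auto
  moreover have "0 \<le> i * (i - 1)" by (cases "i \<ge> 1") (auto intro: mult_nonpos_nonpos)
  ultimately show ?thesis by (simp add: tri_def)
qed

lemma abs_le_tri: "\<bar>i\<bar> \<le> int (tri i) + 1"
proof -
  have "0 \<le> (\<bar>i\<bar> - 1) * (\<bar>i\<bar> - 2)"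
    by (cases "\<bar>i\<bar> \<le> 1") (auto intro: mult_nonpos_nonpos)
  moreover have "\<bar>i\<bar> * \<bar>i\<bar> = i * i" by (simp add: abs_mult_self_eq)
  ultimately have "2 * \<bar>i\<bar> \<le> i * i - \<bar>i\<bar> + 2" by (simp add: algebra_simps)
  then show ?thesis using tri_int[of i] by (simp add: algebra_simps)
qed

text \<open>Coefficients of the Jacobi theta series
  \<open>\<Sum> (-1)^i q^(b i (i-1) / 2) w^(2 i)\<close>.\<close>

definition theta_coeff :: "nat \<Rightarrow> int \<Rightarrow> 'a::comm_ring_1 fps" where
  "theta_coeff b i = alt i * fps_X ^ (b * tri i)"

lemma fsummable_theta_coeff: "b > 0 \<Longrightarrow> fsummable (theta_coeff b :: int \<Rightarrow> 'a::comm_ring_1 fps)"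
  unfolding theta_coeff_def
proof (rule fsummable_X_power_bounded[where S = "\<lambda>N. {- int (N + 1)..int (N + 1)}"])
  fix N i assume "b > 0" "b * tri i \<le> N"
  then have "tri i \<le> N" by (metis le_trans mult_le_mono1 nat_mult_1 Suc_leI One_nat_def)
  then show "i \<in> {- int (N + 1)..int (N + 1)}" using abs_le_tri[of i] by auto
qed simp

lemma tri_reflect: "tri (1 - i) = tri i"
  using tri_int[of i] tri_int[of "1 - i"] by (simp add: algebra_simps)

lemma theta_coeff_reflect: "theta_coeff b (1 - i) = - theta_coeff b i"
  by (simp add: theta_coeff_def tri_reflect alt_def)

lemma bij_int_diff: "bij (\<lambda>i. a - i :: int)" "bij (\<lambda>i. i + a :: int)"
  by (rule bij_betwI[where g = "\<lambda>i. a - i"]; simp) (rule bij_betwI[where g = "\<lambda>i. i - a"]; simp)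

text \<open>The zero of the theta series at \<open>w^2 = 1\<close>: reflection
  \<open>i \<mapsto> 1 - i\<close> negates every term.\<close>

lemma fsum_theta_coeff:
  assumes "b > 0"
  shows "fsum (theta_coeff b) = (0 :: rat fps)"
proof -
  have "fsum (theta_coeff b) = fsum (\<lambda>i. theta_coeff b (1 - i) :: rat fps)"
    by (rule fsum_bij[OF bij_int_diff(1), symmetric])
  also have "\<dots> = - fsum (theta_coeff b)" by (simp add: theta_coeff_reflect fsum_uminus)
  finally show ?thesis by (simp add: eq_neg_iff_add_eq_0 flip: mult_2)
qed

text \<open>Multiplication of the formal series \<open>\<Sum> s(k) w^k\<close> by the theta series.
  It makes sense for arbitrary \<open>s\<close>, because for fixed \<open>k\<close> the theta
  coefficients alone make the sum over \<open>i\<close> locally finite.\<close>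

definition theta_op :: "(int \<Rightarrow> rat fps) \<Rightarrow> int \<Rightarrow> rat fps" where
  "theta_op s k = fsum (\<lambda>i. theta_coeff 2 i * s (k - 2 * i))"

lemma fsummable_theta_op: "fsummable (\<lambda>i. theta_coeff 2 i * s (k - 2 * i) :: rat fps)"
  by (rule fsummable_mult_right) (rule fsummable_theta_coeff, simp)

lemma theta_op_add: "theta_op (\<lambda>x. s x + t x) k = theta_op s k + theta_op t k"
  unfolding theta_op_def distrib_left by (rule fsum_add) (rule fsummable_theta_op)+

lemma theta_op_diff: "theta_op (\<lambda>x. s x - t x) k = theta_op s k - theta_op t k"
  unfolding theta_op_def right_diff_distrib by (rule fsum_diff) (rule fsummable_theta_op)+

lemma theta_op_cmult: "theta_op (\<lambda>x. c * s x) k = c * theta_op s k"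
  unfolding theta_op_def fsum_cmult[OF fsummable_theta_op, symmetric] by (simp add: mult_ac)

lemma theta_op_shift: "theta_op (\<lambda>x. s (x - a)) k = theta_op s (k - a)"
  unfolding theta_op_def by (simp add: algebra_simps)

text \<open>\<open>shift_rel s s' d e\<close> expresses \<open>q^x s(x) = e q^2 s'(x - d)\<close> with \<open>q^a\<close> multiplied in to
  avoid negative exponents.\<close>

definition shift_rel :: "(int \<Rightarrow> rat fps) \<Rightarrow> (int \<Rightarrow> rat fps) \<Rightarrow> int \<Rightarrow> rat fps \<Rightarrow> bool" where
  "shift_rel s s' d e \<longleftrightarrow> (\<forall>x a. 0 \<le> a \<longrightarrow> 0 \<le> a + x \<longrightarrow>
     fps_X ^ nat (a + x) * s x = e * (fps_X ^ nat (a + 2) * s' (x - d)))"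

text \<open>The theta series satisfies \<open>theta(q w) = - w^(-2) theta(w)\<close>, so each factor
  lowers the shift by 2 and flips the sign.\<close>

lemma shift_rel_theta_op:
  assumes "shift_rel s s' d e"
  shows "shift_rel (theta_op s) (theta_op s') (d - 2) (- e)"
  unfolding shift_rel_def
proof (intro allI impI)
  fix x a :: int assume a: "0 \<le> a" "0 \<le> a + x"
  have "fps_X ^ nat (a + x) * theta_op s x = fsum (\<lambda>i. fps_X ^ nat (a + x) * (theta_coeff 2 i * s (x - 2 * i)))"
    unfolding theta_op_def by (rule fsum_cmult[symmetric]) (rule fsummable_theta_op)
  also have "\<dots> = fsum (\<lambda>i. - e * fps_X ^ nat (a + 2) * (theta_coeff 2 (i + 1) * s' (x - (d - 2) - 2 * (i + 1))))"
  proof (rule arg_cong[of _ _ fsum], rule ext)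
    fix i
    have t: "int (2 * tri i) = i * i - i" "int (2 * tri (i + 1)) = i * i + i"
      using tri_int[of i] tri_int[of "i + 1"] by (simp_all add: algebra_simps)
    have p: "0 \<le> i * i + i" using t(2) by linarith
    have q: "0 \<le> i * i - i" using t(1) by linarith
    \<comment> \<open>The hypothesis is applied at \<open>x - 2 i\<close> with \<open>a\<close>
      raised by \<open>i^2 + i\<close>, which keeps both exponents nonnegative.\<close>
    have e1: "nat (a + x) + 2 * tri i = nat ((a + (i * i + i)) + (x - 2 * i))"
      using t a q by (simp add: nat_eq_iff2 flip: of_nat_eq_iff[where 'a = int])
    have e2: "nat (a + (i * i + i) + 2) = nat (a + 2) + 2 * tri (i + 1)"
      using t a p by (simp add: nat_eq_iff)
    have "fps_X ^ nat (a + x) * (theta_coeff 2 i * s (x - 2 * i)) = alt i * (fps_X ^ (nat (a + x) + 2 * tri i) * s (x - 2 * i))"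
      by (simp add: theta_coeff_def power_add mult_ac)
    also have "\<dots> = alt i * (e * (fps_X ^ nat (a + (i * i + i) + 2) * s' (x - 2 * i - d)))"
      unfolding e1 using assms[unfolded shift_rel_def, rule_format, of "a + (i * i + i)" "x - 2 * i"] a p q
      by simp
    also have "\<dots> = - e * fps_X ^ nat (a + 2) * (theta_coeff 2 (i + 1) * s' (x - (d - 2) - 2 * (i + 1)))"
    proof -
      have *: "x - (d - 2) - 2 * (i + 1) = x - 2 * i - d" by simp
      have "(alt (i + 1) :: rat fps) = - alt i" by (simp add: alt_def)
      then show ?thesis unfolding * e2 theta_coeff_def by (simp add: power_add mult_ac)
    qed
    finally show "fps_X ^ nat (a + x) * (theta_coeff 2 i * s (x - 2 * i)) =
      - e * fps_X ^ nat (a + 2) * (theta_coeff 2 (i + 1) * s' (x - (d - 2) - 2 * (i + 1)))" .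
  qed
  also have "\<dots> = fsum (\<lambda>j. - e * fps_X ^ nat (a + 2) * (theta_coeff 2 j * s' (x - (d - 2) - 2 * j)))"
    by (rule fsum_bij[OF bij_int_diff(2)])
  also have "\<dots> = - e * fps_X ^ nat (a + 2) * theta_op s' (x - (d - 2))"
    unfolding theta_op_def by (rule fsum_cmult) (rule fsummable_theta_op)
  finally show "fps_X ^ nat (a + x) * theta_op s x = - e * (fps_X ^ nat (a + 2) * theta_op s' (x - (d - 2)))"
    by (simp add: mult.assoc)
qed

text \<open>The theta coefficients are odd under \<open>i \<mapsto> 1 - i\<close>: the centre of
  symmetry moves by one and the sign flips.\<close>

lemma theta_op_reflect:
  assumes "\<And>x. s' (d - x) = e * s x"
  shows "theta_op s' (d + 2 - x) = - e * theta_op s x"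
proof -
  have "theta_op s' (d + 2 - x) = fsum (\<lambda>i. theta_coeff 2 (1 - i) * s' (d + 2 - x - 2 * (1 - i)))"
    unfolding theta_op_def by (rule fsum_bij[OF bij_int_diff(1), symmetric])
  also have "\<dots> = fsum (\<lambda>i. - e * (theta_coeff 2 i * s (x - 2 * i)))"
  proof (rule arg_cong[of _ _ fsum], rule ext)
    fix i
    have *: "d + 2 - x - 2 * (1 - i) = d - (x - 2 * i)" by simp
    show "theta_coeff 2 (1 - i) * s' (d + 2 - x - 2 * (1 - i)) = - e * (theta_coeff 2 i * s (x - 2 * i))"
      unfolding * assms[of "x - 2 * i"] by (simp add: theta_coeff_reflect)
  qed
  also have "\<dots> = - e * theta_op s x"
    unfolding theta_op_def by (rule fsum_cmult) (rule fsummable_theta_op)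
  finally show ?thesis .
qed

lemma theta_op_even:
  assumes "\<And>x. even x \<Longrightarrow> s x = 0" "even x"
  shows "theta_op s x = 0"
proof -
  have "(\<lambda>i. theta_coeff 2 i * s (x - 2 * i)) = (\<lambda>_. 0)"
    using assms by (intro ext) simp
  then show ?thesis by (simp add: theta_op_def fsum_def fps_eq_iff)
qed

definition odd_pow :: "nat \<Rightarrow> int \<Rightarrow> rat fps" where
  "odd_pow r x = (if odd x then of_int (x ^ r) else 0)"

text \<open>As the theta coefficients sum to 0, convolution lowers the degree of a polynomial on the
  odd integers by one; \<open>K1\<close> and \<open>K2\<close> are the first two moments.\<close>

lemma theta_op_odd_pow:
  defines "K1 \<equiv> fsum (\<lambda>i. theta_coeff 2 i * of_int (2 * i) :: rat fps)"
    and "K2 \<equiv> fsum (\<lambda>i. theta_coeff 2 i * of_int (4 * i ^ 2) :: rat fps)"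
  shows "theta_op (odd_pow 0) x = 0"
    "theta_op (odd_pow 1) x = - K1 * odd_pow 0 x"
    "theta_op (odd_pow 2) x = - 2 * K1 * odd_pow 1 x + K2 * odd_pow 0 x"
proof -
  have s: "fsummable (\<lambda>i. theta_coeff 2 i * b i :: rat fps)" for b
    by (rule fsummable_mult_right) (rule fsummable_theta_coeff, simp)
  have z: "fsum (\<lambda>i. theta_coeff 2 i * c :: rat fps) = 0" for c
    using fsum_cmult_right[OF fsummable_theta_coeff[of 2], of c] fsum_theta_coeff[of 2] by simp
  show "theta_op (odd_pow 0) x = 0"
    using z[of "odd_pow 0 x"] by (simp add: theta_op_def odd_pow_def cong: if_cong)
  have "theta_op (odd_pow 1) x = fsum (\<lambda>i. theta_coeff 2 i * odd_pow 1 x - (theta_coeff 2 i * of_int (2 * i)) * odd_pow 0 x)"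
    unfolding theta_op_def by (rule arg_cong[of _ _ fsum]) (auto simp: odd_pow_def algebra_simps)
  also have "\<dots> = - K1 * odd_pow 0 x"
    unfolding fsum_diff[OF s fsummable_mult_right[OF s]] z fsum_cmult_right[OF s] K1_def by simp
  finally show "theta_op (odd_pow 1) x = - K1 * odd_pow 0 x" .
  have "theta_op (odd_pow 2) x = fsum (\<lambda>i. (theta_coeff 2 i * odd_pow 2 x - (theta_coeff 2 i * of_int (2 * i)) * (2 * odd_pow 1 x))
      + (theta_coeff 2 i * of_int (4 * i ^ 2)) * odd_pow 0 x)"
    unfolding theta_op_def
    by (rule arg_cong[of _ _ fsum]) (auto simp: odd_pow_def algebra_simps power2_eq_square)
  also have "\<dots> = - 2 * K1 * odd_pow 1 x + K2 * odd_pow 0 x"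
    unfolding fsum_add[OF fsummable_diff[OF s fsummable_mult_right[OF s]] fsummable_mult_right[OF s]]
      fsum_diff[OF s fsummable_mult_right[OF s]] z fsum_cmult_right[OF s] K1_def K2_def by simp
  finally show "theta_op (odd_pow 2) x = - 2 * K1 * odd_pow 1 x + K2 * odd_pow 0 x" .
qed

lemma theta_op3_quadratic:
  "theta_op (theta_op (theta_op (\<lambda>x. odd_pow 2 x - c * odd_pow 0 x))) k = 0"
proof -
  let ?K1 = "fsum (\<lambda>i. theta_coeff 2 i * of_int (2 * i) :: rat fps)" and ?K2 = "fsum (\<lambda>i. theta_coeff 2 i * of_int (4 * i ^ 2) :: rat fps)"
  have 1: "theta_op (\<lambda>x. odd_pow 2 x - c * odd_pow 0 x) = (\<lambda>x. - 2 * ?K1 * odd_pow 1 x + ?K2 * odd_pow 0 x)"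
    by (rule ext) (simp only: theta_op_diff theta_op_cmult theta_op_odd_pow mult_zero_right diff_zero)
  have 2: "theta_op \<dots> = (\<lambda>x. 2 * ?K1 * ?K1 * odd_pow 0 x)"
    by (rule ext) (simp only: theta_op_add theta_op_cmult theta_op_odd_pow, simp)
  show ?thesis
    unfolding 1 2 by (simp only: theta_op_cmult theta_op_odd_pow mult_zero_right)
qed

definition quad_wt :: "rat fps \<Rightarrow> int \<Rightarrow> rat fps" where
  "quad_wt c m = of_int (m ^ 2) - c"

text \<open>The three sign patterns differ only on the axes \<open>n = 0\<close> of the summation quadrants. The
  antisymmetry needed for the functional equation interchanges \<open>appell1\<close> and \<open>appell2\<close>, whose
  difference is a quadratic polynomial on the odd integers and is killed by the third power of
  \<open>theta_op\<close>.\<close>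

definition orthant1 :: "int \<Rightarrow> int \<Rightarrow> rat fps" where
  "orthant1 n x = (if even x then 0 else if 0 < x \<and> 0 \<le> n then 1 else if x < 0 \<and> n < 0 then - 1 else 0)"

definition orthant2 :: "int \<Rightarrow> int \<Rightarrow> rat fps" where
  "orthant2 n x = (if even x then 0 else if 0 < x \<and> 0 < n then 1 else if x < 0 \<and> n \<le> 0 then - 1 else 0)"

definition appell1 :: "rat fps \<Rightarrow> int \<Rightarrow> rat fps" where
  "appell1 c x = fsum (\<lambda>n. orthant1 n x * quad_wt c (4 * n + x) * fps_X ^ nat (2 * n ^ 2 + n * x))"

definition appell2 :: "rat fps \<Rightarrow> int \<Rightarrow> rat fps" where
  "appell2 c x = fsum (\<lambda>n. orthant2 n x * quad_wt c (4 * n + x) * fps_X ^ nat (2 * n ^ 2 + n * x))"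

definition orthant :: "int \<Rightarrow> int \<Rightarrow> rat fps" where
  "orthant n x = (if even x then 0 else if 0 < x \<and> 0 < n then 1 else if x < 0 \<and> n < 0 then - 1 else 0)"

text \<open>With the axis \<open>n = 0\<close> removed the sequence is summable in \<open>x\<close>,
  so this version can be put into \<open>texp\<close>.\<close>

definition appell :: "rat fps \<Rightarrow> int \<Rightarrow> rat fps" where
  "appell c x = fsum (\<lambda>n. orthant n x * quad_wt c (4 * n + x) * fps_X ^ nat (2 * n ^ 2 + n * x))"

text \<open>The exponent may be negative, where \<open>nat\<close> returns 0, but for fixed
  \<open>x\<close> this happens for finitely many \<open>n\<close> only.\<close>

lemma fsummable_quad: "fsummable (\<lambda>n. b n * fps_X ^ nat (2 * n ^ 2 + n * x) :: 'a::comm_ring_1 fps)"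
proof (rule fsummable_X_power_bounded[where S = "\<lambda>N. {- (\<bar>x\<bar> + int N)..\<bar>x\<bar> + int N}"])
  fix N n assume le: "nat (2 * n ^ 2 + n * x) \<le> N"
  have "\<bar>n\<bar> \<le> \<bar>x\<bar> + int N"
  proof (rule ccontr)
    assume "\<not> \<bar>n\<bar> \<le> \<bar>x\<bar> + int N"
    then have n: "\<bar>n\<bar> > \<bar>x\<bar> + int N" by simp
    have "\<bar>n\<bar> * 1 \<le> \<bar>n\<bar> * (2 * \<bar>n\<bar> - \<bar>x\<bar>)"
      using n by (intro mult_left_mono) auto
    moreover have "- (\<bar>n\<bar> * \<bar>x\<bar>) \<le> n * x" by (metis abs_ge_minus_self abs_mult neg_le_iff_le minus_minus)
    moreover have "\<bar>n\<bar> * (2 * \<bar>n\<bar> - \<bar>x\<bar>) = 2 * n ^ 2 - \<bar>n\<bar> * \<bar>x\<bar>"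
      by (simp add: algebra_simps power2_eq_square abs_mult_self_eq)
    ultimately have "int N < 2 * n ^ 2 + n * x" using n by linarith
    then show False using le by linarith
  qed
  then show "n \<in> {- (\<bar>x\<bar> + int N)..\<bar>x\<bar> + int N}" by auto
qed simp

text \<open>A power can be moved inside \<open>nat\<close> because the sign factor \<open>s\<close>
  vanishes wherever \<open>r\<close> is negative.\<close>

lemma X_power_mult_term:
  assumes "0 \<le> p" "s \<noteq> 0 \<longrightarrow> 0 \<le> r"
  shows "fps_X ^ nat p * (s * w * fps_X ^ nat r) = s * (w * fps_X ^ nat (p + r) :: rat fps)"
proof (cases "s = 0")
  case False
  then have "nat (p + r) = nat p + nat r" using assms by (simp add: nat_add_distrib)
  then show ?thesis by (simp add: power_add mult_ac)
qed simp

text \<open>The assumption, which determines \<open>c\<close>, cancels the boundary terms arising where the sign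
  pattern jumps.\<close>

lemma shift_rel_appell:
  assumes bd: "fsum (\<lambda>n. quad_wt c (4 * n + 1) * fps_X ^ nat (2 * n ^ 2 + n)) = 0"
  shows "shift_rel (appell1 c) (appell2 c) 4 1"
  unfolding shift_rel_def
proof (intro allI impI)
  fix x a :: int assume a: "0 \<le> a" "0 \<le> a + x"
  define T where "T = (\<lambda>n. quad_wt c (4 * n + x) * fps_X ^ nat (a + x + (2 * n ^ 2 + n * x)))"
  have nn: "0 \<le> n * x" if "orthant1 n x \<noteq> 0" for n
    using that by (auto simp: orthant1_def mult_nonpos_nonpos split: if_splits)
  have nn2: "0 \<le> n * x" if "orthant2 n x \<noteq> 0" for n x
    using that by (auto simp: orthant2_def mult_nonpos_nonpos split: if_splits)
  have A: "fps_X ^ nat (a + x) * appell1 c x = fsum (\<lambda>n. orthant1 n x * T n)"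
    unfolding appell1_def T_def fsum_cmult[OF fsummable_quad, symmetric]
    by (rule arg_cong[of _ _ fsum], rule ext, rule X_power_mult_term) (use a nn in auto)
  have "fps_X ^ nat (a + 2) * appell2 c (x - 4) = fsum (\<lambda>m. orthant2 m (x - 4) *
      (quad_wt c (4 * m + (x - 4)) * fps_X ^ nat (a + 2 + (2 * m ^ 2 + m * (x - 4)))))"
    unfolding appell2_def fsum_cmult[OF fsummable_quad, symmetric]
    by (rule arg_cong[of _ _ fsum], rule ext, rule X_power_mult_term) (use a nn2 in auto)
  also have "\<dots> = fsum (\<lambda>n. orthant2 (n + 1) (x - 4) *
      (quad_wt c (4 * (n + 1) + (x - 4)) * fps_X ^ nat (a + 2 + (2 * (n + 1) ^ 2 + (n + 1) * (x - 4)))))"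
    by (rule fsum_bij[OF bij_int_diff(2), symmetric])
  \<comment> \<open>Replacing \<open>n\<close>, \<open>x\<close> by \<open>n + 1\<close>,
    \<open>x - 4\<close> preserves \<open>4 n + x\<close> and adds \<open>x - 2\<close> to
    \<open>2 n^2 + n x\<close>.\<close>
  also have "\<dots> = fsum (\<lambda>n. orthant2 (n + 1) (x - 4) * T n)"
    unfolding T_def
    by (rule arg_cong[of _ _ fsum], rule ext) (simp add: algebra_simps power2_eq_square)
  finally have B: "fps_X ^ nat (a + 2) * appell2 c (x - 4) = fsum (\<lambda>n. orthant2 (n + 1) (x - 4) * T n)" .
  \<comment> \<open>The shifted quadrants disagree only for \<open>x = 1\<close> and
    \<open>x = 3\<close>, and there by a complete sum over all \<open>n\<close>, which
    \<open>bd\<close> annihilates.\<close>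
  have sgd: "orthant1 n x - orthant2 (n + 1) (x - 4) = (if x = 1 \<or> x = 3 then 1 else 0)" for n
  proof -
    have "x = 1 \<or> x = 3 \<or> x \<ge> 5" if "odd x" "x \<ge> 0" using that by presburger
    then show ?thesis by (auto simp: orthant1_def orthant2_def)
  qed
  have sT: "fsummable (\<lambda>n. b n * T n)" for b
  proof (rule fsummable_mult_left)
    have "fsummable (\<lambda>n. fps_X ^ nat (a + x) * (quad_wt c (4 * n + x) * fps_X ^ nat (2 * n ^ 2 + n * x)))"
      by (rule fsummable_mult_left) (rule fsummable_quad)
    show "fsummable T"
    proof (rule fsummableI[where S = "\<lambda>N. {- (\<bar>x\<bar> + int N)..\<bar>x\<bar> + int N}"])
      fix N n assume nz: "T n $ N \<noteq> 0"
      have "nat (a + x + (2 * n ^ 2 + n * x)) \<le> N"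
        using nz by (auto simp: T_def fps_X_power_mult_right_nth split: if_splits)
      then have le: "2 * n ^ 2 + n * x \<le> int N" using a by linarith
      have "\<bar>n\<bar> \<le> \<bar>x\<bar> + int N"
      proof (rule ccontr)
        assume "\<not> \<bar>n\<bar> \<le> \<bar>x\<bar> + int N"
        then have n: "\<bar>n\<bar> > \<bar>x\<bar> + int N" by simp
        have "\<bar>n\<bar> * 1 \<le> \<bar>n\<bar> * (2 * \<bar>n\<bar> - \<bar>x\<bar>)"
          using n by (intro mult_left_mono) auto
        moreover have "- (\<bar>n\<bar> * \<bar>x\<bar>) \<le> n * x" by (metis abs_ge_minus_self abs_mult neg_le_iff_le minus_minus)
        moreover have "\<bar>n\<bar> * (2 * \<bar>n\<bar> - \<bar>x\<bar>) = 2 * n ^ 2 - \<bar>n\<bar> * \<bar>x\<bar>"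
          by (simp add: algebra_simps power2_eq_square abs_mult_self_eq)
        ultimately show False using n le by linarith
      qed
      then show "n \<in> {- (\<bar>x\<bar> + int N)..\<bar>x\<bar> + int N}" by auto
    qed simp
  qed
  have T0: "fsum T = 0" if "x = 1 \<or> x = 3"
    using that
  proof
    assume x: "x = 1"
    have "T n = fps_X ^ nat (a + 1) * (quad_wt c (4 * n + 1) * fps_X ^ nat (2 * n ^ 2 + n))" for n
    proof -
      have "nat (a + x + (2 * n ^ 2 + n * x)) = nat (a + 1) + nat (2 * n ^ 2 + n)"
        using a abs_le_quadratic[of n] by (simp add: x nat_add_distrib)
      then show ?thesis unfolding T_def by (simp add: x power_add mult_ac)
    qed
    then have "T = (\<lambda>n. fps_X ^ nat (a + 1) * (quad_wt c (4 * n + 1) * fps_X ^ nat (2 * n ^ 2 + n)))"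
      by (rule ext)
    then have "fsum T = fps_X ^ nat (a + 1) * fsum (\<lambda>n. quad_wt c (4 * n + 1) * fps_X ^ nat (2 * n ^ 2 + n))"
      using fsum_cmult[OF fsummable_quad[of "\<lambda>n. quad_wt c (4 * n + 1)" 1], of "fps_X ^ nat (a + 1)"]
      by simp
    then show ?thesis using bd by simp
  next
    assume x: "x = 3"
    \<comment> \<open>The reflection \<open>n \<mapsto> -1 - n\<close> sends \<open>4 n + 3\<close>
      to \<open>-(4 n + 1)\<close> and so reduces \<open>x = 3\<close> to the series in
      \<open>bd\<close>.\<close>
    have "T (- 1 - n) = fps_X ^ nat (a + 2) * (quad_wt c (4 * n + 1) * fps_X ^ nat (2 * n ^ 2 + n))" for n
    proof -
      have 1: "a + x + (2 * (- 1 - n) ^ 2 + (- 1 - n) * x) = (a + 2) + (2 * n ^ 2 + n)"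
        by (simp add: x power2_eq_square algebra_simps)
      have 2: "nat ((a + 2) + (2 * n ^ 2 + n)) = nat (a + 2) + nat (2 * n ^ 2 + n)"
        using a abs_le_quadratic[of n] by (intro nat_add_distrib) auto
      have 3: "quad_wt c (4 * (- 1 - n) + x) = quad_wt c (4 * n + 1)"
        by (simp add: quad_wt_def x power2_eq_square algebra_simps)
      show ?thesis unfolding T_def 1 2 3 by (simp only: power_add mult_ac)
    qed
    moreover have "fsum T = fsum (\<lambda>n. T (- 1 - n))"
      by (rule fsum_bij[OF bij_int_diff(1), symmetric])
    ultimately have "fsum T = fps_X ^ nat (a + 2) * fsum (\<lambda>n. quad_wt c (4 * n + 1) * fps_X ^ nat (2 * n ^ 2 + n))"
      using fsum_cmult[OF fsummable_quad[of "\<lambda>n. quad_wt c (4 * n + 1)" 1], of "fps_X ^ nat (a + 2)"]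
      by (simp add: fun_eq_iff[symmetric])
    then show ?thesis using bd by simp
  qed
  have "fsum (\<lambda>n. orthant1 n x * T n) - fsum (\<lambda>n. orthant2 (n + 1) (x - 4) * T n)
    = fsum (\<lambda>n. (orthant1 n x - orthant2 (n + 1) (x - 4)) * T n)"
    unfolding left_diff_distrib by (rule fsum_diff[symmetric]) (rule sT)+
  also have "\<dots> = 0"
  proof (cases "x = 1 \<or> x = 3")
    case True
    then show ?thesis unfolding sgd using T0 by simp
  next
    case False
    then show ?thesis unfolding sgd by (simp add: fsum_def fps_eq_iff)
  qed
  finally show "fps_X ^ nat (a + x) * appell1 c x = 1 * (fps_X ^ nat (a + 2) * appell2 c (x - 4))"
    unfolding A B by simp
qed

lemma appell2_reflect: "appell2 c (0 - x) = - 1 * appell1 c x"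
proof -
  have "appell2 c (0 - x) = fsum (\<lambda>n. orthant2 (0 - n) (- x) * quad_wt c (4 * (0 - n) + (- x)) * fps_X ^ nat (2 * (0 - n) ^ 2 + (0 - n) * (- x)))"
    unfolding appell2_def diff_0 by (rule fsum_bij[OF bij_int_diff(1)[of 0], symmetric, unfolded diff_0])
  also have "\<dots> = fsum (\<lambda>n. - (orthant1 n x * quad_wt c (4 * n + x) * fps_X ^ nat (2 * n ^ 2 + n * x)))"
  proof (rule arg_cong[of _ _ fsum], rule ext)
    fix n
    have "orthant2 (0 - n) (- x) = - orthant1 n x" by (auto simp: orthant1_def orthant2_def)
    moreover have "quad_wt c (4 * (0 - n) + - x) = quad_wt c (4 * n + x)"
      by (simp add: quad_wt_def power2_eq_square algebra_simps)
    ultimately show "orthant2 (0 - n) (- x) * quad_wt c (4 * (0 - n) + (- x)) * fps_X ^ nat (2 * (0 - n) ^ 2 + (0 - n) * (- x))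
      = - (orthant1 n x * quad_wt c (4 * n + x) * fps_X ^ nat (2 * n ^ 2 + n * x))" by simp
  qed
  finally show ?thesis by (simp add: fsum_uminus appell1_def)
qed

lemma appell1_minus:
  "appell1 c x = appell2 c x + (odd_pow 2 x - c * odd_pow 0 x)"
  "appell1 c x = appell c x + (if odd x \<and> 0 < x then quad_wt c x else 0)"
proof -
  have *: "fsum (\<lambda>n. s n * quad_wt c (4 * n + x) * fps_X ^ nat (2 * n ^ 2 + n * x))
    - fsum (\<lambda>n. t n * quad_wt c (4 * n + x) * fps_X ^ nat (2 * n ^ 2 + n * x)) = d * quad_wt c x"
    if "\<And>n. s n - t n = (if n = 0 then d else 0)" for s t d
  proof -
    have "fsum (\<lambda>n. s n * quad_wt c (4 * n + x) * fps_X ^ nat (2 * n ^ 2 + n * x))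
      - fsum (\<lambda>n. t n * quad_wt c (4 * n + x) * fps_X ^ nat (2 * n ^ 2 + n * x))
      = fsum (\<lambda>n. (s n - t n) * quad_wt c (4 * n + x) * fps_X ^ nat (2 * n ^ 2 + n * x))"
      unfolding left_diff_distrib by (rule fsum_diff[symmetric]) (rule fsummable_quad)+
    also have "\<dots> = d * quad_wt c x"
      unfolding that using fsum_finite[of "{0}" "\<lambda>n. (if n = 0 then d else 0) * quad_wt c (4 * n + x) * fps_X ^ nat (2 * n ^ 2 + n * x)"]
      by simp
    finally show ?thesis .
  qed
  have "appell1 c x - appell2 c x = (if odd x then 1 else 0) * quad_wt c x"
    unfolding appell1_def appell2_def by (rule *) (auto simp: orthant1_def orthant2_def)
  then show "appell1 c x = appell2 c x + (odd_pow 2 x - c * odd_pow 0 x)"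
    by (auto simp: odd_pow_def quad_wt_def algebra_simps split: if_splits)
  have "appell1 c x - appell c x = (if odd x \<and> 0 < x then 1 else 0) * quad_wt c x"
    unfolding appell1_def appell_def by (rule *) (auto simp: orthant1_def orthant_def)
  then show "appell1 c x = appell c x + (if odd x \<and> 0 < x then quad_wt c x else 0)"
    by (auto simp: algebra_simps split: if_splits)
qed

lemma appell1_even: "even x \<Longrightarrow> appell1 c x = 0"
  by (simp add: appell1_def orthant1_def fsum_def fps_eq_iff)

definition theta3_appell :: "rat fps \<Rightarrow> int \<Rightarrow> rat fps" where
  "theta3_appell c = theta_op (theta_op (theta_op (appell1 c)))"

lemma theta3_appell_eq: "theta3_appell c = theta_op (theta_op (theta_op (appell2 c)))"
proof
  fix x
  have "appell1 c = (\<lambda>x. appell2 c x + (odd_pow 2 x - c * odd_pow 0 x))" by (rule ext) (rule appell1_minus)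
  then show "theta3_appell c x = theta_op (theta_op (theta_op (appell2 c))) x"
    using theta_op3_quadratic[of c x] unfolding theta3_appell_def
    by (simp only: theta_op_add[abs_def] add_0_right)
qed

lemma theta3_appell_even: "even x \<Longrightarrow> theta3_appell c x = 0"
  unfolding theta3_appell_def by (intro theta_op_even appell1_even)

text \<open>Three theta factors move the centre from 0 to 3 and give three signs; the fourth comes
  from \<open>appell2_reflect\<close>.\<close>

lemma theta3_appell_reflect: "theta3_appell c (6 - x) = theta3_appell c x"
proof -
  have 1: "theta_op (appell2 c) (2 - x) = - (- 1) * theta_op (appell1 c) x" for x
    using theta_op_reflect[of "appell2 c" 0 "- 1" "appell1 c" x, OF appell2_reflect] by simp
  have 2: "theta_op (theta_op (appell2 c)) (4 - x) = - (- (- 1)) * theta_op (theta_op (appell1 c)) x" for x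
    using theta_op_reflect[of "theta_op (appell2 c)" 2 "- (- 1)" "theta_op (appell1 c)" x, OF 1] by simp
  have 3: "theta_op (theta_op (theta_op (appell2 c))) (6 - x) = theta_op (theta_op (theta_op (appell1 c))) x" for x
    using theta_op_reflect[of "theta_op (theta_op (appell2 c))" 4 "- (- (- 1))" "theta_op (theta_op (appell1 c))" x, OF 2] by simp
  show ?thesis using 3[of x] unfolding theta3_appell_eq[symmetric] theta3_appell_def[symmetric] .
qed

text \<open>After three theta factors the functional equation has shift \<open>-2\<close>, a
  two-term recursion. Its solutions are multiples of
  \<open>w^3 \<Sum> (-1)^i q^(i^2) w^(2 i)\<close>, fixed by the value at 3.\<close>

lemma theta3_appell_odd:
  assumes bd: "fsum (\<lambda>n. quad_wt c (4 * n + 1) * fps_X ^ nat (2 * n ^ 2 + n)) = 0"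
  shows "theta3_appell c (3 + 2 * i) = alt i * fps_X ^ nat (i ^ 2) * theta3_appell c 3"
proof -
  \<comment> \<open>The one sequence is read as built from \<open>appell1\<close> on the left and
    from \<open>appell2\<close> on the right.\<close>
  have sr: "shift_rel (theta3_appell c) (theta3_appell c) (4 - 2 - 2 - 2) (- (- (- 1)))"
    unfolding theta3_appell_def
    by (subst (2) theta3_appell_def[symmetric], subst theta3_appell_eq) (intro shift_rel_theta_op shift_rel_appell bd)
  have r: "fps_X ^ nat x * theta3_appell c x = - (fps_X ^ 2 * theta3_appell c (x + 2))" if "0 \<le> x" for x
  proof -
    from sr[unfolded shift_rel_def, rule_format, of 0 x] that show ?thesis by simp
  qed
  have nn: "theta3_appell c (3 + 2 * int j) = alt (int j) * fps_X ^ (j ^ 2) * theta3_appell c 3" for j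
  proof (induction j)
    case 0
    then show ?case by (simp add: alt_def)
  next
    case (Suc j)
    have "fps_X ^ 2 * theta3_appell c (3 + 2 * int (Suc j)) = - (fps_X ^ (3 + 2 * j) * theta3_appell c (3 + 2 * int j))"
      using r[of "3 + 2 * int j"] by (simp add: nat_add_distrib nat_mult_distrib algebra_simps)
    also have "\<dots> = fps_X ^ 2 * (alt (int (Suc j)) * fps_X ^ (Suc j ^ 2) * theta3_appell c 3)"
    proof -
      have "3 + 2 * j + j ^ 2 = 2 + Suc j ^ 2" by (simp add: power2_eq_square)
      then have "fps_X ^ (3 + 2 * j) * (fps_X ^ j ^ 2) = (fps_X ^ 2 * fps_X ^ (Suc j ^ 2) :: rat fps)"
        by (simp only: power_add[symmetric])
      moreover have "(alt (int (Suc j)) :: rat fps) = - alt (int j)" by (simp add: alt_def)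
      ultimately show ?thesis unfolding Suc by (simp add: mult.left_commute[of "fps_X ^ 2"] mult.assoc)
    qed
    finally show ?case by simp
  qed
  show ?thesis
  proof (cases "i \<ge> 0")
    case True
    then obtain j where "i = int j" using zero_le_imp_eq_int by blast
    then show ?thesis using nn[of j] by (simp add: nat_power_eq)
  next
    case False
    then obtain j where j: "i = - int j" by (metis linear zero_le_imp_eq_int minus_minus neg_0_le_iff_le)
    \<comment> \<open>The recursion \<open>r\<close> is available at nonnegative arguments only;
      indices below 3 come from the symmetry about 3.\<close>
    have "theta3_appell c (3 + 2 * i) = theta3_appell c (3 + 2 * int j)"
      using theta3_appell_reflect[of c "3 + 2 * int j"] by (simp add: j)
    then show ?thesis using nn[of j] by (simp add: j nat_power_eq alt_def)
  qed
qed

section \<open>Exponential substitution\<close>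

text \<open>\<open>texp e a\<close> is the expansion of \<open>\<Sum>i. a i * w powi (e i)\<close> at \<open>w = exp t\<close>, as a power series in
  \<open>t\<close> over the power series in \<open>q\<close>.\<close>

definition ecoeff :: "int \<Rightarrow> nat \<Rightarrow> rat fps" where
  "ecoeff k m = fps_const (of_int k ^ m / fact m)"

definition texp :: "('i \<Rightarrow> int) \<Rightarrow> ('i \<Rightarrow> rat fps) \<Rightarrow> rat fps fps" where
  "texp e a = Abs_fps (\<lambda>m. fsum (\<lambda>i. a i * ecoeff (e i) m))"

lemma fps_const_sum: "fps_const (sum f A) = (\<Sum>x\<in>A. fps_const (f x))"
  by (induction A rule: infinite_finite_induct) (simp_all flip: fps_const_add)

lemma ecoeff_add: "(\<Sum>p=0..m. ecoeff k p * ecoeff l (m - p)) = ecoeff (k + l) m"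
proof -
  have "(\<Sum>p=0..m. of_int k ^ p / fact p * (of_int l ^ (m - p) / fact (m - p))) = (of_int (k + l) ^ m / fact m :: rat)"
    using arg_cong[OF fps_exp_add_mult[of "of_int k :: rat" "of_int l"], of "\<lambda>f. f $ m"]
    by (simp add: fps_mult_nth)
  then show ?thesis
    unfolding ecoeff_def fps_const_mult by (simp only: fps_const_sum[symmetric])
qed

lemma texp_nth: "texp e a $ m = fsum (\<lambda>i. a i * ecoeff (e i) m)"
  by (simp add: texp_def)

lemma fsum_sum:
  assumes "finite A" "\<And>p. p \<in> A \<Longrightarrow> fsummable (g p)"
  shows "fsum (\<lambda>i. \<Sum>p\<in>A. g p i) = (\<Sum>p\<in>A. fsum (g p))" "fsummable (\<lambda>i. \<Sum>p\<in>A. g p i)"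
proof -
  have "fsum (\<lambda>i. \<Sum>p\<in>A. g p i) = (\<Sum>p\<in>A. fsum (g p)) \<and> fsummable (\<lambda>i. \<Sum>p\<in>A. g p i)"
    using assms
  proof (induction A rule: finite_induct)
    case empty
    then show ?case by (auto simp: fsum_def fps_eq_iff fsummable_def)
  next
    case (insert p A)
    then show ?case by (simp add: fsum_add fsummable_add)
  qed
  then show "fsum (\<lambda>i. \<Sum>p\<in>A. g p i) = (\<Sum>p\<in>A. fsum (g p))" "fsummable (\<lambda>i. \<Sum>p\<in>A. g p i)" by auto
qed

lemma texp_mult:
  assumes "fsummable a" "fsummable b"
  shows "texp e a * texp f b = texp (\<lambda>(i, j). e i + f j) (\<lambda>(i, j). a i * b j)"
proof (rule fps_ext)
  fix m
  have s: "fsummable (\<lambda>(i, j). a i * ecoeff (e i) p * (b j * ecoeff (f j) r))" for p r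
    by (rule fsummable_mult_pair) (rule fsummable_mult_right, rule assms)+
  have "(texp e a * texp f b) $ m = (\<Sum>p=0..m. fsum (\<lambda>i. a i * ecoeff (e i) p) * fsum (\<lambda>j. b j * ecoeff (f j) (m - p)))"
    by (simp add: fps_mult_nth texp_nth)
  also have "\<dots> = (\<Sum>p=0..m. fsum (\<lambda>(i, j). a i * ecoeff (e i) p * (b j * ecoeff (f j) (m - p))))"
    by (rule sum.cong[OF refl], rule fsum_mult) (rule fsummable_mult_right, rule assms)+
  also have "\<dots> = fsum (\<lambda>ij. \<Sum>p=0..m. case ij of (i, j) \<Rightarrow> a i * ecoeff (e i) p * (b j * ecoeff (f j) (m - p)))"
    by (rule fsum_sum(1)[symmetric]) (use s in auto)
  also have "\<dots> = texp (\<lambda>(i, j). e i + f j) (\<lambda>(i, j). a i * b j) $ m"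
    unfolding texp_nth
  proof (rule arg_cong[of _ _ fsum], rule ext)
    fix ij
    show "(\<Sum>p=0..m. case ij of (i, j) \<Rightarrow> a i * ecoeff (e i) p * (b j * ecoeff (f j) (m - p)))
      = (case ij of (i, j) \<Rightarrow> a i * b j) * ecoeff (case ij of (i, j) \<Rightarrow> e i + f j) m"
      by (cases ij) (simp add: sum_distrib_left mult_ac flip: ecoeff_add)
  qed
  finally show "(texp e a * texp f b) $ m = texp (\<lambda>(i, j). e i + f j) (\<lambda>(i, j). a i * b j) $ m" .
qed

lemma texp_add:
  assumes "fsummable a" "fsummable b"
  shows "texp e (\<lambda>i. a i + b i) = texp e a + texp e b"
  by (rule fps_ext) (simp add: texp_nth distrib_right fsum_add fsummable_mult_right assms)

lemma texp_diff:
  assumes "fsummable a" "fsummable b"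
  shows "texp e (\<lambda>i. a i - b i) = texp e a - texp e b"
  by (rule fps_ext) (simp add: texp_nth left_diff_distrib fsum_diff fsummable_mult_right assms)

lemma texp_cmult:
  assumes "fsummable a"
  shows "texp e (\<lambda>i. c * a i) = fps_const c * texp e a"
  by (rule fps_ext) (simp add: texp_nth mult.assoc fsum_cmult fsummable_mult_right assms)

lemma ecoeff_Suc: "of_nat (m + 1) * ecoeff k (m + 1) = of_int k * ecoeff k m"
proof -
  have "of_nat (m + 1) * (of_int k ^ (m + 1) / fact (m + 1)) = (of_int k * (of_int k ^ m / fact m) :: rat)"
    by (simp add: divide_simps)
  then show ?thesis
    unfolding ecoeff_def fps_of_nat[symmetric] fps_of_int[symmetric] fps_const_mult by (rule arg_cong)
qed

lemma texp_deriv: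
  assumes "fsummable a"
  shows "fps_deriv (texp e a) = texp e (\<lambda>i. of_int (e i) * a i)"
proof (rule fps_ext)
  fix m
  have "fps_deriv (texp e a) $ m = fsum (\<lambda>i. of_nat (m + 1) * (a i * ecoeff (e i) (m + 1)))"
    unfolding fps_deriv_nth texp_nth by (rule fsum_cmult[symmetric]) (rule fsummable_mult_right, rule assms)
  also have "\<dots> = fsum (\<lambda>i. of_int (e i) * a i * ecoeff (e i) m)"
    by (rule arg_cong[of _ _ fsum], rule ext) (metis ecoeff_Suc mult.assoc mult.commute)
  finally show "fps_deriv (texp e a) $ m = texp e (\<lambda>i. of_int (e i) * a i) $ m"
    by (simp add: texp_nth)
qed

section \<open>The derivation in \<open>q\<close> on series in \<open>t\<close>, and powers of
  \<open>w\<close>\<close>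

definition qderiv :: "rat fps fps \<Rightarrow> rat fps fps" where
  "qderiv F = Abs_fps (\<lambda>m. fps_XD (F $ m))"

lemma qderiv_nth [simp]: "qderiv F $ m = fps_XD (F $ m)"
  by (simp add: qderiv_def)

lemma fps_XD_sum: "fps_XD (sum f A) = (\<Sum>x\<in>A. fps_XD (f x :: rat fps))"
  by (induction A rule: infinite_finite_induct) simp_all

lemma qderiv_mult: "qderiv (F * G) = qderiv F * G + F * qderiv G"
  by (rule fps_ext) (simp add: fps_mult_nth fps_XD_sum fps_XD_mult sum.distrib)

lemma fps_XD_of_nat_mult: "fps_XD (of_nat n * f) = of_nat n * fps_XD (f :: rat fps)"
  by (simp add: fps_XD_mult fps_of_nat[symmetric])

lemma qderiv_deriv: "qderiv (fps_deriv F) = fps_deriv (qderiv F)"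
  by (rule fps_ext) (simp only: qderiv_nth fps_deriv_nth fps_XD_of_nat_mult)

lemma qderiv_texp:
  assumes "fsummable a"
  shows "qderiv (texp e a) = texp e (\<lambda>i. fps_XD (a i))"
proof (rule fps_ext)
  fix m
  have "fps_XD (a i * ecoeff (e i) m) = fps_XD (a i) * ecoeff (e i) m" for i
    by (simp add: fps_XD_mult ecoeff_def)
  then show "qderiv (texp e a) $ m = texp e (\<lambda>i. fps_XD (a i)) $ m"
    by (simp add: texp_nth fsum_XD fsummable_mult_right assms)
qed

definition exp_pow :: "int \<Rightarrow> rat fps fps" where
  "exp_pow k = Abs_fps (ecoeff k)"

lemma exp_pow_nth: "exp_pow k $ m = ecoeff k m"
  by (simp add: exp_pow_def)

lemma exp_pow_add: "exp_pow k * exp_pow l = exp_pow (k + l)"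
  by (rule fps_ext) (simp add: fps_mult_nth exp_pow_nth ecoeff_add)

lemma exp_pow_0 [simp]: "exp_pow 0 = 1"
  by (rule fps_ext) (simp add: exp_pow_nth ecoeff_def power_0_left)

lemma exp_pow_deriv: "fps_deriv (exp_pow k) = of_int k * exp_pow k"
  by (rule fps_ext) (metis (no_types, lifting) exp_pow_nth ecoeff_Suc fps_deriv_nth fps_mult_left_const_nth fps_of_int)

lemma texp_shift:
  assumes "fsummable a"
  shows "texp (\<lambda>i. e i + k) a = exp_pow k * texp e a"
proof (rule fps_ext)
  fix m
  have s: "fsummable (\<lambda>i. a i * ecoeff (e i) (m - p))" for p by (rule fsummable_mult_right[OF assms])
  have "(exp_pow k * texp e a) $ m = (\<Sum>p=0..m. fsum (\<lambda>i. ecoeff k p * (a i * ecoeff (e i) (m - p))))"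
    by (simp add: fps_mult_nth exp_pow_nth texp_nth fsum_cmult s)
  also have "\<dots> = fsum (\<lambda>i. \<Sum>p=0..m. ecoeff k p * (a i * ecoeff (e i) (m - p)))"
    by (rule fsum_sum(1)[symmetric]) (simp_all add: fsummable_mult_left s)
  also have "\<dots> = fsum (\<lambda>i. a i * ecoeff (e i + k) m)"
    by (simp add: add.commute[of _ k] sum_distrib_left mult_ac flip: ecoeff_add)
  finally show "texp (\<lambda>i. e i + k) a $ m = (exp_pow k * texp e a) $ m"
    by (simp add: texp_nth)
qed

lemma texp_reindex:
  assumes "bij_betw h A B" "\<And>i. i \<notin> A \<Longrightarrow> a i = 0" "\<And>j. j \<notin> B \<Longrightarrow> b j = 0"
    "\<And>i. i \<in> A \<Longrightarrow> a i = b (h i)" "\<And>i. i \<in> A \<Longrightarrow> e i = f (h i)"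
  shows "texp e a = texp f b"
  by (rule fps_ext, unfold texp_nth, rule fsum_reindex[OF assms(1)]) (use assms in auto)

lemma bij_conv: "bij (\<lambda>(k, i). (i, k - d i :: int))"
  by (rule bij_betwI[where g = "\<lambda>(i, j). (j + d i, i)"]) auto

lemma fsummable_conv:
  fixes s :: "int \<Rightarrow> rat fps"
  assumes "fsummable a" "fsummable s"
  shows "fsummable (\<lambda>(k, i). a i * s (k - d i))" "fsummable (\<lambda>k. fsum (\<lambda>i. a i * s (k - d i)))"
proof -
  show *: "fsummable (\<lambda>(k, i). a i * s (k - d i))"
    using fsummable_comp[OF fsummable_mult_pair[OF assms] bij_is_inj[OF bij_conv[of d]]]
    by (simp add: case_prod_unfold)
  show "fsummable (\<lambda>k. fsum (\<lambda>i. a i * s (k - d i)))"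
    by (rule fsummable_pair(2)[OF *])
qed

text \<open>Convolution of coefficient sequences becomes a product; here, unlike in
  \<open>theta_op\<close>, the sequence \<open>s\<close> itself must be summable.\<close>

lemma texp_conv:
  fixes s :: "int \<Rightarrow> rat fps"
  assumes "fsummable a" "fsummable s"
  shows "texp (\<lambda>k. z * k) (\<lambda>k. fsum (\<lambda>i. a i * s (k - d i))) = texp (\<lambda>i. z * d i) a * texp (\<lambda>k. z * k) s"
proof (rule fps_ext)
  fix m
  have s1: "fsummable (\<lambda>i. a i * b i)" for b by (rule fsummable_mult_right[OF assms(1)])
  have s2: "fsummable (\<lambda>(k, i). a i * s (k - d i) * ecoeff (z * k) m)"
    using fsummable_mult_right[OF fsummable_conv(1)[OF assms, of d], of "\<lambda>(k, i). ecoeff (z * k) m"]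
    by (simp add: case_prod_unfold)
  have "texp (\<lambda>k. z * k) (\<lambda>k. fsum (\<lambda>i. a i * s (k - d i))) $ m = fsum (\<lambda>k. fsum (\<lambda>i. a i * s (k - d i) * ecoeff (z * k) m))"
    by (simp add: texp_nth fsum_cmult_right[OF s1, symmetric])
  also have "\<dots> = fsum (\<lambda>(k, i). a i * s (k - d i) * ecoeff (z * k) m)"
    by (rule fsum_pair[OF s2])
  also have "\<dots> = fsum (\<lambda>ki. (\<lambda>(i, j). a i * s j * ecoeff (z * d i + z * j) m) ((\<lambda>(k, i). (i, k - d i)) ki))"
    by (rule arg_cong[of _ _ fsum]) (auto simp: fun_eq_iff algebra_simps)
  also have "\<dots> = fsum (\<lambda>(i, j). a i * s j * ecoeff (z * d i + z * j) m)"
    by (rule fsum_bij[OF bij_conv])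
  also have "\<dots> = (texp (\<lambda>i. z * d i) a * texp (\<lambda>k. z * k) s) $ m"
    unfolding texp_mult[OF assms] texp_nth by (simp add: case_prod_unfold)
  finally show "texp (\<lambda>k. z * k) (\<lambda>k. fsum (\<lambda>i. a i * s (k - d i))) $ m = (texp (\<lambda>i. z * d i) a * texp (\<lambda>k. z * k) s) $ m" .
qed

text \<open>At \<open>t = 0\<close> \<open>theta1\<close> has a simple zero and
  \<open>theta4\<close> none, as for the classical functions of these names.\<close>

definition theta1 :: "nat \<Rightarrow> rat fps fps" where "theta1 b = texp (\<lambda>i. 2 * i) (theta_coeff b)"

definition theta4 :: "rat fps fps" where "theta4 = texp (\<lambda>i. 2 * i) (\<lambda>i. alt i * fps_X ^ nat (i ^ 2))"

lemma texp_theta_op: "fsummable s \<Longrightarrow> texp id (theta_op s) = theta1 2 * texp id s"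
  using texp_conv[OF fsummable_theta_coeff[of 2], of s 1 "\<lambda>i. 2 * i"]
  by (simp add: theta_op_def[abs_def] theta1_def id_def)

lemma fsummable_theta_op': "fsummable s \<Longrightarrow> fsummable (theta_op s)"
  unfolding theta_op_def[abs_def] by (rule fsummable_conv(2)) (rule fsummable_theta_coeff, simp)

text \<open>Multiplication by \<open>1 - w^2\<close>; three of them clear the pole left by the axis
  terms.\<close>

definition backward_diff :: "(int \<Rightarrow> rat fps) \<Rightarrow> int \<Rightarrow> rat fps" where
  "backward_diff s k = s k - s (k - 2)"

lemma fsummable_shift: "fsummable s \<Longrightarrow> fsummable (\<lambda>k. s (k - d :: int))"
  by (rule fsummable_comp[of s "\<lambda>k. k - d"]) (auto simp: inj_def)

lemma fsummable_backward_diff: "fsummable s \<Longrightarrow> fsummable (backward_diff s)"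
  unfolding backward_diff_def[abs_def] by (intro fsummable_diff fsummable_shift)

lemma texp_backward_diff:
  assumes "fsummable s"
  shows "texp id (backward_diff s) = (1 - exp_pow 2) * texp id s"
proof -
  have "texp id (\<lambda>k. s (k - 2)) = texp (\<lambda>k. id k + 2) s"
    by (rule texp_reindex[of "\<lambda>k. k - 2" UNIV UNIV])
       (auto intro!: bij_betwI[where g = "\<lambda>k. k + 2"])
  then show ?thesis
    unfolding backward_diff_def[abs_def] texp_diff[OF assms fsummable_shift[OF assms]] texp_shift[OF assms]
    by (simp add: algebra_simps id_def)
qed

lemma backward_diff_theta_op: "backward_diff (theta_op s) = theta_op (backward_diff s)"
  by (rule ext) (simp only: backward_diff_def[abs_def] theta_op_diff theta_op_shift)

text \<open>Off the axis the sign pattern forces \<open>n x \<ge> |x|\<close>, so the exponent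
  exceeds \<open>|x|\<close>.\<close>

lemma fsummable_appell: "fsummable (appell c)"
proof (rule fsummableI[where S = "\<lambda>N. {- int N..int N}"])
  fix N x assume nz: "appell c x $ N \<noteq> 0"
  show "x \<in> {- int N..int N}"
  proof (rule ccontr)
    assume x: "x \<notin> {- int N..int N}"
    have "(orthant n x * quad_wt c (4 * n + x) * fps_X ^ nat (2 * n ^ 2 + n * x)) $ N = 0" for n
    proof (cases "orthant n x = 0")
      case False
      then have "n * x \<ge> \<bar>x\<bar>"
      proof -
        have "\<bar>n\<bar> * \<bar>x\<bar> \<ge> 1 * \<bar>x\<bar>"
          using False by (intro mult_right_mono) (auto simp: orthant_def split: if_splits)
        moreover have "n * x = \<bar>n\<bar> * \<bar>x\<bar>" using False by (auto simp: orthant_def split: if_splits)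
        ultimately show ?thesis by simp
      qed
      then have "2 * n ^ 2 + n * x > int N" using x by (smt (verit) atLeastAtMost_iff zero_le_power2)
      then have "N < nat (2 * n ^ 2 + n * x)" by linarith
      then show ?thesis by (simp add: fps_X_power_mult_right_nth)
    qed simp
    then have "appell c x $ N = 0" unfolding appell_def fsum_def by simp
    with nz show False ..
  qed
qed simp

lemma fsummable_zero_outside:
  assumes "fsummable (\<lambda>i. a (h i))" "\<And>j. j \<notin> range h \<Longrightarrow> a j = 0"
  shows "fsummable a"
proof (rule fsummableI[where S = "\<lambda>N. h ` {i. a (h i) $ N \<noteq> 0}"])
  show "finite (h ` {i. a (h i) $ N \<noteq> 0})" for N using assms(1) by (auto simp: fsummable_def)
  fix N j assume "a j $ N \<noteq> 0"
  then show "j \<in> h ` {i. a (h i) $ N \<noteq> 0}" using assms(2)[of j] by (cases "j \<in> range h") auto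
qed

lemma fsummable_theta4_coeff: "fsummable (\<lambda>i::int. alt i * fps_X ^ nat (i ^ 2) * b i :: rat fps)"
proof (rule fsummable_mult_right, rule fsummable_X_power_bounded[where S = "\<lambda>N. {- int N..int N}"])
  fix N and i :: int assume "nat (i ^ 2) \<le> N"
  moreover have "\<bar>i\<bar> \<le> i ^ 2"
  proof -
    have "\<bar>i\<bar> * 1 \<le> \<bar>i\<bar> * \<bar>i\<bar>" if "i \<noteq> 0" by (rule mult_left_mono) (use that in auto)
    then show ?thesis by (cases "i = 0") (auto simp: power2_eq_square)
  qed
  ultimately show "i \<in> {- int N..int N}" by auto
qed simp

text \<open>The relation between coefficients holds before summability does. Third differences
  commute with \<open>theta_op\<close> and make every sequence summable, so after them the relation
  passes to \<open>texp\<close>. The explicit polynomial is the third difference of the axis part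
  \<open>H\<close>.\<close>

lemma appell_theta_identity:
  assumes bd: "fsum (\<lambda>n. quad_wt c (4 * n + 1) * fps_X ^ nat (2 * n ^ 2 + n)) = 0"
  shows "(1 - exp_pow 2) ^ 3 * (fps_const (theta3_appell c 3) * (exp_pow 3 * theta4)) =
    theta1 2 ^ 3 * (fps_const (1 - c) * (exp_pow 1 + exp_pow 5) + fps_const (6 + 2 * c) * exp_pow 3 + (1 - exp_pow 2) ^ 3 * texp id (appell c))"
proof -
  define H where "H = (\<lambda>x. if odd x \<and> 0 < x then quad_wt c x else 0)"
  define h where "h = backward_diff (backward_diff (backward_diff H))"
  have range: "range (\<lambda>i::int. 3 + 2 * i) = {k. odd k}"
  proof safe
    fix k :: int assume "odd k"
    then have "k = 3 + 2 * ((k - 3) div 2)" by simp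
    then show "k \<in> range (\<lambda>i. 3 + 2 * i)" by blast
  qed simp
  have s4: "fsummable (\<lambda>i. alt i * fps_X ^ nat (i ^ 2) :: rat fps)" using fsummable_theta4_coeff[of "\<lambda>_. 1"] by simp
  have "fsummable (\<lambda>i. theta3_appell c (3 + 2 * i))"
    unfolding theta3_appell_odd[OF bd] by (rule fsummable_theta4_coeff)
  then have sg: "fsummable (theta3_appell c)"
    by (rule fsummable_zero_outside) (simp add: range theta3_appell_even)
  have "texp (\<lambda>i. 2 * i + 3) (\<lambda>i. theta3_appell c 3 * (alt i * fps_X ^ nat (i ^ 2))) = texp id (theta3_appell c)"
  proof (rule texp_reindex[where h = "\<lambda>i. 3 + 2 * i" and A = UNIV and B = "range (\<lambda>i. 3 + 2 * i)"])
    show "theta3_appell c j = 0" if "j \<notin> range (\<lambda>i. 3 + 2 * i)" for j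
      using that unfolding range by (simp add: theta3_appell_even)
    show "theta3_appell c 3 * (alt i * fps_X ^ nat (i ^ 2)) = theta3_appell c (3 + 2 * i)" for i
      unfolding theta3_appell_odd[OF bd] by (simp only: mult_ac)
  qed (auto simp: bij_betw_def inj_def)
  then have G: "texp id (theta3_appell c) = fps_const (theta3_appell c 3) * (exp_pow 3 * theta4)"
    unfolding texp_cmult[OF s4] texp_shift[OF s4] theta4_def by (rule sym)
  have y: "backward_diff (backward_diff (backward_diff (appell1 c))) = (\<lambda>k. h k + backward_diff (backward_diff (backward_diff (appell c))) k)"
    unfolding h_def H_def by (rule ext) (simp only: backward_diff_def appell1_minus(2), simp only: algebra_simps)
  \<comment> \<open>A third difference of a quadratic vanishes once \<open>k - 6 > 0\<close>; what
    remains is \<open>1 - c\<close>, \<open>(9 - c) - 3 (1 - c)\<close> and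
    \<open>(25 - c) - 3 (9 - c) + 3 (1 - c)\<close>.\<close>
  have hv: "h k = (if k = 1 \<or> k = 5 then 1 - c else if k = 3 then 6 + 2 * c else 0)" for k
  proof -
    have "even k \<or> k < 0 \<or> k = 1 \<or> k = 3 \<or> k = 5 \<or> odd k \<and> k > 6" by presburger
    then consider "even k \<or> k < 0" | "k = 1" | "k = 3" | "k = 5" | "odd k" "k > 6" by blast
    then show ?thesis
      by cases (auto simp: h_def backward_diff_def H_def quad_wt_def power2_eq_square algebra_simps)
  qed
  have fin: "finite {i. h i \<noteq> 0}" by (rule finite_subset[of _ "{1, 3, 5}"]) (auto simp: hv)
  then have sh: "fsummable h" by (rule fsummable_finite)
  have th: "texp id h = fps_const (1 - c) * (exp_pow 1 + exp_pow 5) + fps_const (6 + 2 * c) * exp_pow 3"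
  proof (rule fps_ext)
    fix m
    have "texp id h $ m = (\<Sum>i\<in>{1, 3, 5}. h i * ecoeff i m)"
      unfolding texp_nth by (subst fsum_finite[where S = "{1, 3, 5}"]) (auto simp: hv)
    then show "texp id h $ m = (fps_const (1 - c) * (exp_pow 1 + exp_pow 5) + fps_const (6 + 2 * c) * exp_pow 3) $ m"
      by (simp add: hv exp_pow_nth algebra_simps)
  qed
  note sy = fsummable_backward_diff[OF fsummable_backward_diff[OF fsummable_backward_diff[OF fsummable_appell[of c]]]]
  have sv: "fsummable (backward_diff (backward_diff (backward_diff (appell1 c))))"
    unfolding y by (rule fsummable_add[OF sh sy])
  have "texp id (backward_diff (backward_diff (backward_diff (theta3_appell c)))) = (1 - exp_pow 2) ^ 3 * texp id (theta3_appell c)"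
    by (simp add: texp_backward_diff sg fsummable_backward_diff power3_eq_cube mult.assoc)
  moreover have "backward_diff (backward_diff (backward_diff (theta3_appell c))) = theta_op (theta_op (theta_op (backward_diff (backward_diff (backward_diff (appell1 c))))))"
    by (simp only: theta3_appell_def backward_diff_theta_op)
  moreover have "texp id (theta_op (theta_op (theta_op (backward_diff (backward_diff (backward_diff (appell1 c))))))) = theta1 2 ^ 3 * texp id (backward_diff (backward_diff (backward_diff (appell1 c))))"
    by (simp add: texp_theta_op sv fsummable_theta_op' power3_eq_cube mult.assoc)
  moreover have "texp id (backward_diff (backward_diff (backward_diff (appell1 c)))) = texp id h + (1 - exp_pow 2) ^ 3 * texp id (appell c)"
    unfolding y texp_add[OF sh sy]
    by (simp add: texp_backward_diff fsummable_appell fsummable_backward_diff power3_eq_cube mult.assoc)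
  ultimately show ?thesis unfolding G th by simp
qed

section \<open>Logarithmic derivatives and heat equations\<close>

lemma fsum_telescope_nat:
  fixes A :: "nat \<Rightarrow> nat \<Rightarrow> 'a::comm_ring_1 fps"
  assumes "fsummable (\<lambda>(k, l). A k l)"
  shows "fsum (\<lambda>(k, l). A k l) - fsum (\<lambda>(k, l). A k (l + s)) = (\<Sum>l<s. fsum (\<lambda>k. A k l))"
  using assms
proof (induction s arbitrary: A)
  case 0
  then show ?case by simp
next
  case (Suc s)
  have inj: "inj (\<lambda>(k::nat, l::nat). (k, Suc l))" by (auto simp: inj_def)
  have s': "fsummable (\<lambda>(k, l). A k (Suc l))"
    using fsummable_comp[OF Suc.prems inj] by (simp add: case_prod_unfold)
  have "fsum (\<lambda>(k, l). A k l) = fsum (\<lambda>k. A k 0 + fsum (\<lambda>l. A k (Suc l)))"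
    unfolding fsum_pair[OF Suc.prems, symmetric]
    by (rule arg_cong[of _ _ fsum], rule ext) (rule fsum_Suc[OF fsummable_pair(1)[OF Suc.prems]])
  also have "\<dots> = fsum (\<lambda>k. A k 0) + fsum (\<lambda>k. fsum (\<lambda>l. A k (Suc l)))"
  proof (rule fsum_add)
    show "fsummable (\<lambda>k. A k 0)"
      using fsummable_comp[OF Suc.prems, of "\<lambda>k. (k, 0)"] by (simp add: inj_def)
    show "fsummable (\<lambda>k. fsum (\<lambda>l. A k (Suc l)))" by (rule fsummable_pair(2)[OF s'])
  qed
  also have "fsum (\<lambda>k. fsum (\<lambda>l. A k (Suc l))) = fsum (\<lambda>(k, l). A k (Suc l))"
    by (rule fsum_pair[OF s'])
  finally have "fsum (\<lambda>(k, l). A k l) - fsum (\<lambda>(k, l). A k (l + Suc s))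
     = fsum (\<lambda>k. A k 0) + (fsum (\<lambda>(k, l). A k (Suc l)) - fsum (\<lambda>(k, l). A k (Suc (l + s))))"
    by simp
  also have "\<dots> = fsum (\<lambda>k. A k 0) + (\<Sum>l<s. fsum (\<lambda>k. A k (Suc l)))"
    using Suc.IH[OF s'] by simp
  also have "\<dots> = (\<Sum>l<Suc s. fsum (\<lambda>k. A k l))"
    by (rule sum.lessThan_Suc_shift[symmetric])
  finally show ?case .
qed

lemma fsum_int_split:
  fixes f :: "int \<Rightarrow> 'a::comm_ring_1 fps"
  assumes "fsummable f"
  shows "fsum f = f 0 + fsum (\<lambda>k. f (int k + 1)) + fsum (\<lambda>k. f (- (int k + 1)))"
proof -
  define a where "a = (\<lambda>i::int. if i = 0 then f 0 else 0)"
  define b where "b = (\<lambda>i::int. if i > 0 then f i else 0)"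
  define c where "c = (\<lambda>i::int. if i < 0 then f i else 0)"
  have s: "fsummable a" "fsummable b" "fsummable c"
    unfolding a_def b_def c_def using fsummable_if[OF assms, of "\<lambda>i. i > 0"] fsummable_if[OF assms, of "\<lambda>i. i < 0"]
    by (auto intro!: fsummable_finite finite_subset[of _ "{0}"] split: if_splits)
  have "fsum f = fsum (\<lambda>i. a i + b i + c i)"
    by (rule arg_cong[of _ _ fsum]) (auto simp: a_def b_def c_def)
  also have "\<dots> = fsum a + fsum b + fsum c"
    by (simp add: fsum_add fsummable_add s)
  also have "fsum a = f 0" using fsum_finite[of "{0}" a] by (simp add: a_def)
  also have "fsum b = fsum (\<lambda>k. f (int k + 1))"
    by (rule fsum_reindex[where h = "\<lambda>i. nat (i - 1)" and A = "{0<..}" and B = UNIV])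
       (auto simp: b_def intro!: bij_betwI[where g = "\<lambda>k. int k + 1"])
  also have "fsum c = fsum (\<lambda>k. f (- (int k + 1)))"
    by (rule fsum_reindex[where h = "\<lambda>i. nat (- i - 1)" and A = "{..<0}" and B = UNIV])
       (auto simp: c_def intro!: bij_betwI[where g = "\<lambda>k. - (int k + 1)"])
  finally show ?thesis .
qed

lemma sum_paired:
  fixes B :: "nat \<Rightarrow> rat fps"
  assumes "\<And>l. l < M \<Longrightarrow> B l + B (M - Suc l) = c"
  shows "2 * (\<Sum>l<M. B l) = of_nat M * c"
proof -
  have "2 * (\<Sum>l<M. B l) = (\<Sum>l<M. B l) + (\<Sum>l<M. B (M - Suc l))"
    by (simp add: sum.nat_diff_reindex)
  also have "\<dots> = (\<Sum>l<M. c)"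
    by (simp add: assms flip: sum.distrib)
  finally show ?thesis by simp
qed

text \<open>For \<open>m\<close> odd the involution \<open>K \<mapsto> -m - K\<close> changes the sign of every term.\<close>

lemma fsum_alternating:
  assumes "odd m" "\<And>K. e (- m - K) = e K" "fsummable (\<lambda>K. alt K * fps_X ^ e K :: rat fps)"
  shows "fsum (\<lambda>K. alt K * fps_X ^ e K) = (0 :: rat fps)"
proof -
  have "fsum (\<lambda>K. alt K * fps_X ^ e K) = fsum (\<lambda>K. alt (- m - K) * fps_X ^ e (- m - K) :: rat fps)"
    by (rule fsum_bij[OF bij_int_diff(1), symmetric])
  also have "\<dots> = fsum (\<lambda>K. - (alt K * fps_X ^ e K))"
    using assms(1,2) by (intro arg_cong[of _ _ fsum]) (auto simp: alt_def)
  also have "\<dots> = - fsum (\<lambda>K. alt K * fps_X ^ e K)" by (rule fsum_uminus)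
  finally show ?thesis by (simp add: eq_neg_iff_add_eq_0 flip: mult_2)
qed

lemma alt_simps: "alt (i + j) = (alt i * alt j :: rat fps)" "alt (i - j) = (alt i * alt j :: rat fps)"
  "alt (- i) = (alt i :: rat fps)" "alt i * alt i = (1 :: rat fps)"
  by (auto simp: alt_def)

text \<open>The shape taken by the \<open>t\<close>-derivative of the logarithm of a product of
  factors \<open>(1 - w^2 q^m) (1 - w^(-2) q^m)\<close>, with the geometric series expanded.\<close>

definition lseries :: "(nat \<Rightarrow> nat \<Rightarrow> nat) \<Rightarrow> rat fps fps" where
  "lseries e = texp (\<lambda>(k, l). 2 * (int k + 1)) (\<lambda>(k, l). - 2 * fps_X ^ e k l)
     - texp (\<lambda>(k, l). 2 * - (int k + 1)) (\<lambda>(k, l). - 2 * fps_X ^ e k l)"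

lemma lseries_mult:
  fixes s :: "int \<Rightarrow> rat fps"
  assumes e: "fsummable (\<lambda>(k, l). fps_X ^ e k l :: rat fps)" and s: "fsummable s"
  shows "lseries e * texp (\<lambda>i. 2 * i) s = texp (\<lambda>j. 2 * j)
    (\<lambda>j. fsum (\<lambda>(k, l). - 2 * fps_X ^ e k l * s (j - (int k + 1))) - fsum (\<lambda>(k, l). - 2 * fps_X ^ e k l * s (j + (int k + 1))))"
  "fsummable (\<lambda>j. fsum (\<lambda>(k, l). - 2 * fps_X ^ e k l * s (j - (int k + 1))) - fsum (\<lambda>(k, l). - 2 * fps_X ^ e k l * s (j + (int k + 1))))"
proof -
  have e': "fsummable (\<lambda>(k, l). - 2 * fps_X ^ e k l :: rat fps)"
    using fsummable_mult_left[OF e, of "\<lambda>_. - 2"] by (simp add: case_prod_unfold)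
  define d where "d = (\<lambda>(k::nat, l::nat). int k + 1)"
  define d' where "d' = (\<lambda>(k::nat, l::nat). - (int k + 1))"
  define a where "a = (\<lambda>(k, l). - 2 * fps_X ^ e k l :: rat fps)"
  note 1 = texp_conv[OF e' s, of 2 d, folded a_def] texp_conv[OF e' s, of 2 d', folded a_def]
  note 2 = fsummable_conv(2)[OF e' s, of d, folded a_def] fsummable_conv(2)[OF e' s, of d', folded a_def]
  have eq: "(\<lambda>j. fsum (\<lambda>(k, l). - 2 * fps_X ^ e k l * s (j - (int k + 1))) - fsum (\<lambda>(k, l). - 2 * fps_X ^ e k l * s (j + (int k + 1))))
    = (\<lambda>j. fsum (\<lambda>i. a i * s (j - d i)) - fsum (\<lambda>i. a i * s (j - d' i)))"
    unfolding a_def d_def d'_def case_prod_unfold diff_minus_eq_add by (rule refl)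
  have "lseries e = texp (\<lambda>i. 2 * d i) a - texp (\<lambda>i. 2 * d' i) a"
    by (simp add: lseries_def a_def d_def d'_def case_prod_unfold)
  then show "lseries e * texp (\<lambda>i. 2 * i) s = texp (\<lambda>j. 2 * j)
    (\<lambda>j. fsum (\<lambda>(k, l). - 2 * fps_X ^ e k l * s (j - (int k + 1))) - fsum (\<lambda>(k, l). - 2 * fps_X ^ e k l * s (j + (int k + 1))))"
    unfolding eq texp_diff[OF 2] 1 by (simp only: left_diff_distrib)
  show "fsummable (\<lambda>j. fsum (\<lambda>(k, l). - 2 * fps_X ^ e k l * s (j - (int k + 1))) - fsum (\<lambda>(k, l). - 2 * fps_X ^ e k l * s (j + (int k + 1))))"
    unfolding eq by (rule fsummable_diff[OF 2])
qed

definition theta4_coeff :: "int \<Rightarrow> rat fps" where "theta4_coeff i = alt i * fps_X ^ nat (i ^ 2)"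

definition log_theta4 :: "rat fps fps" where "log_theta4 = lseries (\<lambda>k l. Suc k * (2 * l + 1))"

lemma fsummable_theta4_coeff': "fsummable theta4_coeff"
  using fsummable_theta4_coeff[of "\<lambda>_. 1"] by (simp add: theta4_coeff_def[abs_def])

lemma fsummable_kl1: "fsummable (\<lambda>(k, l). fps_X ^ (Suc k * (2 * l + 1)) * b k l :: rat fps)"
proof -
  have "fsummable (\<lambda>p. (case p of (k, l) \<Rightarrow> b k l) * fps_X ^ (case p of (k, l) \<Rightarrow> Suc k * (2 * l + 1)) :: rat fps)"
  proof (rule fsummable_X_power_bounded[where S = "\<lambda>N. {..N} \<times> {..N}"])
    fix N and p :: "nat \<times> nat"
    assume "(case p of (k, l) \<Rightarrow> Suc k * (2 * l + 1)) \<le> N"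
    then show "p \<in> {..N} \<times> {..N}" by (cases p) (auto simp: algebra_simps)
  qed simp
  then show ?thesis by (simp add: case_prod_unfold mult.commute)
qed

text \<open>The coefficient of \<open>w^(2 j)\<close> in the logarithmic derivative identity.
  Because \<open>(j + k)^2 - (j - k)^2 = 4 j k\<close>, the second sum is the first with
  \<open>l\<close> shifted by \<open>2 j\<close>, so only the rows \<open>l < 2 j\<close> survive.
  Rows \<open>l\<close> and \<open>2 j - 1 - l\<close> together form a bilateral alternating sum
  lacking its term \<open>K = 0\<close>; the full sum vanishes, so each pair is determined by that
  term.\<close>

lemma theta4_coeff_log_coeff_nonneg:
  "fsum (\<lambda>(k, l). - 2 * fps_X ^ (Suc k * (2 * l + 1)) * theta4_coeff (int j - (int k + 1)))
   - fsum (\<lambda>(k, l). - 2 * fps_X ^ (Suc k * (2 * l + 1)) * theta4_coeff (int j + (int k + 1))) = of_nat (2 * j) * theta4_coeff (int j)"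
proof -
  define A where "A = (\<lambda>k l. - 2 * fps_X ^ (Suc k * (2 * l + 1)) * theta4_coeff (int j - (int k + 1)))"
  have sA: "fsummable (\<lambda>(k, l). A k l)"
    using fsummable_kl1[of "\<lambda>k l. - 2 * theta4_coeff (int j - (int k + 1))"] by (simp add: A_def mult_ac)
  have e: "int (nat (i ^ 2)) = i ^ 2" for i :: int by simp
  have shift: "- 2 * fps_X ^ (Suc k * (2 * l + 1)) * theta4_coeff (int j + (int k + 1)) = A k (l + 2 * j)" for k l
  proof -
    have "Suc k * (2 * l + 1) + nat ((int j + (int k + 1)) ^ 2) = Suc k * (2 * (l + 2 * j) + 1) + nat ((int j - (int k + 1)) ^ 2)"
      unfolding of_nat_eq_iff[where 'a = int, symmetric] of_nat_add e
      by (simp add: algebra_simps power2_eq_square)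
    then have "fps_X ^ (Suc k * (2 * l + 1)) * fps_X ^ nat ((int j + (int k + 1)) ^ 2)
      = (fps_X ^ (Suc k * (2 * (l + 2 * j) + 1)) * fps_X ^ nat ((int j - (int k + 1)) ^ 2) :: rat fps)"
      by (simp only: power_add[symmetric])
    then show ?thesis unfolding A_def theta4_coeff_def alt_simps(1,2) by (simp only: mult_ac)
  qed
  have "2 * (\<Sum>l<2 * j. fsum (\<lambda>k. A k l)) = of_nat (2 * j) * (2 * theta4_coeff (int j))"
  proof (rule sum_paired)
    fix l assume l: "l < 2 * j"
    define m where "m = 2 * int l + 1 - 2 * int j"
    define ex where "ex = (\<lambda>K. nat (int j ^ 2 + K ^ 2 + K * m))"
    \<comment> \<open>Makes \<open>nat\<close> exact in \<open>ex\<close> and the family summable;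
      it rests on \<open>|m| \<le> 2 j - 1\<close>, that is, on \<open>l < 2 j\<close>.\<close>
    have pos: "\<bar>K\<bar> \<le> int j ^ 2 + K ^ 2 + K * m" for K
    proof -
      have "\<bar>m\<bar> \<le> 2 * int j - 1" using l by (simp add: m_def)
      then have "\<bar>K\<bar> * \<bar>m\<bar> \<le> \<bar>K\<bar> * (2 * int j - 1)" by (rule mult_left_mono) simp
      moreover have "- (\<bar>K\<bar> * \<bar>m\<bar>) \<le> K * m" by (metis abs_ge_minus_self abs_mult neg_le_iff_le minus_minus)
      moreover have "0 \<le> (int j - \<bar>K\<bar>) ^ 2" by simp
      ultimately show ?thesis by (simp add: power2_eq_square algebra_simps)
    qed
    have sx: "fsummable (\<lambda>K. alt K * fps_X ^ ex K :: rat fps)"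
    proof (rule fsummable_X_power_bounded[where S = "\<lambda>N. {- int N..int N}"])
      fix N K assume "ex K \<le> N"
      then show "K \<in> {- int N..int N}" using pos[of K] by (auto simp: ex_def)
    qed simp
    have Z: "fsum (\<lambda>K. alt K * fps_X ^ ex K) = (0 :: rat fps)"
    proof (rule fsum_alternating[OF _ _ sx])
      show "odd m" by (simp add: m_def)
      show "ex (- m - K) = ex K" for K by (simp add: ex_def power2_eq_square algebra_simps)
    qed
    have A1: "A k l = - 2 * alt (int j) * (alt (int k + 1) * fps_X ^ ex (int k + 1))" for k
    proof -
      have "Suc k * (2 * l + 1) + nat ((int j - (int k + 1)) ^ 2) = ex (int k + 1)"
        unfolding of_nat_eq_iff[where 'a = int, symmetric] of_nat_add e ex_def
        using pos[of "int k + 1"] by (simp add: m_def algebra_simps power2_eq_square)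
      then have *: "fps_X ^ (Suc k * (2 * l + 1)) * fps_X ^ nat ((int j - (int k + 1)) ^ 2) = (fps_X ^ ex (int k + 1) :: rat fps)"
        by (simp only: power_add[symmetric])
      show ?thesis
        unfolding *[symmetric] A_def theta4_coeff_def alt_simps(2)[of "int j"] by (simp only: mult_ac)
    qed
    \<comment> \<open>The mirrored row is row \<open>l\<close> with \<open>k + 1\<close> replaced by
      its negative.\<close>
    have A2: "A k (2 * j - Suc l) = - 2 * alt (int j) * (alt (- (int k + 1)) * fps_X ^ ex (- (int k + 1)))" for k
    proof -
      have "int (2 * j - Suc l) = 2 * int j - 1 - int l" using l by simp
      then have "Suc k * (2 * (2 * j - Suc l) + 1) + nat ((int j - (int k + 1)) ^ 2) = ex (- (int k + 1))"
        unfolding of_nat_eq_iff[where 'a = int, symmetric] of_nat_add of_nat_mult e ex_def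
        using pos[of "- (int k + 1)"] by (simp add: m_def algebra_simps power2_eq_square)
      then have *: "fps_X ^ (Suc k * (2 * (2 * j - Suc l) + 1)) * fps_X ^ nat ((int j - (int k + 1)) ^ 2)
          = (fps_X ^ ex (- (int k + 1)) :: rat fps)"
        by (simp only: power_add[symmetric])
      show ?thesis
        unfolding *[symmetric] A_def theta4_coeff_def alt_simps(2)[of "int j"] alt_simps(3) by (simp only: mult_ac)
    qed
    have s1: "fsummable (\<lambda>k. alt (int k + 1) * fps_X ^ ex (int k + 1) :: rat fps)"
      "fsummable (\<lambda>k. alt (- (int k + 1)) * fps_X ^ ex (- (int k + 1)) :: rat fps)"
      using fsummable_comp[OF sx, of "\<lambda>k::nat. int k + 1"] fsummable_comp[OF sx, of "\<lambda>k::nat. - (int k + 1)"]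
      by (auto simp: inj_def)
    have "fsum (\<lambda>k. A k l) + fsum (\<lambda>k. A k (2 * j - Suc l)) = - 2 * alt (int j) *
       (fsum (\<lambda>k. alt (int k + 1) * fps_X ^ ex (int k + 1)) + fsum (\<lambda>k. alt (- (int k + 1)) * fps_X ^ ex (- (int k + 1))))"
      unfolding A1 A2 fsum_cmult[OF s1(1)] fsum_cmult[OF s1(2)] by (simp only: distrib_left)
    also have "\<dots> = - 2 * alt (int j) * (- (alt 0 * fps_X ^ ex 0))"
      by (rule arg_cong[of _ _ "\<lambda>x. - 2 * alt (int j) * x"], rule minus_unique[symmetric])
         (use Z fsum_int_split[OF sx] in \<open>simp only: add.assoc\<close>)
    also have "\<dots> = 2 * theta4_coeff (int j)"
      by (simp add: theta4_coeff_def ex_def alt_def)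
    finally show "fsum (\<lambda>k. A k l) + fsum (\<lambda>k. A k (2 * j - Suc l)) = 2 * theta4_coeff (int j)" .
  qed
  then have "2 * (\<Sum>l<2 * j. fsum (\<lambda>k. A k l)) = 2 * (of_nat (2 * j) * theta4_coeff (int j))"
    by (simp only: mult.left_commute)
  then have "(\<Sum>l<2 * j. fsum (\<lambda>k. A k l)) = of_nat (2 * j) * theta4_coeff (int j)"
    by (rule mult_left_cancel[THEN iffD1, rotated]) simp
  then show ?thesis
    unfolding shift using fsum_telescope_nat[OF sA, of "2 * j"] by (simp add: A_def)
qed

lemma theta4_coeff_minus: "theta4_coeff (- i) = theta4_coeff i"
  by (simp add: theta4_coeff_def alt_simps)

lemma theta4_coeff_log_deriv: "fps_deriv theta4 = log_theta4 * theta4"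
proof -
  have e: "fsummable (\<lambda>(k, l). fps_X ^ (Suc k * (2 * l + 1)) :: rat fps)"
    using fsummable_kl1[of "\<lambda>_ _. 1"] by simp
  have D: "fsum (\<lambda>(k, l). - 2 * fps_X ^ (Suc k * (2 * l + 1)) * theta4_coeff (j - (int k + 1)))
   - fsum (\<lambda>(k, l). - 2 * fps_X ^ (Suc k * (2 * l + 1)) * theta4_coeff (j + (int k + 1))) = of_int (2 * j) * theta4_coeff j" for j
  proof (cases "j \<ge> 0")
    case True
    then obtain n where "j = int n" using zero_le_imp_eq_int by blast
    then show ?thesis using theta4_coeff_log_coeff_nonneg[of n] by simp
  next
    case False
    then obtain n where j: "j = - int n" by (metis linear zero_le_imp_eq_int minus_minus neg_0_le_iff_le)
    have "j - (int k + 1) = - (int n + (int k + 1))" "j + (int k + 1) = - (int n - (int k + 1))" for k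
      by (simp_all add: j)
    then have "theta4_coeff (j - (int k + 1)) = theta4_coeff (int n + (int k + 1))" "theta4_coeff (j + (int k + 1)) = theta4_coeff (int n - (int k + 1))" for k
      by (simp_all only: theta4_coeff_minus)
    then show ?thesis using theta4_coeff_log_coeff_nonneg[of n] by (simp add: j theta4_coeff_minus algebra_simps)
  qed
  have "log_theta4 * theta4 = texp (\<lambda>i. 2 * i) (\<lambda>j. of_int (2 * j) * theta4_coeff j)"
    using lseries_mult(1)[OF e fsummable_theta4_coeff'] unfolding D
    by (simp add: log_theta4_def theta4_def theta4_coeff_def[abs_def])
  also have "\<dots> = fps_deriv theta4"
    using texp_deriv[OF fsummable_theta4_coeff', of "\<lambda>i. 2 * i"] by (simp add: theta4_def theta4_coeff_def[abs_def])
  finally show ?thesis ..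
qed

section \<open>Logarithmic derivative of the odd theta series\<close>

definition log_theta1 :: "nat \<Rightarrow> rat fps fps" where "log_theta1 b = lseries (\<lambda>k l. b * (Suc k * Suc l))"

lemma fsummable_kl2: "0 < b \<Longrightarrow> fsummable (\<lambda>(k, l). fps_X ^ (b * (Suc k * Suc l)) * c k l :: rat fps)"
  using fsummable_eis[of b c] by (simp add: mult.commute)

text \<open>As for \<open>theta4\<close>, but the shift in \<open>l\<close> is
  \<open>2 j + 1\<close>: the row \<open>l = 2 j\<close> has no partner and yields the tail sum. The
  tail reflects the factor \<open>1 - w^2\<close> of the theta function, which
  \<open>log_theta1\<close> leaves out.\<close>

lemma theta_coeff_log_coeff:
  assumes b: "0 < b"
  shows "fsum (\<lambda>(k, l). - 2 * fps_X ^ (b * (Suc k * Suc l)) * theta_coeff b (int j + 1 - (int k + 1)))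
   - fsum (\<lambda>(k, l). - 2 * fps_X ^ (b * (Suc k * Suc l)) * theta_coeff b (int j + 1 + (int k + 1)))
   = (of_nat (2 * j) * theta_coeff b (int j + 1) - 2 * fsum (\<lambda>k. theta_coeff b (int j + 1 + (int k + 1))) :: rat fps)"
proof -
  define J where "J = int j + 1"
  define A where "A = (\<lambda>k l. - 2 * fps_X ^ (b * (Suc k * Suc l)) * theta_coeff b (J - (int k + 1)) :: rat fps)"
  have sA: "fsummable (\<lambda>(k, l). A k l)"
    using fsummable_kl2[OF b, of "\<lambda>k l. - 2 * theta_coeff b (J - (int k + 1))"] by (simp add: A_def mult_ac)
  have t: "2 * (Suc k * Suc l + tri i) = 2 * ex \<Longrightarrow>
      fps_X ^ (b * (Suc k * Suc l)) * fps_X ^ (b * tri i) = (fps_X ^ (b * ex) :: rat fps)" for k l i ex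
    by (simp only: power_add[symmetric] distrib_left[symmetric] mult_cancel1) simp
  have t2: "int (2 * (Suc k * Suc l + tri i)) = 2 * (int k + 1) * (int l + 1) + i * (i - 1)" for k l i
    using tri_int[of i] by (simp add: algebra_simps)
  have shift: "- 2 * fps_X ^ (b * (Suc k * Suc l)) * theta_coeff b (J + (int k + 1)) = A k (l + (2 * j + 1))" for k l
  proof -
    have "2 * (Suc k * Suc l + tri (J + (int k + 1))) = 2 * (Suc k * Suc (l + (2 * j + 1)) + tri (J - (int k + 1)))"
      unfolding of_nat_eq_iff[where 'a = int, symmetric] t2 by (simp add: J_def algebra_simps)
    from t[OF this] have "fps_X ^ (b * (Suc k * Suc l)) * fps_X ^ (b * tri (J + (int k + 1)))
      = (fps_X ^ (b * (Suc k * Suc (l + (2 * j + 1)))) * fps_X ^ (b * tri (J - (int k + 1))) :: rat fps)"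
      by (simp only: power_add distrib_left)
    then show ?thesis unfolding A_def theta_coeff_def alt_simps(1,2)[of J] by (simp only: mult_ac)
  qed
  have "2 * (\<Sum>l<2 * j. fsum (\<lambda>k. A k l)) = of_nat (2 * j) * (2 * theta_coeff b J)"
  proof (rule sum_paired)
    fix l assume l: "l < 2 * j"
    define m where "m = 2 * int l + 1 - 2 * int j"
    define ex where "ex = (\<lambda>K. nat ((J * (J - 1) + K ^ 2 + K * m) div 2))"
    have bound: "(\<bar>K\<bar> - int j) ^ 2 + \<bar>K\<bar> + int j \<le> J * (J - 1) + K ^ 2 + K * m" for K
    proof -
      have "\<bar>m\<bar> \<le> 2 * int j - 1" using l by (simp add: m_def)
      then have "\<bar>K\<bar> * \<bar>m\<bar> \<le> \<bar>K\<bar> * (2 * int j - 1)" by (rule mult_left_mono) simp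
      moreover have "- (\<bar>K\<bar> * \<bar>m\<bar>) \<le> K * m" by (metis abs_ge_minus_self abs_mult neg_le_iff_le minus_minus)
      ultimately show ?thesis by (simp add: J_def power2_eq_square algebra_simps)
    qed
    have pos: "2 * \<bar>K\<bar> - 2 \<le> J * (J - 1) + K ^ 2 + K * m" for K
    proof -
      define x where "x = \<bar>K\<bar> - int j"
      have "x \<le> x ^ 2"
      proof (cases "x \<ge> 1")
        case True
        then show ?thesis using mult_left_mono[of 1 x x] by (simp add: power2_eq_square)
      next
        case False
        then show ?thesis using zero_le_power2[of x] by linarith
      qed
      then show ?thesis using bound[of K] by (simp add: x_def)
    qed
    have ev: "even (J * (J - 1) + K ^ 2 + K * m)" for K by (simp add: m_def)
    have pos0: "0 \<le> J * (J - 1) + K ^ 2 + K * m" for K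
      using bound[of K] zero_le_power2[of "\<bar>K\<bar> - int j"] by linarith
    have ex: "int (2 * ex K) = J * (J - 1) + K ^ 2 + K * m" for K
      using ev[of K] pos0[of K] by (simp add: ex_def)
    have sx: "fsummable (\<lambda>K. alt K * fps_X ^ (b * ex K) :: rat fps)"
    proof (rule fsummable_X_power_bounded[where S = "\<lambda>N. {- int (N + 1)..int (N + 1)}"])
      fix N K assume le: "b * ex K \<le> N"
      have "ex K \<le> b * ex K" using b by (cases b) auto
      then have "ex K \<le> N" using le by (rule le_trans)
      then have "int (2 * ex K) \<le> 2 * int N" by simp
      then show "K \<in> {- int (N + 1)..int (N + 1)}" unfolding ex using pos[of K] by auto
    qed simp
    have Z: "fsum (\<lambda>K. alt K * fps_X ^ (b * ex K)) = (0 :: rat fps)"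
    proof (rule fsum_alternating[OF _ _ sx])
      show "odd m" by (simp add: m_def)
      show "b * ex (- m - K) = b * ex K" for K by (simp add: ex_def power2_eq_square algebra_simps)
    qed
    have A1: "A k l = - 2 * alt J * (alt (int k + 1) * fps_X ^ (b * ex (int k + 1)))" for k
    proof -
      have "2 * (Suc k * Suc l + tri (J - (int k + 1))) = 2 * ex (int k + 1)"
        unfolding of_nat_eq_iff[where 'a = int, symmetric] t2 ex
        by (simp add: m_def J_def algebra_simps power2_eq_square)
      from t[OF this] show ?thesis
        unfolding A_def theta_coeff_def alt_simps(2)[of J] by (metis (no_types, lifting) mult.assoc mult.left_commute)
    qed
    have A2: "A k (2 * j - Suc l) = - 2 * alt J * (alt (- (int k + 1)) * fps_X ^ (b * ex (- (int k + 1))))" for k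
    proof -
      have "int (2 * j - Suc l) = 2 * int j - 1 - int l" using l by simp
      then have "2 * (Suc k * Suc (2 * j - Suc l) + tri (J - (int k + 1))) = 2 * ex (- (int k + 1))"
        unfolding of_nat_eq_iff[where 'a = int, symmetric] t2 ex
        by (simp add: m_def J_def algebra_simps power2_eq_square)
      from t[OF this] show ?thesis
        unfolding A_def theta_coeff_def alt_simps(2)[of J] alt_simps(3) by (metis (no_types, lifting) mult.assoc mult.left_commute)
    qed
    have s1: "fsummable (\<lambda>k. alt (int k + 1) * fps_X ^ (b * ex (int k + 1)) :: rat fps)"
      "fsummable (\<lambda>k. alt (- (int k + 1)) * fps_X ^ (b * ex (- (int k + 1))) :: rat fps)"
      using fsummable_comp[OF sx, of "\<lambda>k::nat. int k + 1"] fsummable_comp[OF sx, of "\<lambda>k::nat. - (int k + 1)"]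
      by (auto simp: inj_def)
    have "fsum (\<lambda>k. A k l) + fsum (\<lambda>k. A k (2 * j - Suc l)) = - 2 * alt J *
       (fsum (\<lambda>k. alt (int k + 1) * fps_X ^ (b * ex (int k + 1))) + fsum (\<lambda>k. alt (- (int k + 1)) * fps_X ^ (b * ex (- (int k + 1)))))"
      unfolding A1 A2 fsum_cmult[OF s1(1)] fsum_cmult[OF s1(2)] by (simp only: distrib_left)
    also have "\<dots> = - 2 * alt J * (- (alt 0 * fps_X ^ (b * ex 0)))"
      by (rule arg_cong[of _ _ "\<lambda>x. - 2 * alt J * x"], rule minus_unique[symmetric])
         (use Z fsum_int_split[OF sx] in \<open>simp only: add.assoc\<close>)
    also have "\<dots> = 2 * theta_coeff b J"
      by (simp add: theta_coeff_def ex_def alt_def tri_def)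
    finally show "fsum (\<lambda>k. A k l) + fsum (\<lambda>k. A k (2 * j - Suc l)) = 2 * theta_coeff b J" .
  qed
  then have "2 * (\<Sum>l<2 * j. fsum (\<lambda>k. A k l)) = 2 * (of_nat (2 * j) * theta_coeff b J)"
    by (simp only: mult.left_commute)
  then have S: "(\<Sum>l<2 * j. fsum (\<lambda>k. A k l)) = of_nat (2 * j) * theta_coeff b J"
    by (rule mult_left_cancel[THEN iffD1, rotated]) simp
  have sk: "fsummable (\<lambda>k. theta_coeff b (J + (int k + 1)) :: rat fps)"
    by (rule fsummable_comp[OF fsummable_theta_coeff[OF b]]) (auto simp: inj_def)
  have "A k (2 * j) = - 2 * theta_coeff b (J + (int k + 1))" for k
  proof -
    have "2 * (Suc k * Suc (2 * j) + tri (J - (int k + 1))) = 2 * tri (J + (int k + 1))"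
      unfolding of_nat_eq_iff[where 'a = int, symmetric] t2
      using tri_int[of "J + (int k + 1)"] by (simp add: J_def algebra_simps)
    from t[OF this] show ?thesis
      unfolding A_def theta_coeff_def alt_simps(1,2)[of J] by (metis (no_types, lifting) mult.assoc mult.left_commute)
  qed
  then have L: "fsum (\<lambda>k. A k (2 * j)) = - 2 * fsum (\<lambda>k. theta_coeff b (J + (int k + 1)))"
    by (simp add: fsum_cmult[OF sk, symmetric])
  show ?thesis
    unfolding J_def[symmetric] unfolding shift
    using fsum_telescope_nat[OF sA, of "2 * j + 1"] S L by (simp add: A_def)
qed

text \<open>The coefficient of \<open>w^(2 j)\<close> in
  \<open>log_theta1 b * theta1 b\<close>.\<close>

definition log_defect :: "nat \<Rightarrow> int \<Rightarrow> rat fps" where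
  "log_defect b j = fsum (\<lambda>(k, l). - 2 * fps_X ^ (b * (Suc k * Suc l)) * theta_coeff b (j - (int k + 1)))
   - fsum (\<lambda>(k, l). - 2 * fps_X ^ (b * (Suc k * Suc l)) * theta_coeff b (j + (int k + 1)))"

lemma log_defect_reflect: "log_defect b (1 - j) = log_defect b j"
proof -
  have "1 - j - (int k + 1) = 1 - (j + (int k + 1))" "1 - j + (int k + 1) = 1 - (j - (int k + 1))" for k
    by simp_all
  then have "log_defect b (1 - j) = fsum (\<lambda>(k, l). - (- 2 * fps_X ^ (b * (Suc k * Suc l)) * theta_coeff b (j + (int k + 1))))
     - fsum (\<lambda>(k, l). - (- 2 * fps_X ^ (b * (Suc k * Suc l)) * theta_coeff b (j - (int k + 1))))"
    unfolding log_defect_def by (simp only: theta_coeff_reflect mult_minus_right)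
  then show ?thesis
    by (simp only: log_defect_def case_prod_unfold fsum_uminus) simp
qed

lemma log_defect_diff_pos:
  assumes b: "0 < b"
  shows "log_defect b (int j + 2) - log_defect b (int j + 1) = of_int (2 * (int j + 2)) * theta_coeff b (int j + 2) - of_int (2 * (int j + 2) - 4) * theta_coeff b (int j + 1)"
proof -
  have s: "fsummable (\<lambda>k. theta_coeff b (int j + 2 + int k) :: rat fps)"
    by (rule fsummable_comp[OF fsummable_theta_coeff[OF b]]) (auto simp: inj_def)
  have F: "fsum (\<lambda>k. theta_coeff b (int j + 2 + int k)) = theta_coeff b (int j + 2) + fsum (\<lambda>k. theta_coeff b (int j + 2 + (int k + 1)) :: rat fps)"
    using fsum_Suc[OF s] by (simp add: add_ac)
  have D1: "log_defect b (int j + 1) = of_nat (2 * j) * theta_coeff b (int j + 1) - 2 * fsum (\<lambda>k. theta_coeff b (int j + 2 + int k))"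
    using theta_coeff_log_coeff[OF b, of j] by (simp add: log_defect_def add_ac)
  have D2: "log_defect b (int j + 2) = of_nat (2 * Suc j) * theta_coeff b (int j + 2) - 2 * fsum (\<lambda>k. theta_coeff b (int j + 2 + (int k + 1)))"
    using theta_coeff_log_coeff[OF b, of "Suc j"] by (simp add: log_defect_def add_ac)
  show ?thesis unfolding D1 D2 F by (simp add: algebra_simps)
qed

text \<open>Differencing collapses the tail sum to a single term; nonpositive \<open>j\<close>
  follow from the symmetry \<open>j \<mapsto> 1 - j\<close>.\<close>

lemma log_defect_diff:
  assumes b: "0 < b"
  shows "log_defect b j - log_defect b (j - 1) = of_int (2 * j) * theta_coeff b j - of_int (2 * j - 4) * theta_coeff b (j - 1)"
proof -
  consider "j \<ge> 2" | "j = 1" | "j \<le> 0" by linarith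
  then show ?thesis
  proof cases
    case 1
    then obtain n where "j = int n + 2" by (metis add.commute le_add_diff_inverse zero_le_imp_eq_int diff_ge_0_iff_ge diff_add_cancel)
    then show ?thesis using log_defect_diff_pos[OF b, of n] by (simp add: add.commute)
  next
    case 2
    have "theta_coeff b 1 = (- theta_coeff b 0 :: rat fps)" using theta_coeff_reflect[of b 0] by simp
    then show ?thesis using 2 log_defect_reflect[of b 0] by simp
  next
    case 3
    then obtain n where n: "j = - int n" by (metis zero_le_imp_eq_int minus_minus neg_0_le_iff_le)
    have e: "1 - (int n + 2) = j - 1" "1 - (int n + 1) = j" by (simp_all add: n)
    have "log_defect b j = log_defect b (int n + 1)" "log_defect b (j - 1) = log_defect b (int n + 2)"
      using log_defect_reflect[of b "int n + 1"] log_defect_reflect[of b "int n + 2"] unfolding e by simp_all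
    moreover have "theta_coeff b j = (- theta_coeff b (int n + 1) :: rat fps)" "theta_coeff b (j - 1) = (- theta_coeff b (int n + 2) :: rat fps)"
      using theta_coeff_reflect[of b "int n + 1"] theta_coeff_reflect[of b "int n + 2"] unfolding e by simp_all
    ultimately show ?thesis using log_defect_diff_pos[OF b, of n] by (simp add: n algebra_simps)
  qed
qed

text \<open>The cleared form of
  \<open>theta1' / theta1 = log_theta1 - 2 w^2 / (1 - w^2)\<close>.\<close>

lemma theta_coeff_log_deriv:
  assumes b: "0 < b"
  shows "(1 - exp_pow 2) * (log_theta1 b * theta1 b) = (1 - exp_pow 2) * fps_deriv (theta1 b) + 2 * exp_pow 2 * theta1 b"
proof -
  have e: "fsummable (\<lambda>(k, l). fps_X ^ (b * (Suc k * Suc l)) :: rat fps)"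
    using fsummable_kl2[OF b, of "\<lambda>_ _. 1"] by simp
  note st = fsummable_theta_coeff[OF b, where 'a = rat]
  have sD: "fsummable (log_defect b)"
    using lseries_mult(2)[OF e st] by (simp add: log_defect_def[abs_def])
  have RT: "log_theta1 b * theta1 b = texp (\<lambda>j. 2 * j) (log_defect b)"
    using lseries_mult(1)[OF e st] by (simp add: log_theta1_def theta1_def log_defect_def[abs_def])
  have shift: "exp_pow 2 * texp (\<lambda>j. 2 * j) s = texp (\<lambda>j. 2 * j) (\<lambda>j. s (j - 1))" if "fsummable s" for s :: "int \<Rightarrow> rat fps"
    unfolding texp_shift[OF that, symmetric]
    by (rule texp_reindex[of "\<lambda>j. j + 1" UNIV UNIV]) (auto intro!: bij_betwI[where g = "\<lambda>j. j - 1"])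
  have dT: "fps_deriv (theta1 b) = texp (\<lambda>j. 2 * j) (\<lambda>j. of_int (2 * j) * theta_coeff b j)"
    unfolding theta1_def by (rule texp_deriv[OF st])
  have sj: "fsummable (\<lambda>j. of_int (2 * j) * theta_coeff b j :: rat fps)" by (rule fsummable_mult_left[OF st])
  have sinh2: "fsummable (\<lambda>j. s (j - 1))" if "fsummable s" for s :: "int \<Rightarrow> rat fps" by (rule fsummable_shift[OF that])
  have "(1 - exp_pow 2) * (log_theta1 b * theta1 b) = texp (\<lambda>j. 2 * j) (\<lambda>j. log_defect b j - log_defect b (j - 1))"
    unfolding texp_diff[OF sD sinh2[OF sD]] RT shift[OF sD, symmetric] by (simp add: algebra_simps)
  also have "(\<lambda>j. log_defect b j - log_defect b (j - 1)) = (\<lambda>j. (of_int (2 * j) * theta_coeff b j - of_int (2 * (j - 1)) * theta_coeff b (j - 1)) + 2 * theta_coeff b (j - 1))"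
    by (rule ext) (simp add: log_defect_diff[OF b] algebra_simps)
  also have "texp (\<lambda>j. 2 * j) \<dots> = (fps_deriv (theta1 b) - exp_pow 2 * fps_deriv (theta1 b)) + fps_const 2 * (exp_pow 2 * theta1 b)"
    unfolding texp_add[OF fsummable_diff[OF sj sinh2[OF sj]] fsummable_mult_left[OF sinh2[OF st]]] texp_diff[OF sj sinh2[OF sj]]
      texp_cmult[OF sinh2[OF st]] shift[OF sj, symmetric] shift[OF st, symmetric] dT[unfolded theta1_def] theta1_def by (rule refl)
  finally show ?thesis by (simp add: algebra_simps fps_numeral_fps_const)
qed

section \<open>Heat equations\<close>

lemma fps_XD_alt: "fps_XD (alt i * fps_X ^ m :: rat fps) = alt i * (of_nat m * fps_X ^ m)"
  by (simp add: alt_def fps_XD_X_power)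

lemma heat_theta4: "4 * qderiv theta4 = fps_deriv (fps_deriv theta4)"
proof -
  have T: "theta4 = texp (\<lambda>i. 2 * i) theta4_coeff" by (simp add: theta4_def theta4_coeff_def[abs_def])
  have *: "of_int (2 * i) * (of_int (2 * i) * theta4_coeff i) = 4 * fps_XD (theta4_coeff i)" for i
    unfolding theta4_coeff_def fps_XD_alt by (simp add: power2_eq_square)
  have "4 * qderiv theta4 = texp (\<lambda>i. 2 * i) (\<lambda>i. 4 * fps_XD (theta4_coeff i))"
    unfolding T qderiv_texp[OF fsummable_theta4_coeff'] texp_cmult[OF fsummable_XD[OF fsummable_theta4_coeff']]
    by (simp add: fps_numeral_fps_const)
  also have "\<dots> = fps_deriv (fps_deriv theta4)"
    unfolding *[symmetric] T texp_deriv[OF fsummable_theta4_coeff'] texp_deriv[OF fsummable_mult_left[OF fsummable_theta4_coeff']] ..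
  finally show ?thesis .
qed

text \<open>Eight times the exponent is \<open>8 b i (i-1) / 2 = b ((2 i)^2 - 2 (2 i))\<close>, and
  \<open>2 i\<close> is the eigenvalue of \<open>d/dt\<close>.\<close>

lemma heat_theta1:
  assumes b: "0 < b"
  shows "8 * qderiv (theta1 b) = of_nat b * (fps_deriv (fps_deriv (theta1 b)) - 2 * fps_deriv (theta1 b))"
proof -
  note st = fsummable_theta_coeff[OF b, where 'a = rat]
  have *: "8 * fps_XD (theta_coeff b i :: rat fps) = of_nat b * (of_int (2 * i) * (of_int (2 * i) * theta_coeff b i) - 2 * (of_int (2 * i) * theta_coeff b i))" for i :: int
  proof -
    have "8 * of_nat (b * tri i) = (of_nat b * (4 * of_int (2 * int (tri i))) :: rat fps)" by simp
    also have "\<dots> = of_nat b * (of_int (2 * i) * of_int (2 * i) - 2 * of_int (2 * i))"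
      unfolding tri_int by (simp add: algebra_simps)
    finally have I: "8 * of_nat (b * tri i) = (of_nat b * (of_int (2 * i) * of_int (2 * i) - 2 * of_int (2 * i)) :: rat fps)" .
    have "8 * fps_XD (theta_coeff b i :: rat fps) = (8 * of_nat (b * tri i)) * theta_coeff b i"
      unfolding theta_coeff_def fps_XD_alt by (simp only: mult_ac)
    then show ?thesis unfolding I by (simp only: algebra_simps)
  qed
  have "8 * qderiv (theta1 b) = texp (\<lambda>i. 2 * i) (\<lambda>i. 8 * fps_XD (theta_coeff b i))"
    by (simp add: theta1_def qderiv_texp[OF st] texp_cmult[OF fsummable_XD[OF st]] fps_numeral_fps_const)
  also have "\<dots> = fps_const (of_nat b) * (texp (\<lambda>i. 2 * i) (\<lambda>i. of_int (2 * i) * (of_int (2 * i) * theta_coeff b i))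
      - fps_const 2 * texp (\<lambda>i. 2 * i) (\<lambda>i. of_int (2 * i) * theta_coeff b i))"
    unfolding *
    unfolding texp_cmult[OF fsummable_diff[OF fsummable_mult_left[OF fsummable_mult_left[OF st]]
          fsummable_mult_left[OF fsummable_mult_left[OF st]]]]
      texp_diff[OF fsummable_mult_left[OF fsummable_mult_left[OF st]] fsummable_mult_left[OF fsummable_mult_left[OF st]]]
      texp_cmult[OF fsummable_mult_left[OF st]] ..
  also have "\<dots> = of_nat b * (fps_deriv (fps_deriv (theta1 b)) - 2 * fps_deriv (theta1 b))"
    unfolding theta1_def texp_deriv[OF st] texp_deriv[OF fsummable_mult_left[OF st]]
    by (simp only: fps_of_nat fps_numeral_fps_const[symmetric])
  finally show ?thesis .
qed

section \<open>Comparison of Taylor coefficients\<close>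

text \<open>Here \<open>sinh2 = 2 sinh t\<close> and, next, \<open>cosh2 = 2 cosh t\<close>.\<close>

definition sinh2 :: "rat fps fps" where "sinh2 = exp_pow 1 - exp_pow (- 1)"
definition cosh2 :: "rat fps fps" where "cosh2 = exp_pow 1 + exp_pow (- 1)"

lemma sinh2_deriv: "fps_deriv sinh2 = cosh2" "fps_deriv cosh2 = sinh2"
  by (simp_all add: sinh2_def cosh2_def exp_pow_deriv)

lemma cosh2_sq: "cosh2 * cosh2 = sinh2 * sinh2 + 4"
  by (simp add: sinh2_def cosh2_def algebra_simps exp_pow_add)

lemma qderiv_exp_pow: "qderiv (exp_pow k) = 0"
  by (rule fps_ext) (simp add: exp_pow_nth ecoeff_def)

lemma qderiv_linear: "qderiv (F + G) = qderiv F + qderiv G" "qderiv (F - G) = qderiv F - qderiv G"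
  by (rule fps_ext, simp)+

lemma qderiv_sinh2: "qderiv sinh2 = 0" "qderiv cosh2 = 0"
  by (simp_all add: sinh2_def cosh2_def qderiv_linear qderiv_exp_pow)

lemma sinh2_nonzero: "sinh2 \<noteq> 0"
proof
  assume "sinh2 = 0"
  then have "sinh2 $ 1 $ 0 = 0" by simp
  then show False by (simp add: sinh2_def exp_pow_nth ecoeff_def)
qed

text \<open>The factor \<open>w^(-1)\<close> removes the first-order term from the heat equation and
  turns the logarithmic derivative into \<open>coth t + log_theta1 b\<close>.\<close>

definition theta1_sym :: "nat \<Rightarrow> rat fps fps" where "theta1_sym b = exp_pow (- 1) * theta1 b"

lemma theta1_theta1_sym: "theta1 b = exp_pow 1 * theta1_sym b"
  by (simp add: theta1_sym_def mult.assoc[symmetric] exp_pow_add)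

lemma one_minus_EE2: "1 - exp_pow 2 = - exp_pow 1 * sinh2"
  by (simp add: sinh2_def algebra_simps exp_pow_add)

lemma theta1_sym_log_deriv:
  assumes "0 < b"
  shows "sinh2 * fps_deriv (theta1_sym b) = theta1_sym b * (cosh2 + sinh2 * log_theta1 b)"
proof -
  have d: "fps_deriv (theta1 b) = exp_pow 1 * (fps_deriv (theta1_sym b) + theta1_sym b)"
    by (simp add: theta1_theta1_sym exp_pow_deriv algebra_simps)
  have "exp_pow 2 = exp_pow 1 * exp_pow 1" by (simp add: exp_pow_add)
  then have "exp_pow 1 * exp_pow 1 * (- sinh2 * (log_theta1 b * theta1_sym b)) = exp_pow 1 * exp_pow 1 * (- sinh2 * (fps_deriv (theta1_sym b) + theta1_sym b) + 2 * exp_pow 1 * theta1_sym b)"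
    using theta_coeff_log_deriv[OF assms] unfolding one_minus_EE2 d by (simp add: theta1_theta1_sym algebra_simps)
  moreover have "exp_pow 1 * exp_pow 1 \<noteq> 0"
    using exp_pow_add[of 1 1] exp_pow_add[of 2 "- 2"] by auto
  ultimately have "- sinh2 * (log_theta1 b * theta1_sym b) = - sinh2 * (fps_deriv (theta1_sym b) + theta1_sym b) + 2 * exp_pow 1 * theta1_sym b"
    by (simp only: mult_cancel_left) simp
  moreover have "2 * exp_pow 1 = sinh2 + cosh2" by (simp add: sinh2_def cosh2_def)
  ultimately show ?thesis by algebra
qed

lemma theta1_sym_nonzero:
  assumes "0 < b"
  shows "theta1_sym b \<noteq> 0"
proof
  assume "theta1_sym b = 0"
  then have "theta1 b $ 1 $ 0 = 0" by (simp add: theta1_theta1_sym)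
  moreover have "theta1 b $ 1 $ 0 = (\<Sum>i\<in>{0, 1}. (theta_coeff b i * ecoeff (2 * i) 1) $ 0)"
    unfolding theta1_def texp_nth
  proof (rule fsum_nth)
    fix i assume "(theta_coeff b i * ecoeff (2 * i) 1) $ 0 \<noteq> 0"
    then have "b * tri i = 0" by (auto simp: theta_coeff_def split: if_splits)
    then have "tri i = 0" using assms by simp
    then have "i * (i - 1) = 0" using tri_int[of i] by simp
    then show "i \<in> {0, 1}" by simp
  qed simp
  ultimately show False by (simp add: theta_coeff_def ecoeff_def alt_def tri_def)
qed

lemma theta4_nonzero: "theta4 \<noteq> 0"
proof
  assume "theta4 = 0"
  then have "theta4 $ 0 $ 0 = 0" by simp
  moreover have "theta4 $ 0 $ 0 = (\<Sum>i\<in>{0}. (theta4_coeff i * ecoeff (2 * i) 0) $ 0)"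
    unfolding theta4_def texp_nth theta4_coeff_def[symmetric]
  proof (rule fsum_nth)
    fix i assume "(theta4_coeff i * ecoeff (2 * i) 0) $ 0 \<noteq> 0"
    then have "nat (i ^ 2) = 0" by (auto simp: theta4_coeff_def split: if_splits)
    then show "i \<in> {0}" by simp
  qed simp
  ultimately show False by (simp add: theta4_coeff_def ecoeff_def alt_def)
qed

text \<open>Cole-Hopf: the logarithmic derivative of a solution of the heat equation solves Burgers'
  equation.\<close>

lemma burgers_log_theta4: "4 * qderiv log_theta4 = fps_deriv (fps_deriv log_theta4) + 2 * log_theta4 * fps_deriv log_theta4"
proof -
  have h: "4 * qderiv theta4 = (fps_deriv log_theta4 + log_theta4 * log_theta4) * theta4"
    unfolding heat_theta4 theta4_coeff_log_deriv by (simp add: theta4_coeff_log_deriv algebra_simps)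
  have "4 * qderiv (log_theta4 * theta4) = fps_deriv ((fps_deriv log_theta4 + log_theta4 * log_theta4) * theta4)"
    unfolding h[symmetric] theta4_coeff_log_deriv[symmetric] by (simp add: qderiv_deriv)
  then have "4 * qderiv log_theta4 * theta4 + log_theta4 * (4 * qderiv theta4) = fps_deriv ((fps_deriv log_theta4 + log_theta4 * log_theta4) * theta4)"
    by (simp add: qderiv_mult algebra_simps)
  then have "(4 * qderiv log_theta4) * theta4 = (fps_deriv (fps_deriv log_theta4) + 2 * log_theta4 * fps_deriv log_theta4) * theta4"
    unfolding h by (simp add: theta4_coeff_log_deriv algebra_simps)
  then show ?thesis using theta4_nonzero by simp
qed

text \<open>Burgers' equation for \<open>coth t + R\<close>, times \<open>sinh2^2\<close>. Since
  \<open>coth\<close> is itself a stationary solution, only cross terms remain;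
  \<open>coth' = - 4 / sinh2^2\<close> produces \<open>- 8 R\<close>.\<close>

lemma burgers_log_theta1:
  assumes b: "0 < b"
  defines "R \<equiv> log_theta1 b"
  shows "8 * sinh2 * sinh2 * qderiv R = of_nat b * (sinh2 * sinh2 * (fps_deriv (fps_deriv R) + 2 * R * fps_deriv R)
     + 2 * sinh2 * cosh2 * fps_deriv R - 8 * R)"
proof -
  define A where "A = theta1_sym b"
  note h1 = theta1_sym_log_deriv[OF b, folded A_def R_def]
  define A1 A2 R1 R2 where "A1 = fps_deriv A" and "A2 = fps_deriv A1" and "R1 = fps_deriv R" and "R2 = fps_deriv R1"
  have h2: "8 * qderiv A = of_nat b * (A2 - A)"
  proof -
    have "exp_pow 1 * (8 * qderiv A) = exp_pow 1 * (of_nat b * (A2 - A))"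
      using heat_theta1[OF b] unfolding theta1_theta1_sym
      by (simp add: qderiv_mult qderiv_exp_pow exp_pow_deriv A_def A1_def A2_def algebra_simps)
    moreover have "exp_pow 1 \<noteq> 0" using exp_pow_add[of 1 "- 1"] by auto
    ultimately show ?thesis by simp
  qed
  have h1': "sinh2 * A1 = A * (cosh2 + sinh2 * R)" using h1 by (simp add: A1_def)
  have d1: "cosh2 * A1 + sinh2 * A2 = A1 * (cosh2 + sinh2 * R) + A * (sinh2 + cosh2 * R + sinh2 * R1)"
    using arg_cong[OF h1', of fps_deriv] by (simp add: sinh2_deriv A1_def A2_def R1_def algebra_simps)
  \<comment> \<open>Chosen so that \<open>sinh2 (A'' - A) = A Z\<close>.\<close>
  define Z where "Z = 2 * cosh2 * R + sinh2 * (R * R + R1)"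
  have "sinh2 * (sinh2 * A2 - sinh2 * A) = (sinh2 * A1) * sinh2 * R + sinh2 * A * (cosh2 * R + sinh2 * R1)"
    using d1 by algebra
  also have "\<dots> = sinh2 * (A * Z)" unfolding h1' Z_def by algebra
  finally have "sinh2 * A2 - sinh2 * A = A * Z" using sinh2_nonzero by simp
  then have h3: "8 * sinh2 * qderiv A = of_nat b * (A * Z)"
    using h2 by algebra
  have q: "sinh2 * qderiv A1 = qderiv A * (cosh2 + sinh2 * R) + A * sinh2 * qderiv R"
    using arg_cong[OF h1', of qderiv] by (simp add: qderiv_mult qderiv_sinh2 qderiv_linear algebra_simps)
  have q2: "fps_deriv (qderiv A) = qderiv A1" by (simp add: A1_def qderiv_deriv)
  have "8 * cosh2 * qderiv A + 8 * sinh2 * qderiv A1 = of_nat b * (A1 * Z + A * fps_deriv Z)"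
    using arg_cong[OF h3, of fps_deriv] by (simp add: sinh2_deriv q2 A1_def algebra_simps)
  then have "A * (8 * sinh2 * sinh2 * qderiv R) = A * (of_nat b * (sinh2 * fps_deriv Z - cosh2 * Z))"
    using q h3 h1' by algebra
  then have "8 * sinh2 * sinh2 * qderiv R = of_nat b * (sinh2 * fps_deriv Z - cosh2 * Z)"
    using theta1_sym_nonzero[OF b] by (simp add: A_def)
  moreover have "sinh2 * fps_deriv Z - cosh2 * Z = sinh2 * sinh2 * (R2 + 2 * R * R1) + 2 * sinh2 * cosh2 * R1 - 8 * R"
  proof -
    have "fps_deriv Z = 2 * sinh2 * R + 2 * cosh2 * R1 + cosh2 * (R * R + R1) + sinh2 * (2 * R * R1 + R2)"
      by (simp add: Z_def sinh2_deriv R1_def R2_def algebra_simps)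
    then show ?thesis unfolding Z_def using cosh2_sq by algebra
  qed
  ultimately show ?thesis by (simp add: R1_def R2_def)
qed

text \<open>Up to a factor free of \<open>t\<close>, \<open>B\<close> is
  \<open>sinh2^3 theta4 / theta1_sym^3\<close>. Logarithmic differentiation removes the unknown
  \<open>theta3_appell c 3\<close>, and the three \<open>coth t\<close> from the denominator cancel
  those from \<open>sinh2^3\<close>.\<close>

lemma kernel_log_deriv:
  assumes bd: "fsum (\<lambda>n. quad_wt c (4 * n + 1) * fps_X ^ nat (2 * n ^ 2 + n)) = 0"
  defines "B \<equiv> fps_const (1 - c) * (exp_pow 2 + exp_pow (- 2)) + fps_const (6 + 2 * c) - sinh2 ^ 3 * texp id (appell c)"
  shows "fps_deriv B = (log_theta4 - 3 * log_theta1 2) * B"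
proof -
  define A where "A = theta1_sym 2"
  note h1 = theta1_sym_log_deriv[of 2, folded A_def, simplified]
  have E: "exp_pow 3 = exp_pow 1 ^ 3" "exp_pow 1 + exp_pow 5 = exp_pow 3 * (exp_pow 2 + exp_pow (- 2))"
    by (simp_all add: power3_eq_cube algebra_simps exp_pow_add)
  have "exp_pow 1 ^ 3 * exp_pow 1 ^ 3 * (- (sinh2 ^ 3) * (fps_const (theta3_appell c 3) * theta4)) = exp_pow 1 ^ 3 * exp_pow 1 ^ 3 * (A ^ 3 * B)"
    using appell_theta_identity[OF bd]
    unfolding one_minus_EE2  theta1_theta1_sym A_def[symmetric] E B_def
    by (simp add: power_mult_distrib algebra_simps)
  moreover have "exp_pow 1 \<noteq> 0" using exp_pow_add[of 1 "- 1"] by auto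
  then have "exp_pow 1 ^ 3 * exp_pow 1 ^ 3 \<noteq> 0" by simp
  ultimately have main: "- (sinh2 ^ 3) * (fps_const (theta3_appell c 3) * theta4) = A ^ 3 * B"
    by (rule mult_left_cancel[THEN iffD1, rotated])
  define C where "C = fps_const (theta3_appell c 3) * theta4"
  have C: "fps_deriv C = log_theta4 * C" by (simp add: C_def theta4_coeff_log_deriv mult.left_commute)
  define A1 B1 where "A1 = fps_deriv A" and "B1 = fps_deriv B"
  have main': "- (sinh2 * sinh2 * sinh2 * C) = A * A * A * B" using main by (simp add: C_def power3_eq_cube)
  have "- (3 * sinh2 * sinh2 * cosh2 * C + sinh2 * sinh2 * sinh2 * (log_theta4 * C)) = 3 * A * A * A1 * B + A * A * A * B1"
    using arg_cong[OF main', of fps_deriv] by (simp add: sinh2_deriv C A1_def B1_def algebra_simps)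
  then have "A * A * A * (sinh2 * B1) = A * A * A * (sinh2 * ((log_theta4 - 3 * log_theta1 2) * B))"
    using main' h1[folded A1_def] by algebra
  moreover have "A \<noteq> 0" using theta1_sym_nonzero[of 2] by (simp add: A_def)
  ultimately show ?thesis using sinh2_nonzero by (simp add: B1_def)
qed

section \<open>Taylor coefficients in \<open>t\<close>\<close>

lemma fsum_half_sym:
  fixes f :: "int \<Rightarrow> rat fps"
  assumes "fsummable f" "\<And>x. f (- x) = f x" "f 0 = 0"
  shows "fsum f = 2 * fsum (\<lambda>k. f (int k + 1))"
  using fsum_int_split[OF assms(1)] unfolding assms(2,3) by simp

lemma ecoeff_odd: "odd m \<Longrightarrow> ecoeff (- k) m = - ecoeff k m"
  by (simp add: ecoeff_def)

lemma ecoeff_even: "even m \<Longrightarrow> ecoeff (- k) m = ecoeff k m"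
  by (simp add: ecoeff_def)

lemma ecoeff_eq: "ecoeff (int k) m = fps_const (1 / fact m) * of_nat (k ^ m)"
  by (simp add: ecoeff_def flip: fps_of_nat)

lemma lseries_nth:
  assumes e: "fsummable (\<lambda>(k, l). fps_X ^ e k l :: rat fps)"
  shows "even m \<Longrightarrow> lseries e $ m = 0"
    "odd m \<Longrightarrow> lseries e $ m = fps_const (- 4 * 2 ^ m / fact m) * fsum (\<lambda>(k, l). of_nat (Suc k ^ m) * fps_X ^ e k l)"
proof -
  have s: "fsummable (\<lambda>p. c p * (case p of (k, l) \<Rightarrow> fps_X ^ e k l) :: rat fps)" for c
    by (rule fsummable_mult_left[OF e])
  have m: "2 * - (int k + 1) = - (2 * (int k + 1))" for k by simp
  have *: "lseries e $ m = fsum (\<lambda>p. - 2 * ecoeff (2 * (int (fst p) + 1)) m * (case p of (k, l) \<Rightarrow> fps_X ^ e k l))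
     - fsum (\<lambda>p. - 2 * ecoeff (- (2 * (int (fst p) + 1))) m * (case p of (k, l) \<Rightarrow> fps_X ^ e k l))"
    by (simp add: lseries_def texp_nth m case_prod_unfold mult_ac)
  show "lseries e $ m = 0" if "even m" unfolding * ecoeff_even[OF that] by simp
  assume "odd m"
  then have "lseries e $ m = fsum (\<lambda>p. - 4 * ecoeff (2 * (int (fst p) + 1)) m * (case p of (k, l) \<Rightarrow> fps_X ^ e k l))"
    unfolding * ecoeff_odd[OF \<open>odd m\<close>] by (subst fsum_diff[OF s s, symmetric]) (simp add: algebra_simps)
  also have "(\<lambda>p. - 4 * ecoeff (2 * (int (fst p) + 1)) m * (case p of (k, l) \<Rightarrow> fps_X ^ e k l)) =
     (\<lambda>p. fps_const (- 4 * 2 ^ m / fact m) * ((case p of (k, l) \<Rightarrow> of_nat (Suc k ^ m) * fps_X ^ e k l)))"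
  proof (rule ext)
    fix p :: "nat \<times> nat"
    obtain k l where p: "p = (k, l)" by (cases p)
    have "of_int (2 * (int k + 1)) ^ m = (2 ^ m * of_nat (Suc k ^ m) :: rat)"
      by (simp add: power_mult_distrib[symmetric] algebra_simps)
    then have "- 4 * (of_int (2 * (int k + 1)) ^ m / fact m) = (- 4 * 2 ^ m / fact m * of_nat (Suc k ^ m) :: rat)"
      by simp
    then have "- 4 * ecoeff (2 * (int k + 1)) m = fps_const (- 4 * 2 ^ m / fact m) * of_nat (Suc k ^ m)"
      unfolding ecoeff_def fps_of_nat[symmetric] neg_numeral_fps_const fps_const_mult by (rule arg_cong)
    then show "- 4 * ecoeff (2 * (int (fst p) + 1)) m * (case p of (k, l) \<Rightarrow> fps_X ^ e k l) =
      fps_const (- 4 * 2 ^ m / fact m) * (case p of (k, l) \<Rightarrow> of_nat (Suc k ^ m) * fps_X ^ e k l)"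
      by (simp add: p mult.assoc)
  qed
  also have "fsum \<dots> = fps_const (- 4 * 2 ^ m / fact m) * fsum (\<lambda>(k, l). of_nat (Suc k ^ m) * fps_X ^ e k l)"
    by (rule fsum_cmult) (use s[of "\<lambda>p. of_nat (Suc (fst p) ^ m)"] in \<open>simp add: case_prod_unfold\<close>)
  finally show "lseries e $ m = fps_const (- 4 * 2 ^ m / fact m) * fsum (\<lambda>(k, l). of_nat (Suc k ^ m) * fps_X ^ e k l)" .
qed

lemma log_theta1_nth:
  assumes "0 < b"
  shows "even m \<Longrightarrow> log_theta1 b $ m = 0" "odd m \<Longrightarrow> log_theta1 b $ m = fps_const (- 4 * 2 ^ m / fact m) * eis b m"
  using lseries_nth[of "\<lambda>k l. b * (Suc k * Suc l)" m] fsummable_kl2[OF assms, of "\<lambda>_ _. 1"]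
  by (simp_all add: log_theta1_def eis_def)

text \<open>Odd cofactors are all cofactors minus the even ones; as the cofactor is
  \<open>l + 1\<close>, even \<open>l\<close> means an odd cofactor.\<close>

lemma eis_diff: "fsum (\<lambda>(k, l). of_nat (Suc k ^ m) * fps_X ^ (Suc k * (2 * l + 1))) = (eis 1 m - eis 2 m :: rat fps)"
proof -
  define f where "f = (\<lambda>(k, l). of_nat (Suc k ^ m) * fps_X ^ (1 * (Suc k * Suc l)) :: rat fps)"
  define a where "a = (\<lambda>p. if even (snd p) then f p else 0)"
  define b where "b = (\<lambda>p. if odd (snd p) then f p else 0)"
  have sf: "fsummable f"
    using fsummable_eis[of 1 "\<lambda>k l. of_nat (Suc k ^ m)"] by (simp add: f_def)
  have s: "fsummable a" "fsummable b"
    unfolding a_def b_def by (rule fsummable_if[OF sf])+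
  have "eis 1 m = fsum f" by (simp add: eis_def f_def)
  also have "\<dots> = fsum (\<lambda>p. a p + b p)" by (rule arg_cong[of _ _ fsum]) (auto simp: a_def b_def)
  also have "\<dots> = fsum a + fsum b" by (rule fsum_add[OF s])
  also have "fsum b = eis 2 m"
    unfolding eis_def
    by (rule fsum_reindex[where h = "\<lambda>(k, l). (k, l div 2)" and A = "{p. odd (snd p)}" and B = UNIV])
       (auto simp: b_def f_def elim!: oddE intro!: bij_betwI[where g = "\<lambda>(k, l). (k, 2 * l + 1)"])
  also have "fsum a = fsum (\<lambda>(k, l). of_nat (Suc k ^ m) * fps_X ^ (Suc k * (2 * l + 1)))"
    by (rule fsum_reindex[where h = "\<lambda>(k, l). (k, l div 2)" and A = "{p. even (snd p)}" and B = UNIV])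
       (auto simp: a_def f_def elim!: evenE intro!: bij_betwI[where g = "\<lambda>(k, l). (k, 2 * l)"])
  finally show ?thesis by simp
qed

lemma log_theta4_nth:
  "even m \<Longrightarrow> log_theta4 $ m = 0" "odd m \<Longrightarrow> log_theta4 $ m = fps_const (- 4 * 2 ^ m / fact m) * (eis 1 m - eis 2 m)"
  using lseries_nth[of "\<lambda>k l. Suc k * (2 * l + 1)" m] fsummable_kl1[of "\<lambda>_ _. 1"]
  unfolding log_theta4_def eis_diff by simp_all

lemma appell_reflect: "appell c (- x) = - appell c x"
proof -
  have "appell c (- x) = fsum (\<lambda>n. orthant (0 - n) (- x) * quad_wt c (4 * (0 - n) + - x) * fps_X ^ nat (2 * (0 - n) ^ 2 + (0 - n) * - x))"
    unfolding appell_def by (rule fsum_bij[OF bij_int_diff(1), symmetric])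
  also have "\<dots> = fsum (\<lambda>n. - (orthant n x * quad_wt c (4 * n + x) * fps_X ^ nat (2 * n ^ 2 + n * x)))"
  proof (rule arg_cong[of _ _ fsum], rule ext)
    fix n
    have "orthant (0 - n) (- x) = - orthant n x" by (auto simp: orthant_def)
    moreover have "quad_wt c (4 * (0 - n) + - x) = quad_wt c (4 * n + x)"
      by (simp add: quad_wt_def power2_eq_square algebra_simps)
    ultimately show "orthant (0 - n) (- x) * quad_wt c (4 * (0 - n) + - x) * fps_X ^ nat (2 * (0 - n) ^ 2 + (0 - n) * - x)
      = - (orthant n x * quad_wt c (4 * n + x) * fps_X ^ nat (2 * n ^ 2 + n * x))" by simp
  qed
  finally show ?thesis by (simp add: fsum_uminus appell_def)
qed

lemma appell_pos: "appell c (2 * int j + 1) = fsum (\<lambda>n. quad_wt c (4 * (int n + 1) + (2 * int j + 1)) * fps_X ^ (Suc n * (2 * Suc n + 2 * j + 1)))"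
  unfolding appell_def
proof (rule fsum_reindex[where h = "\<lambda>n. nat (n - 1)" and A = "{0<..}" and B = UNIV])
  show "bij_betw (\<lambda>n. nat (n - 1)) {0<..} UNIV"
    by (rule bij_betwI[where g = "\<lambda>n. int n + 1"]) auto
  fix n :: int
  show "orthant n (2 * int j + 1) * quad_wt c (4 * n + (2 * int j + 1)) * fps_X ^ nat (2 * n ^ 2 + n * (2 * int j + 1)) = 0"
    if "n \<notin> {0<..}" using that by (simp add: orthant_def)
  assume n: "n \<in> {0<..}"
  then obtain k where k: "n = int k + 1" by (metis add.commute greaterThan_iff zless_iff_Suc_zadd of_nat_Suc add_0 of_nat_add)
  have "nat (2 * n ^ 2 + n * (2 * int j + 1)) = Suc k * (2 * Suc k + 2 * j + 1)"
    by (simp add: k nat_eq_iff power2_eq_square algebra_simps)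
  then show "orthant n (2 * int j + 1) * quad_wt c (4 * n + (2 * int j + 1)) * fps_X ^ nat (2 * n ^ 2 + n * (2 * int j + 1)) =
    quad_wt c (4 * (int (nat (n - 1)) + 1) + (2 * int j + 1)) * fps_X ^ (Suc (nat (n - 1)) * (2 * Suc (nat (n - 1)) + 2 * j + 1))"
    by (simp add: orthant_def k)
qed simp

text \<open>The weight \<open>(4 n + x)^2\<close> is eight times the exponent plus
  \<open>x^2\<close>: the first part becomes \<open>8 * fps_XD\<close>, the second raises the moment
  by two. The factor 2 joins \<open>x\<close> and \<open>-x\<close>.\<close>

lemma appell_nth:
  "even m \<Longrightarrow> texp id (appell c) $ m = 0"
  "odd m \<Longrightarrow> texp id (appell c) $ m = fps_const (2 / fact m) * (8 * fps_XD (lam m) + lam (m + 2) - c * lam m)"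
proof -
  let ?f = "\<lambda>x. appell c x * ecoeff x m"
  have s: "fsummable ?f" by (rule fsummable_mult_right[OF fsummable_appell])
  show "texp id (appell c) $ m = 0" if "even m"
  proof -
    have "fsum ?f = fsum (\<lambda>x. ?f (0 - x))" by (rule fsum_bij[OF bij_int_diff(1), symmetric])
    also have "\<dots> = - fsum ?f" using that by (simp add: appell_reflect ecoeff_even fsum_uminus)
    finally show ?thesis by (simp add: texp_nth eq_neg_iff_add_eq_0 flip: mult_2)
  qed
  assume m: "odd m"
  have y00: "appell c x = 0" if "even x" for x using that by (simp add: appell_def orthant_def fsum_def fps_eq_iff)
  have "texp id (appell c) $ m = 2 * fsum (\<lambda>k. ?f (int k + 1))"
    unfolding texp_nth id_def by (rule fsum_half_sym[OF s]) (simp_all add: appell_reflect ecoeff_odd m y00)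
  also have "fsum (\<lambda>k. ?f (int k + 1)) = fsum (\<lambda>j. ?f (2 * int j + 1))"
    by (rule fsum_reindex[where h = "\<lambda>k. k div 2" and A = "{k. even k}" and B = UNIV])
       (auto simp: y00 elim!: evenE intro!: bij_betwI[where g = "\<lambda>j. 2 * j"])
  also have "\<dots> = fsum (\<lambda>j. fsum (\<lambda>n. fps_const (1 / fact m) * (quad_wt c (4 * (int n + 1) + (2 * int j + 1)) * of_nat ((2 * j + 1) ^ m) * fps_X ^ (Suc n * (2 * Suc n + 2 * j + 1)))))"
  proof (rule arg_cong[of _ _ fsum], rule ext)
    fix j
    have sn: "fsummable (\<lambda>n. quad_wt c (4 * (int n + 1) + (2 * int j + 1)) * fps_X ^ (Suc n * (2 * Suc n + 2 * j + 1)))"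
      using fsummable_comp[OF fsummable_lam[of "\<lambda>n j. quad_wt c (4 * (int n + 1) + (2 * int j + 1))"], of "\<lambda>n. (n, j)"]
      by (simp add: inj_def)
    have e: "ecoeff (2 * int j + 1) m = fps_const (1 / fact m) * of_nat ((2 * j + 1) ^ m)"
    proof -
      have *: "2 * int j + 1 = int (2 * j + 1)" by simp
      show ?thesis unfolding * by (rule ecoeff_eq)
    qed
    show "appell c (2 * int j + 1) * ecoeff (2 * int j + 1) m = fsum (\<lambda>n. fps_const (1 / fact m) * (quad_wt c (4 * (int n + 1) + (2 * int j + 1)) * of_nat ((2 * j + 1) ^ m) * fps_X ^ (Suc n * (2 * Suc n + 2 * j + 1))))"
      unfolding appell_pos fsum_cmult_right[OF sn, symmetric] e by (simp only: mult_ac)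
  qed
  also have "\<dots> = fsum (\<lambda>n. fsum (\<lambda>j. fps_const (1 / fact m) * (quad_wt c (4 * (int n + 1) + (2 * int j + 1)) * of_nat ((2 * j + 1) ^ m) * fps_X ^ (Suc n * (2 * Suc n + 2 * j + 1)))))"
    by (rule fsum_swap[symmetric])
       (use fsummable_mult_left[OF fsummable_lam[of "\<lambda>n j. quad_wt c (4 * (int n + 1) + (2 * int j + 1)) * of_nat ((2 * j + 1) ^ m)"], of "\<lambda>_. fps_const (1 / fact m)"]
         in \<open>simp add: case_prod_unfold\<close>)
  also have "\<dots> = fsum (\<lambda>(n, j). fps_const (1 / fact m) * (quad_wt c (4 * (int n + 1) + (2 * int j + 1)) * of_nat ((2 * j + 1) ^ m) * fps_X ^ (Suc n * (2 * Suc n + 2 * j + 1))))"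
    by (rule fsum_pair)
       (use fsummable_mult_left[OF fsummable_lam[of "\<lambda>n j. quad_wt c (4 * (int n + 1) + (2 * int j + 1)) * of_nat ((2 * j + 1) ^ m)"], of "\<lambda>_. fps_const (1 / fact m)"]
         in \<open>simp add: case_prod_unfold\<close>)
  also have "\<dots> = fps_const (1 / fact m) * fsum (\<lambda>(n, j). quad_wt c (4 * (int n + 1) + (2 * int j + 1)) * of_nat ((2 * j + 1) ^ m) * fps_X ^ (Suc n * (2 * Suc n + 2 * j + 1)))"
    using fsum_cmult[OF fsummable_lam[of "\<lambda>n j. quad_wt c (4 * (int n + 1) + (2 * int j + 1)) * of_nat ((2 * j + 1) ^ m)"], of "fps_const (1 / fact m)"]
    by (simp add: case_prod_unfold)
  also have "fsum (\<lambda>(n, j). quad_wt c (4 * (int n + 1) + (2 * int j + 1)) * of_nat ((2 * j + 1) ^ m) * fps_X ^ (Suc n * (2 * Suc n + 2 * j + 1)))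
     = 8 * fps_XD (lam m) + lam (m + 2) - c * lam m"
  proof -
    define t where "t = (\<lambda>k (n::nat, j). of_nat ((2 * j + 1) ^ k) * fps_X ^ (Suc n * (2 * Suc n + 2 * j + 1)) :: rat fps)"
    have st: "fsummable (t k)" for k
      using fsummable_lam[of "\<lambda>n j. of_nat ((2 * j + 1) ^ k)"] by (simp add: t_def)
    have L: "lam k = fsum (t k)" for k by (simp add: lam_def t_def)
    have "(case p of (n, j) \<Rightarrow> quad_wt c (4 * (int n + 1) + (2 * int j + 1)) * of_nat ((2 * j + 1) ^ m) * fps_X ^ (Suc n * (2 * Suc n + 2 * j + 1)))
      = (8 * fps_XD (t m p) + t (m + 2) p) - c * t m p" for p
    proof -
      obtain n j where p: "p = (n, j)" by (cases p)
      have w: "quad_wt c (4 * (int n + 1) + (2 * int j + 1)) = 8 * of_nat (Suc n * (2 * Suc n + 2 * j + 1)) + of_nat ((2 * j + 1) ^ 2) - c"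
      proof -
        have "(4 * (int n + 1) + (2 * int j + 1)) ^ 2 = int (8 * (Suc n * (2 * Suc n + 2 * j + 1)) + (2 * j + 1) ^ 2)"
          by (simp add: power2_eq_square algebra_simps)
        then have "of_int ((4 * (int n + 1) + (2 * int j + 1)) ^ 2) =
            (of_nat (8 * (Suc n * (2 * Suc n + 2 * j + 1)) + (2 * j + 1) ^ 2) :: rat fps)"
          by (simp only: of_int_of_nat_eq)
        moreover have "of_nat (8 * a + b) = (8 * of_nat a + of_nat b :: rat fps)" for a b by simp
        ultimately show ?thesis unfolding quad_wt_def by (simp only:)
      qed
      have X: "fps_XD (of_nat a * fps_X ^ e) = of_nat a * (of_nat e * fps_X ^ e :: rat fps)" for a e
        by (simp only: fps_XD_of_nat_mult fps_XD_X_power)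
      have ring: "(8 * u + v - c) * a * x = (8 * (a * (u * x)) + a * v * x) - c * (a * x)" for u v a x :: "rat fps"
        by (simp add: algebra_simps)
      have "(8 * of_nat e + of_nat (a ^ 2) - c) * of_nat (a ^ m) * fps_X ^ e =
        (8 * fps_XD (of_nat (a ^ m) * fps_X ^ e) + of_nat (a ^ (m + 2)) * fps_X ^ e) - c * (of_nat (a ^ m) * fps_X ^ e)" for a e
        by (simp only: X power_add of_nat_mult ring)
      then show ?thesis
        unfolding p w t_def prod.case .
    qed
    then have "fsum (\<lambda>p. case p of (n, j) \<Rightarrow> quad_wt c (4 * (int n + 1) + (2 * int j + 1)) * of_nat ((2 * j + 1) ^ m) * fps_X ^ (Suc n * (2 * Suc n + 2 * j + 1)))
      = fsum (\<lambda>p. (8 * fps_XD (t m p) + t (m + 2) p) - c * t m p)" by simp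
    also have "\<dots> = 8 * fps_XD (lam m) + lam (m + 2) - c * lam m"
      unfolding L fsum_diff[OF fsummable_add[OF fsummable_mult_left[OF fsummable_XD[OF st]] st] fsummable_mult_left[OF st]]
        fsum_add[OF fsummable_mult_left[OF fsummable_XD[OF st]] st] fsum_cmult[OF fsummable_XD[OF st]]
        fsum_cmult[OF st] fsum_XD[OF st] ..
    finally show ?thesis .
  qed
  finally show "texp id (appell c) $ m = fps_const (2 / fact m) * (8 * fps_XD (lam m) + lam (m + 2) - c * lam m)"
    by (simp add: fps_numeral_fps_const mult.assoc[symmetric] id_def)
qed

section \<open>Relations between Eisenstein series\<close>

lemma fps_mult_nth_numerals:
  fixes f g :: "'a::comm_ring_1 fps"
  shows "(f * g) $ 1 = f $ 0 * g $ 1 + f $ 1 * g $ 0"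
    "(f * g) $ 2 = f $ 0 * g $ 2 + f $ 1 * g $ 1 + f $ 2 * g $ 0"
    "(f * g) $ 3 = f $ 0 * g $ 3 + f $ 1 * g $ 2 + f $ 2 * g $ 1 + f $ 3 * g $ 0"
    "(f * g) $ 4 = f $ 0 * g $ 4 + f $ 1 * g $ 3 + f $ 2 * g $ 2 + f $ 3 * g $ 1 + f $ 4 * g $ 0"
    "(f * g) $ 5 = f $ 0 * g $ 5 + f $ 1 * g $ 4 + f $ 2 * g $ 3 + f $ 3 * g $ 2 + f $ 4 * g $ 1 + f $ 5 * g $ 0"
    "(f * g) $ 6 = f $ 0 * g $ 6 + f $ 1 * g $ 5 + f $ 2 * g $ 4 + f $ 3 * g $ 3 + f $ 4 * g $ 2 + f $ 5 * g $ 1 + f $ 6 * g $ 0"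
  by (simp_all add: fps_mult_nth eval_nat_numeral)

lemma fps_deriv_nth_numerals:
  fixes f :: "'a::comm_ring_1 fps"
  shows "fps_deriv f $ 0 = f $ 1" "fps_deriv f $ 1 = 2 * f $ 2" "fps_deriv f $ 2 = 3 * f $ 3" "fps_deriv f $ 3 = 4 * f $ 4"
    "fps_deriv f $ 4 = 5 * f $ 5" "fps_deriv f $ 5 = 6 * f $ 6"
  by (simp_all add: numeral_eq_Suc)

lemma log_theta4_values:
  "log_theta4 $ 0 = 0" "log_theta4 $ 1 = - 8 * (eis 1 1 - eis 2 1)" "log_theta4 $ 2 = 0" "3 * log_theta4 $ 3 = - 16 * (eis 1 3 - eis 2 3)"
  "log_theta4 $ 4 = 0" "15 * log_theta4 $ 5 = - 16 * (eis 1 5 - eis 2 5)"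
  by (simp_all add: log_theta4_nth fact_numeral fps_numeral_fps_const mult.assoc[symmetric])

lemma log_theta1_values:
  assumes "0 < b"
  shows "log_theta1 b $ 0 = 0" "log_theta1 b $ 1 = - 8 * eis b 1" "log_theta1 b $ 2 = 0" "3 * log_theta1 b $ 3 = - 16 * eis b 3"
  "log_theta1 b $ 4 = 0" "15 * log_theta1 b $ 5 = - 16 * eis b 5"
  by (simp_all add: log_theta1_nth[OF assms] fact_numeral fps_numeral_fps_const mult.assoc[symmetric])

lemma numeral_mult_nth: "(numeral k * f) $ n = numeral k * (f :: rat fps fps) $ n"
  by (simp add: fps_numeral_fps_const)

lemma of_nat_mult_nth: "(of_nat k * f) $ n = of_nat k * (f :: rat fps fps) $ n"
  by (simp flip: fps_of_nat)

lemma fps_XD_numeral_mult: "fps_XD (numeral k * f) = numeral k * fps_XD (f :: rat fps)"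
  "fps_XD (- numeral k * f) = - numeral k * fps_XD (f :: rat fps)"
  by (simp_all add: fps_XD_mult)

text \<open>The coefficient of \<open>t\<close> in Burgers' equation for
  \<open>log_theta4\<close>.\<close>

lemma eis_T_relation:
  "fps_XD (eis 1 1 - eis 2 1) = eis 1 3 - eis 2 3 - 4 * (eis 1 1 - eis 2 1 :: rat fps) ^ 2"
proof -
  have "(4 * qderiv log_theta4) $ 1 = (fps_deriv (fps_deriv log_theta4) + 2 * (log_theta4 * fps_deriv log_theta4)) $ 1"
    using arg_cong[OF burgers_log_theta4, of "\<lambda>f. f $ 1"] by (simp only: mult.assoc)
  then have "4 * fps_XD (log_theta4 $ 1) = 2 * (3 * log_theta4 $ 3) + 2 * (log_theta4 $ 1 * log_theta4 $ 1)"
    by (simp only: fps_add_nth fps_mult_nth_numerals[of log_theta4 "fps_deriv log_theta4"] fps_deriv_nth_numerals numeral_mult_nth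
        log_theta4_values(1,3) qderiv_nth mult_zero_left mult_zero_right add_0_left add_0_right)
  then have "4 * (- 8 * fps_XD (eis 1 1 - eis 2 1)) = 2 * (- 16 * (eis 1 3 - eis 2 3)) + 2 * (- 8 * (eis 1 1 - eis 2 1) * (- 8 * (eis 1 1 - eis 2 1 :: rat fps)))"
    by (simp only: log_theta4_values fps_XD_numeral_mult)
  then have "- 32 * fps_XD (eis 1 1 - eis 2 1) = - 32 * (eis 1 3 - eis 2 3 - 4 * (eis 1 1 - eis 2 1 :: rat fps) ^ 2)"
    by algebra
  then show ?thesis by (rule mult_left_cancel[THEN iffD1, rotated]) simp
qed

lemma sinh2_sq_values:
  "(sinh2 * sinh2) $ 0 = 0" "(sinh2 * sinh2) $ 1 = 0" "(sinh2 * sinh2) $ 2 = 4" "(sinh2 * sinh2) $ 3 = 0" "3 * (sinh2 * sinh2) $ 4 = 4" "(sinh2 * sinh2) $ 5 = 0"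
proof -
  have "sinh2 * sinh2 = exp_pow 2 + exp_pow (- 2) - 2" by (simp add: sinh2_def algebra_simps exp_pow_add)
  then show "(sinh2 * sinh2) $ 0 = 0" "(sinh2 * sinh2) $ 1 = 0" "(sinh2 * sinh2) $ 2 = 4" "(sinh2 * sinh2) $ 3 = 0" "3 * (sinh2 * sinh2) $ 4 = 4" "(sinh2 * sinh2) $ 5 = 0"
    by (simp_all add: exp_pow_nth ecoeff_def fact_numeral fps_numeral_fps_const del: One_nat_def)
qed

lemma sinh2_cosh2_values:
  "(sinh2 * cosh2) $ 0 = 0" "(sinh2 * cosh2) $ 1 = 4" "(sinh2 * cosh2) $ 2 = 0" "3 * (sinh2 * cosh2) $ 3 = 8" "(sinh2 * cosh2) $ 4 = 0" "15 * (sinh2 * cosh2) $ 5 = 8"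
proof -
  have "sinh2 * cosh2 = exp_pow 2 - exp_pow (- 2)" by (simp add: sinh2_def cosh2_def algebra_simps exp_pow_add)
  then show "(sinh2 * cosh2) $ 0 = 0" "(sinh2 * cosh2) $ 1 = 4" "(sinh2 * cosh2) $ 2 = 0" "3 * (sinh2 * cosh2) $ 3 = 8" "(sinh2 * cosh2) $ 4 = 0" "15 * (sinh2 * cosh2) $ 5 = 8"
    by (simp_all add: exp_pow_nth ecoeff_def fact_numeral fps_numeral_fps_const del: One_nat_def)
qed

text \<open>Ramanujan's formulas for the derivatives of \<open>E_2\<close> and \<open>E_4\<close> at
  \<open>q^b\<close>, read off from Burgers' equation at \<open>t^3\<close> and
  \<open>t^5\<close>.\<close>

lemma ramanujan:
  assumes b: "0 < b"
  shows "6 * fps_XD (eis b 1) = of_nat b * (eis b 1 - 12 * eis b 1 ^ 2 + 5 * eis b 3 :: rat fps)"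
    "30 * fps_XD (eis b 3) = of_nat b * (10 * eis b 3 - eis b 1 - 240 * eis b 1 * eis b 3 + 21 * eis b 5 :: rat fps)"
proof -
  define R where "R = log_theta1 b"
  define U V where "U = sinh2 * sinh2" and "V = sinh2 * cosh2"
  define r1 r3 r5 where "r1 = R $ 1" and "r3 = R $ 3" and "r5 = R $ 5"
  have E: "8 * (U * qderiv R) = of_nat b * (U * (fps_deriv (fps_deriv R) + 2 * (R * fps_deriv R)) + 2 * (V * fps_deriv R) - 8 * R)"
    using burgers_log_theta1[OF b] unfolding U_def V_def R_def by (simp only: mult.assoc)
  note vals = log_theta1_values[OF b, folded R_def] sinh2_sq_values[folded U_def] sinh2_cosh2_values[folded V_def]
  note simps = fps_add_nth fps_sub_nth fps_mult_nth_0
        fps_mult_nth_numerals[of U "qderiv R"] fps_mult_nth_numerals[of U "fps_deriv (fps_deriv R) + 2 * (R * fps_deriv R)"]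
        fps_mult_nth_numerals[of R "fps_deriv R"] fps_mult_nth_numerals[of V "fps_deriv R"] fps_deriv_nth_numerals numeral_mult_nth of_nat_mult_nth vals(1,3,5) qderiv_nth
        vals(7,8,9,10,12) vals(13,14,15,17) mult_zero_left mult_zero_right add_0_left add_0_right fps_XD_simps(4)
        r1_def[symmetric] r3_def[symmetric] r5_def[symmetric]
  have u4: "3 * U $ 4 = 4" and v3: "3 * V $ 3 = 8" and v5: "15 * V $ 5 = 8" using vals by blast+
  have r1: "r1 = - 8 * eis b 1" and r3: "3 * r3 = - 16 * eis b 3" and r5: "15 * r5 = - 16 * eis b 5"
    using vals unfolding r1_def r3_def r5_def by blast+
  have x1: "fps_XD r1 = - 8 * fps_XD (eis b 1)" unfolding r1 by (rule fps_XD_numeral_mult)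
  have x3: "3 * fps_XD r3 = - 16 * fps_XD (eis b 3)"
    using arg_cong[OF r3, of fps_XD] unfolding fps_XD_numeral_mult .
  have e3: "8 * (4 * fps_XD r1) = of_nat b * (4 * (2 * (3 * r3) + 2 * (r1 * r1)) + 2 * (4 * (3 * r3) + V $ 3 * r1) - 8 * r3)"
    using arg_cong[OF E, of "\<lambda>f. f $ 3"] by (simp only: simps)
  have e5: "8 * (4 * fps_XD r3 + U $ 4 * fps_XD r1) =
     of_nat b * (4 * (4 * (5 * r5) + 2 * (r1 * (3 * r3) + r3 * r1)) + U $ 4 * (2 * (3 * r3) + 2 * (r1 * r1))
       + 2 * (4 * (5 * r5) + V $ 3 * (3 * r3) + V $ 5 * r1) - 8 * r5)"
    using arg_cong[OF E, of "\<lambda>f. f $ 5"] by (simp only: simps)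
  have "- 128 * (6 * fps_XD (eis b 1 :: rat fps)) = - 128 * (of_nat b * (eis b 1 - 12 * eis b 1 ^ 2 + 5 * eis b 3))"
  proof -
    \<comment> \<open>The elimination is done for plain variables, so that the series stay
      opaque.\<close>
    have "- 768 * x = b * (- 640 * p3 + 1536 * p1 ^ 2 - 128 * p1)"
      if "8 * (4 * (- 8 * x)) = b * (4 * (2 * (3 * r) + 2 * (- 8 * p1 * (- 8 * p1))) + 2 * (4 * (3 * r) + v * (- 8 * p1)) - 8 * r)"
        "3 * v = 8" "3 * r = - 16 * p3" for x b r p1 p3 v :: "rat fps"
    proof -
      have "- 768 * x = 3 * (8 * (4 * (- 8 * x)))" by simp
      also have "\<dots> = b * (40 * (3 * r) + 1536 * p1 ^ 2 - 16 * p1 * (3 * v))"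
        unfolding that(1) by (simp add: algebra_simps power2_eq_square)
      finally show ?thesis unfolding that(2,3) by (simp add: algebra_simps)
    qed
    from this[OF e3[unfolded x1, unfolded r1] v3 r3] show ?thesis by (simp add: algebra_simps)
  qed
  then show 1: "6 * fps_XD (eis b 1) = of_nat b * (eis b 1 - 12 * eis b 1 ^ 2 + 5 * eis b 3 :: rat fps)"
    by (rule mult_left_cancel[THEN iffD1, rotated]) simp
  have "- 256 * (30 * fps_XD (eis b 3 :: rat fps)) = - 256 * (of_nat b * (10 * eis b 3 - eis b 1 - 240 * eis b 1 * eis b 3 + 21 * eis b 5))"
  proof -
    have "- 7680 * y = b * (- 2560 * p3 + 256 * p1 + 61440 * p1 * p3 - 5376 * p5)"
      if h: "8 * (4 * z + u * (- 8 * x)) = b * (4 * (4 * (5 * s) + 2 * (- 8 * p1 * (3 * r) + r * (- 8 * p1)))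
         + u * (2 * (3 * r) + 2 * (- 8 * p1 * (- 8 * p1))) + 2 * (4 * (5 * s) + v * (3 * r) + w * (- 8 * p1)) - 8 * s)"
        and v: "3 * v = 8" and w: "15 * w = 8" and u: "3 * u = 4" and r: "3 * r = - 16 * p3" and s: "15 * s = - 16 * p5"
        and z: "3 * z = - 16 * y" and x: "6 * x = b * (p1 - 12 * p1 ^ 2 + 5 * p3)"
      for x y z b r s p1 p3 p5 u v w :: "rat fps"
    proof -
      have "45 * (8 * (4 * z + u * (- 8 * x))) = 480 * (3 * z) - 160 * (3 * u) * (6 * x)"
        by (simp add: algebra_simps)
      also have "\<dots> = - 7680 * y - 640 * (6 * x)" unfolding z u by simp
      finally have L: "45 * (8 * (4 * z + u * (- 8 * x))) = - 7680 * y - 640 * (b * (p1 - 12 * p1 ^ 2 + 5 * p3))"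
        unfolding x .
      have "45 * (b * (4 * (4 * (5 * s) + 2 * (- 8 * p1 * (3 * r) + r * (- 8 * p1)))
         + u * (2 * (3 * r) + 2 * (- 8 * p1 * (- 8 * p1))) + 2 * (4 * (5 * s) + v * (3 * r) + w * (- 8 * p1)) - 8 * s))
        = b * (336 * (15 * s) - 3840 * p1 * (3 * r) + (3 * u) * (30 * (3 * r) + 1920 * p1 ^ 2) + 30 * (3 * v) * (3 * r) - 48 * p1 * (15 * w))"
        by (simp add: algebra_simps power2_eq_square)
      also have "\<dots> = b * (- 5376 * p5 + 61440 * p1 * p3 + 4 * (- 480 * p3 + 1920 * p1 ^ 2) - 3840 * p3 - 384 * p1)"
        unfolding s r u v w by (simp add: algebra_simps)
      finally have "- 7680 * y - 640 * (b * (p1 - 12 * p1 ^ 2 + 5 * p3))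
         = b * (- 5376 * p5 + 61440 * p1 * p3 + 4 * (- 480 * p3 + 1920 * p1 ^ 2) - 3840 * p3 - 384 * p1)"
        unfolding L[symmetric] h .
      then show ?thesis by (simp add: algebra_simps)
    qed
    from this[OF e5[unfolded x1, unfolded r1] v3 v5 u4 r3 r5 x3 1] show ?thesis by (simp add: algebra_simps)
  qed
  then show "30 * fps_XD (eis b 3) = of_nat b * (10 * eis b 3 - eis b 1 - 240 * eis b 1 * eis b 3 + 21 * eis b 5 :: rat fps)"
    by (rule mult_left_cancel[THEN iffD1, rotated]) simp
qed

text \<open>Eliminating both derivatives leaves the classical
  \<open>5 (2 E_2(q^2) - E_2(q))^2 = E_4(q) + 4 E_4(q^2)\<close>.\<close>

lemma eis_level_relation:
  "eis 1 3 + 4 * eis 2 3 = 12 * (eis 1 1 - 2 * eis 2 1) ^ 2 + (eis 1 1 - 2 * eis 2 1 :: rat fps)"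
proof -
  have "6 * (fps_XD (eis 1 1) - fps_XD (eis 2 1)) = 6 * (eis 1 3 - eis 2 3 - 4 * (eis 1 1 - eis 2 1 :: rat fps) ^ 2)"
    using eis_T_relation by simp
  then show ?thesis using ramanujan(1)[OF zero_less_one] ramanujan(1)[of 2, OF zero_less_numeral] by (simp only: of_nat_numeral of_nat_1) algebra
qed

text \<open>Because \<open>(4 n + 1)^2 = 8 (2 n^2 + n) + 1\<close>.\<close>

lemma psi_squares: "fsum (\<lambda>n::int. of_int ((4 * n + 1) ^ 2) * fps_X ^ nat (2 * n ^ 2 + n)) = (8 * fps_XD psi + psi :: rat fps)"
proof -
  have s: "fsummable (\<lambda>n::int. fps_X ^ nat (2 * n ^ 2 + n) :: rat fps)"
    using fsummable_psi[of "\<lambda>_. 1"] by simp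
  have "of_int ((4 * n + 1) ^ 2) * fps_X ^ nat (2 * n ^ 2 + n) =
      (8 * fps_XD (fps_X ^ nat (2 * n ^ 2 + n)) + fps_X ^ nat (2 * n ^ 2 + n) :: rat fps)" for n :: int
  proof -
    have "(4 * n + 1) ^ 2 = 8 * int (nat (2 * n ^ 2 + n)) + 1"
      using abs_le_quadratic[of n] by (simp add: power2_eq_square algebra_simps)
    from arg_cong[OF this, of "of_int :: int \<Rightarrow> rat fps"]
    have "of_int ((4 * n + 1) ^ 2) = (8 * of_nat (nat (2 * n ^ 2 + n)) + 1 :: rat fps)"
      by (simp only: of_int_add of_int_mult of_int_numeral of_int_of_nat_eq of_int_1)
    then show ?thesis unfolding fps_XD_X_power by (simp add: algebra_simps)
  qed
  then show ?thesis
    unfolding psi_def fsum_XD[OF s]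
    by (simp add: fsum_add fsum_cmult fsummable_mult_left fsummable_XD s)
qed

lemma psi_nth_0: "psi $ 0 = (1 :: rat)"
  using psi_nth[of 0 0] by simp

text \<open>The coefficients of \<open>t\<close>, \<open>t^3\<close> and \<open>t^5\<close> in
  \<open>fps_deriv B = N * B\<close>. The first evaluates \<open>c\<close>, hence the logarithmic
  derivative of \<open>psi\<close>; the others are the two moment equations.\<close>

lemma lam_identities:
  defines "x \<equiv> eis 1 1 :: rat fps" and "y \<equiv> eis 2 1 :: rat fps"
    and "x3 \<equiv> eis 1 3 - 4 * eis 2 3 :: rat fps" and "x5 \<equiv> eis 1 5 - 4 * eis 2 5 :: rat fps"
  defines "w \<equiv> x - 4 * y"
  shows "fps_XD psi = w * psi"
    "3 * (8 * fps_XD (lam 1) - (1 + 8 * w) * lam 1 + lam 3) = 2 * (x3 - w) - 12 * w ^ 2"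
    "15 * (8 * fps_XD (lam 3) - (1 + 8 * w) * lam 3 + lam 5)
       = 8 * (x5 - w) - 30 * (x3 - w) + 180 * w ^ 2 - 240 * w * x3 + 480 * w ^ 3"
proof -
  \<comment> \<open>The value forced by the boundary condition \<open>bd\<close>, which by
    \<open>psi_squares\<close> says \<open>(8 \<theta> + 1) psi = c psi\<close>.\<close>
  define c where "c = inverse psi * (8 * fps_XD psi + psi :: rat fps)"
  have inv: "inverse psi * psi = (1 :: rat fps)" by (rule inverse_mult_eq_1) (simp add: psi_nth_0)
  have cpsi: "c * psi = 8 * fps_XD psi + psi"
  proof -
    have "c * psi = (inverse psi * psi) * (8 * fps_XD psi + psi)" unfolding c_def by (simp only: mult_ac)
    then show ?thesis unfolding inv by simp
  qed
  have s: "fsummable (\<lambda>n::int. b n * fps_X ^ nat (2 * n ^ 2 + n) :: rat fps)" for b by (rule fsummable_psi)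
  have bd: "fsum (\<lambda>n. quad_wt c (4 * n + 1) * fps_X ^ nat (2 * n ^ 2 + n)) = 0"
    unfolding quad_wt_def left_diff_distrib fsum_diff[OF s s] psi_squares
    using fsum_cmult[OF s[of "\<lambda>_. 1"], of c] cpsi by (simp add: psi_def)
  define Y B N W3 where "Y = texp id (appell c)" and "B = fps_const (1 - c) * (exp_pow 2 + exp_pow (- 2)) + fps_const (6 + 2 * c) - sinh2 ^ 3 * Y"
    and "N = log_theta4 - 3 * log_theta1 2" and "W3 = sinh2 ^ 3"
  have D: "fps_deriv B = N * B"
    using kernel_log_deriv[OF bd] by (simp only: B_def N_def Y_def)
  \<comment> \<open>Since \<open>sinh2^3 = 8 t^3 + 4 t^5 + ...\<close> and \<open>Y\<close> starts
    at \<open>t\<close>, the moments enter \<open>B\<close> from \<open>t^4\<close> on, and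
    \<open>B $ 2\<close> involves \<open>c\<close> alone.\<close>
  have "sinh2 ^ 3 = exp_pow 3 - exp_pow (- 3) - 3 * (exp_pow 1 - exp_pow (- 1))"
    by (simp add: sinh2_def power3_eq_cube algebra_simps exp_pow_add)
  then have W: "W3 $ 0 = 0" "W3 $ 1 = 0" "W3 $ 2 = 0" "W3 $ 3 = 8" "W3 $ 4 = 0" "W3 $ 5 = 4" "W3 $ 6 = 0"
    by (simp_all add: W3_def exp_pow_nth ecoeff_def fact_numeral fps_numeral_fps_const numeral_mult_nth del: One_nat_def)
  define A1 A3 where "A1 = 8 * fps_XD (lam 1) + lam 3 - c * lam 1" and "A3 = 8 * fps_XD (lam 3) + lam 5 - c * lam 3"
  have Y: "Y $ 0 = 0" "Y $ 1 = 2 * A1" "Y $ 2 = 0" "3 * Y $ 3 = A3" "Y $ 4 = 0"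
  proof -
    show "Y $ 0 = 0" "Y $ 2 = 0" "Y $ 4 = 0" unfolding Y_def by (rule appell_nth(1); simp)+
    have "Y $ 1 = fps_const 2 * A1" using appell_nth(2)[of 1 c] by (simp add: Y_def A1_def numeral_3_eq_3)
    then show "Y $ 1 = 2 * A1" by (simp add: fps_numeral_fps_const)
    have "Y $ 3 = fps_const (1 / 3) * A3" using appell_nth(2)[of 3 c] by (simp add: Y_def A3_def fact_numeral)
    then show "3 * Y $ 3 = A3" by (simp add: fps_numeral_fps_const mult.assoc[symmetric])
  qed
  have N: "N $ 0 = 0" "N $ 1 = - 8 * w" "N $ 2 = 0" "3 * N $ 3 = - 16 * x3" "N $ 4 = 0" "15 * N $ 5 = - 16 * x5"
    unfolding N_def fps_sub_nth numeral_mult_nth right_diff_distrib using log_theta4_values log_theta1_values[of 2]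
    by (simp_all add: w_def x_def y_def x3_def x5_def algebra_simps mult.left_commute[of 3])
  have E2: "(exp_pow 2 + exp_pow (- 2)) $ 0 = 2" "(exp_pow 2 + exp_pow (- 2)) $ 2 = 4" "3 * (exp_pow 2 + exp_pow (- 2)) $ 4 = 4" "45 * (exp_pow 2 + exp_pow (- 2)) $ 6 = 8"
    by (simp_all add: exp_pow_nth ecoeff_def fact_numeral fps_numeral_fps_const del: One_nat_def)
  have B0: "B $ 0 = 8"
    unfolding B_def W3_def[symmetric] fps_sub_nth fps_add_nth[of "_ * _"] fps_mult_left_const_nth E2 fps_mult_nth_0 W Y by simp
  have B2: "B $ 2 = 4 * (1 - c)"
    unfolding B_def W3_def[symmetric] fps_sub_nth fps_add_nth[of "_ * _"] fps_mult_left_const_nth E2 fps_mult_nth_numerals W Y by simp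
  have B4: "3 * B $ 4 = 4 * (1 - c) - 48 * A1"
  proof -
    have "3 * B $ 4 = (1 - c) * (3 * (exp_pow 2 + exp_pow (- 2)) $ 4) - 3 * (8 * Y $ 1)"
      unfolding B_def W3_def[symmetric] fps_sub_nth fps_add_nth[of "_ * _"] fps_mult_left_const_nth fps_mult_nth_numerals W Y(1)
      by (simp add: algebra_simps)
    then show ?thesis unfolding E2 Y by (simp add: algebra_simps)
  qed
  have B6: "45 * B $ 6 = 8 * (1 - c) - 120 * A3 - 360 * A1"
  proof -
    have "45 * B $ 6 = (1 - c) * (45 * (exp_pow 2 + exp_pow (- 2)) $ 6) - 120 * (3 * Y $ 3) - 180 * Y $ 1"
      unfolding B_def W3_def[symmetric] fps_sub_nth fps_add_nth[of "_ * _"] fps_mult_left_const_nth fps_mult_nth_numerals W Y(1)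
      by (simp add: algebra_simps)
    then show ?thesis unfolding E2 Y by (simp add: algebra_simps)
  qed
  have d1: "2 * B $ 2 = N $ 1 * B $ 0"
    using arg_cong[OF D, of "\<lambda>f. f $ 1"] unfolding fps_deriv_nth_numerals fps_mult_nth_numerals N(1) by simp
  have d3: "4 * B $ 4 = N $ 1 * B $ 2 + N $ 3 * B $ 0"
    using arg_cong[OF D, of "\<lambda>f. f $ 3"] unfolding fps_deriv_nth_numerals fps_mult_nth_numerals N(1,3) by simp
  have d5: "6 * B $ 6 = N $ 1 * B $ 4 + N $ 3 * B $ 2 + N $ 5 * B $ 0"
    using arg_cong[OF D, of "\<lambda>f. f $ 5"] unfolding fps_deriv_nth_numerals fps_mult_nth_numerals N(1,3,5) by simp
  have "8 * c = 8 * (1 + 8 * w)"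
    using d1 unfolding B2 B0 N by (simp add: algebra_simps)
  then have c: "c = 1 + 8 * w" by (rule mult_left_cancel[THEN iffD1, rotated]) simp
  have "8 * fps_XD psi = 8 * (w * (psi :: rat fps))"
    using cpsi unfolding c by (simp add: algebra_simps)
  then show "fps_XD psi = w * psi" by (rule mult_left_cancel[THEN iffD1, rotated]) simp
  have "12 * B $ 4 = N $ 1 * (3 * B $ 2) + 8 * (3 * N $ 3)"
  proof -
    have "12 * B $ 4 = 3 * (4 * B $ 4)" by simp
    then show ?thesis unfolding d3 B0 by (simp add: algebra_simps)
  qed
  moreover have "12 * B $ 4 = 4 * (3 * B $ 4)" by simp
  ultimately have "4 * (4 * (- 8 * w) - 48 * A1) = - 8 * w * (3 * (4 * (- 8 * w))) + 8 * (- 16 * x3)"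
    unfolding B4 N B2 c by (simp add: algebra_simps)
  then have "- 64 * (3 * A1) = - 64 * (2 * (x3 - w) - 12 * w ^ 2)"
    by (simp add: algebra_simps power2_eq_square)
  then have A1: "3 * A1 = 2 * (x3 - w) - 12 * w ^ 2" by (rule mult_left_cancel[THEN iffD1, rotated]) simp
  then show "3 * (8 * fps_XD (lam 1) - (1 + 8 * w) * lam 1 + lam 3) = 2 * (x3 - w) - 12 * w ^ 2"
    unfolding A1_def c by (simp add: algebra_simps)
  have "6 * (45 * B $ 6) = 15 * (N $ 1 * (3 * B $ 4)) + 15 * ((3 * N $ 3) * B $ 2) + 24 * (15 * N $ 5)"
  proof -
    have "6 * (45 * B $ 6) = 45 * (6 * B $ 6)" by simp
    then show ?thesis unfolding d5 B0 by (simp add: algebra_simps)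
  qed
  then have "6 * (8 * (- 8 * w) - 120 * A3 - 360 * A1) = 15 * (- 8 * w * (4 * (- 8 * w) - 48 * A1)) + 15 * (- 16 * x3 * (4 * (- 8 * w))) + 24 * (- 16 * x5)"
    unfolding B6 N B4 B2 c by (simp add: algebra_simps)
  then have "- 720 * A3 = 384 * w + 720 * (3 * A1) + 3840 * w * w + 1920 * w * (3 * A1) + 7680 * x3 * w - 384 * x5"
    by (simp add: algebra_simps)
  then have "- 48 * (15 * A3) = - 48 * (8 * (x5 - w) - 30 * (x3 - w) + 180 * w ^ 2 - 240 * w * x3 + 480 * w ^ 3)"
    unfolding A1 by (simp add: algebra_simps power2_eq_square power3_eq_cube)
  then have "15 * A3 = 8 * (x5 - w) - 30 * (x3 - w) + 180 * w ^ 2 - 240 * w * x3 + 480 * w ^ 3"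
    by (rule mult_left_cancel[THEN iffD1, rotated]) simp
  then show "15 * (8 * fps_XD (lam 3) - (1 + 8 * w) * lam 3 + lam 5)
       = 8 * (x5 - w) - 30 * (x3 - w) + 180 * w ^ 2 - 240 * w * x3 + 480 * w ^ 3"
    unfolding A3_def c by (simp add: algebra_simps)
qed

section \<open>Differential equations modulo 3 and 5\<close>

text \<open>Identities proved over the rationals are pulled back to the integers by injectivity of
  this map, then pushed into characteristic 3 or 5.\<close>

definition of_int_fps :: "int fps \<Rightarrow> 'a::comm_ring_1 fps" where
  "of_int_fps f = Abs_fps (\<lambda>n. of_int (f $ n))"

lemma of_int_fps_nth [simp]: "of_int_fps f $ n = of_int (f $ n)"
  by (simp add: of_int_fps_def)

lemma of_int_fps_simps [simp]:
  "of_int_fps 0 = 0" "of_int_fps 1 = 1"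
  "of_int_fps (f + g) = of_int_fps f + of_int_fps g"
  "of_int_fps (f - g) = of_int_fps f - of_int_fps g"
  "of_int_fps (- f) = - of_int_fps f"
  "of_int_fps (f * g) = of_int_fps f * of_int_fps g"
  "of_int_fps fps_X = fps_X"
  "of_int_fps (fps_XD f) = fps_XD (of_int_fps f)"
  by (rule fps_ext; simp add: fps_mult_nth fps_XD_nth)+

lemma of_int_fps_power [simp]: "of_int_fps (f ^ n) = of_int_fps f ^ n"
  by (induction n) simp_all

lemma of_int_fps_of_nat [simp]: "of_int_fps (of_nat n) = of_nat n"
  by (induction n) simp_all

lemma of_int_fps_numeral [simp]: "of_int_fps (numeral n) = numeral n"
  using of_int_fps_of_nat[of "numeral n"] by simp

lemma of_int_fps_eq_iff: "(of_int_fps f :: rat fps) = of_int_fps g \<longleftrightarrow> f = g"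
  by (auto simp: fps_eq_iff)

lemma of_int_fps_fsum:
  assumes "fsummable a"
  shows "of_int_fps (fsum a) = (fsum (\<lambda>i. of_int_fps (a i)) :: 'b::comm_ring_1 fps)"
proof (rule fps_ext)
  fix N
  have "finite {i. a i $ N \<noteq> 0}" using assms by (simp add: fsummable_def)
  then have "(fsum (\<lambda>i. of_int_fps (a i)) :: 'b fps) $ N = (\<Sum>i | a i $ N \<noteq> 0. of_int_fps (a i) $ N)"
    by (rule fsum_nth) auto
  then show "of_int_fps (fsum a) $ N = (fsum (\<lambda>i. of_int_fps (a i)) :: 'b fps) $ N"
    by (simp add: fsum_def[of a])
qed

lemma of_int_fps_series [simp]:
  "of_int_fps psi = psi" "of_int_fps (lam k) = lam k"
  "b > 0 \<Longrightarrow> of_int_fps (eis b k) = eis b k"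
proof -
  show "of_int_fps psi = psi"
    unfolding psi_def using fsummable_psi[of "\<lambda>_. 1 :: int fps"] by (simp add: of_int_fps_fsum)
  show "of_int_fps (lam k) = lam k"
    unfolding lam_def using fsummable_lam[of "\<lambda>n j. of_nat ((2 * j + 1) ^ k)"]
    by (subst of_int_fps_fsum) (simp_all add: case_prod_unfold del: of_nat_power power_Suc)
  show "of_int_fps (eis b k) = eis b k" if "b > 0"
    unfolding eis_def using fsummable_eis[OF that, of "\<lambda>m l. of_nat (Suc m ^ k)"]
    by (subst of_int_fps_fsum) (simp_all add: case_prod_unfold del: of_nat_power power_Suc)
qed

lemma psi_XD: "fps_XD psi = (eis 1 1 - 4 * eis 2 1) * (psi :: int fps)"
  unfolding of_int_fps_eq_iff[symmetric] using lam_identities(1) by simp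

lemma ramanujan_int:
  "6 * fps_XD (eis 1 1) = eis 1 1 - 12 * eis 1 1 ^ 2 + 5 * (eis 1 3 :: int fps)"
  "3 * fps_XD (eis 2 1) = eis 2 1 - 12 * eis 2 1 ^ 2 + 5 * (eis 2 3 :: int fps)"
proof -
  show "6 * fps_XD (eis 1 1) = eis 1 1 - 12 * eis 1 1 ^ 2 + 5 * (eis 1 3 :: int fps)"
    unfolding of_int_fps_eq_iff[symmetric] using ramanujan(1)[of 1] by simp
  have "2 * (3 * fps_XD (eis 2 1)) = 2 * (eis 2 1 - 12 * eis 2 1 ^ 2 + 5 * (eis 2 3 :: int fps))"
    unfolding of_int_fps_eq_iff[symmetric] using ramanujan(1)[of 2] by simp
  then show "3 * fps_XD (eis 2 1) = eis 2 1 - 12 * eis 2 1 ^ 2 + 5 * (eis 2 3 :: int fps)"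
    by (rule mult_left_cancel[THEN iffD1, rotated]) simp
qed

lemma eis_level_relation_int:
  "eis 1 3 + 4 * eis 2 3 = 12 * (eis 1 1 - 2 * eis 2 1) ^ 2 + (eis 1 1 - 2 * eis 2 1 :: int fps)"
  unfolding of_int_fps_eq_iff[symmetric] using eis_level_relation by simp

text \<open>Serves characteristic 5; in characteristic 3 the left side is 0.\<close>

lemma lam_1_equation_1:
  fixes w :: "int fps"
  defines "w \<equiv> eis 1 1 - 4 * eis 2 1"
  shows "3 * (8 * fps_XD (lam 1) - (1 + 8 * w) * lam 1 + lam 3) = 2 * (eis 1 3 - 4 * eis 2 3 - w) - 12 * w ^ 2"
  unfolding of_int_fps_eq_iff[symmetric] w_def using lam_identities(2) by simp

text \<open>For characteristic 3: after multiplication by 5 Ramanujan's equations replace the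
  weight-four series, and then a factor 3 cancels over the integers.\<close>

lemma lam_1_equation_2:
  fixes w x y :: "int fps"
  defines "x \<equiv> eis 1 1" and "y \<equiv> eis 2 1" and "w \<equiv> x - 4 * y"
  shows "5 * (8 * fps_XD (lam 1) - (1 + 8 * w) * lam 1 + lam 3)
    = 2 * (2 * fps_XD x - 4 * fps_XD y - 2 * x + 8 * y + 4 * x ^ 2 - 16 * y ^ 2) - 20 * w ^ 2"
proof -
  note h = lam_1_equation_1[folded x_def y_def, folded w_def]
  note r = ramanujan_int[folded x_def y_def]
  have "3 * (5 * (8 * fps_XD (lam 1) - (1 + 8 * w) * lam 1 + lam 3)) =
      2 * (5 * eis 1 3 - 4 * (5 * eis 2 3) - 5 * w) - 60 * w ^ 2"
    using arg_cong[OF h, of "\<lambda>t. 5 * t"] by (simp add: algebra_simps)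
  also have "5 * eis 1 3 = 6 * fps_XD x - x + 12 * x ^ 2" using r by (simp add: algebra_simps)
  also have "5 * eis 2 3 = 3 * fps_XD y - y + 12 * y ^ 2" using r by (simp add: algebra_simps)
  also have "2 * (6 * fps_XD x - x + 12 * x ^ 2 - 4 * (3 * fps_XD y - y + 12 * y ^ 2) - 5 * w) - 60 * w ^ 2
    = 3 * (2 * (2 * fps_XD x - 4 * fps_XD y - 2 * x + 8 * y + 4 * x ^ 2 - 16 * y ^ 2) - 20 * w ^ 2)"
    by (simp add: algebra_simps w_def)
  finally show ?thesis by (rule mult_left_cancel[THEN iffD1, rotated]) simp
qed

text \<open>For characteristic 5: after multiplication by 21 Ramanujan's equations replace the
  weight-six series, and the 5 in 15 cancels; the remaining 63 is prime to 5.\<close>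

lemma lam_3_equation:
  fixes w x y a b :: "int fps"
  defines "x \<equiv> eis 1 1" and "y \<equiv> eis 2 1" and "a \<equiv> eis 1 3" and "b \<equiv> eis 2 3" and "w \<equiv> x - 4 * y"
  shows "63 * (8 * fps_XD (lam 3) - (1 + 8 * w) * lam 3 + lam 5)
    = 8 * (6 * fps_XD a - 12 * fps_XD b - 2 * a + 8 * b - 4 * x + 16 * y + 48 * x * a - 192 * y * b)
      - 126 * (a - 4 * b - w) + 756 * w ^ 2 - 1008 * w * (a - 4 * b) + 2016 * w ^ 3"
proof -
  define x5 y5 :: "int fps" where "x5 = eis 1 5" and "y5 = eis 2 5"
  define Z where "Z = 8 * fps_XD (lam 3) - (1 + 8 * w) * lam 3 + lam 5"
  have h: "15 * Z = 8 * (x5 - 4 * y5 - w) - 30 * (a - 4 * b - w) + 180 * w ^ 2 - 240 * w * (a - 4 * b) + 480 * w ^ 3"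
    unfolding Z_def of_int_fps_eq_iff[symmetric] w_def x_def y_def a_def b_def x5_def y5_def
    using lam_identities(3) by simp
  have x5: "21 * x5 = 30 * fps_XD a - 10 * a + x + 240 * x * a"
    unfolding of_int_fps_eq_iff[symmetric] x_def a_def x5_def
    using ramanujan(2)[of 1] by (simp add: algebra_simps)
  have "2 * (21 * y5) = 2 * (15 * fps_XD b - 10 * b + y + 240 * y * b)"
    unfolding of_int_fps_eq_iff[symmetric] y_def b_def y5_def
    using ramanujan(2)[of 2] by (simp add: algebra_simps)
  then have y5: "21 * y5 = 15 * fps_XD b - 10 * b + y + 240 * y * b"
    by (rule mult_left_cancel[THEN iffD1, rotated]) simp
  have "5 * (63 * Z) = 8 * (21 * x5 - 4 * (21 * y5) - 21 * w) - 630 * (a - 4 * b - w) + 3780 * w ^ 2 - 5040 * w * (a - 4 * b) + 10080 * w ^ 3"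
    using arg_cong[OF h, of "\<lambda>t. 21 * t"] by (simp add: algebra_simps)
  also have "\<dots> = 5 * (8 * (6 * fps_XD a - 12 * fps_XD b - 2 * a + 8 * b - 4 * x + 16 * y + 48 * x * a - 192 * y * b)
      - 126 * (a - 4 * b - w) + 756 * w ^ 2 - 1008 * w * (a - 4 * b) + 2016 * w ^ 3)"
    unfolding x5 y5 by (simp add: algebra_simps w_def)
  finally show ?thesis unfolding Z_def by (rule mult_left_cancel[THEN iffD1, rotated]) simp
qed

text \<open>Below \<open>p\<close> is the characteristic, and \<open>q\<close> is an explicit cofactor witnessing a polynomial
  congruence modulo \<open>p\<close>.\<close>

lemma congruence_eqI:
  fixes u v :: "'a::comm_ring_1"
  assumes "p = 0" "s = t" "u - v = c * (s - t) + p * q"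
  shows "u = v"
  using assms by simp

lemma power_expand:
  fixes t :: "'a::monoid_mult"
  shows "t ^ 2 = t * t" "t ^ 3 = t * t * t" "t ^ 4 = t * t * t * t" "t ^ 5 = t * t * t * t * t"
  by (simp_all add: numeral_eq_Suc mult.assoc)

text \<open>The coefficient ring may have zero divisors, but \<open>psi\<close> has constant
  coefficient 1, so \<open>g\<close> vanishes degree by degree.\<close>

lemma psi_mult_eq_0_iff: "psi * g = 0 \<longleftrightarrow> g = (0 :: 'a::comm_ring_1 fps)"
proof
  have "of_int ((psi :: int fps) $ 0) = (1 :: rat)"
    using psi_nth_0 by (metis of_int_fps_nth of_int_fps_series(1))
  then have "(psi :: int fps) $ 0 = 1" by simp
  then have 0: "(psi :: 'a fps) $ 0 = 1"
    by (metis of_int_fps_nth of_int_fps_series(1) of_int_1)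
  assume *: "psi * g = 0"
  have "g $ n = 0" for n
  proof (induction n rule: less_induct)
    case (less n)
    have "0 = (g * psi) $ n" using * by (simp add: mult.commute)
    also have "\<dots> = (\<Sum>i=0..n. if i = n then g $ i else 0)"
      unfolding fps_mult_nth by (rule sum.cong) (use less 0 in auto)
    finally show ?case by simp
  qed
  then show "g = 0" by (simp add: fps_eq_iff)
qed simp

definition nabla :: "'a::comm_ring_1 fps \<Rightarrow> 'a fps" where
  "nabla h = 8 * fps_XD h - (1 + 8 * (eis 1 1 - 4 * eis 2 1)) * h"

lemma nabla_linear: "nabla (f + g) = nabla f + nabla g" "nabla (f - g) = nabla f - nabla g"
  by (simp_all add: nabla_def algebra_simps)

lemma psi_XD': "fps_XD psi = (eis 1 1 - 4 * eis 2 1) * (psi :: 'a::comm_ring_1 fps)"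
  using arg_cong[OF psi_XD, of "of_int_fps :: _ \<Rightarrow> 'a fps"] by simp

definition XD8 :: "'a::comm_ring_1 fps \<Rightarrow> 'a fps" where
  "XD8 g = 8 * fps_XD g - g"

lemma XD8_nth: "XD8 g $ n = (8 * of_nat n - 1) * g $ n"
  by (simp add: XD8_def fps_XD_nth left_diff_distrib mult.assoc fps_numeral_fps_const)

lemma nabla_psi: "nabla (psi * g) = psi * XD8 g"
  unfolding XD8_def nabla_def fps_XD_mult psi_XD' by (simp add: algebra_simps)

text \<open>\<open>\<theta>\<close> acts as \<open>T\<close> on \<open>q^T\<close>, and
  \<open>psi\<close> is supported on \<open>T = 2 n^2 + n\<close>; a polynomial vanishing at all
  these \<open>T\<close> annihilates \<open>psi\<close>.\<close>

lemma psi_power_relation: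
  fixes a b c d :: int
  assumes "\<And>n. (of_int (a * (2 * n ^ 2 + n) ^ 3 + b * (2 * n ^ 2 + n) ^ 2 + c * (2 * n ^ 2 + n)) :: 'a::comm_ring_1) = 0"
  shows "of_int a * fps_XD (fps_XD (fps_XD psi)) + of_int b * fps_XD (fps_XD psi) + of_int c * fps_XD psi = (0 :: 'a fps)"
proof (rule fps_ext)
  fix N
  have "(of_int (a * int N ^ 3 + b * int N ^ 2 + c * int N) :: 'a) * psi $ N = 0"
  proof (cases "\<exists>n. N = nat (2 * n ^ 2 + n)")
    case True
    then obtain n where "N = nat (2 * n ^ 2 + n)" by blast
    moreover have "0 \<le> 2 * n ^ 2 + n" using abs_le_quadratic[of n] by linarith
    ultimately have "int N = 2 * n ^ 2 + n" by simp
    then show ?thesis using assms[of n] by (simp del: of_int_add of_int_mult of_int_power of_int_diff)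
  next
    case False
    then have "(psi :: 'a fps) $ N = (\<Sum>n\<in>{}. fps_X ^ nat (2 * n ^ 2 + n) $ N)"
      unfolding psi_def by (intro fsum_nth) auto
    then show ?thesis by simp
  qed
  then show "(of_int a * fps_XD (fps_XD (fps_XD psi)) + of_int b * fps_XD (fps_XD psi) + of_int c * fps_XD psi) $ N
      = (0 :: 'a fps) $ N"
    by (simp add: fps_XD_nth algebra_simps power_expand flip: fps_of_int)
qed

lemma lam_cong:
  assumes "\<And>j. of_nat ((2 * j + 1) ^ k) = (of_nat ((2 * j + 1) ^ l) :: 'a::comm_ring_1)"
  shows "lam k = (lam l :: 'a fps)"
proof -
  have "of_nat ((2 * j + 1) ^ k) = (of_nat ((2 * j + 1) ^ l) :: 'a fps)" for j
    using assms[of j] by (metis fps_of_nat)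
  then show ?thesis unfolding lam_def by (simp only:)
qed

lemma of_int_power_if_of_nat:
  assumes "\<And>n. (of_nat n :: 'a::comm_ring_1) ^ k = of_nat n" "odd k"
  shows "(of_int n :: 'a) ^ k = of_int n"
  using assms by (cases n rule: int_cases2) simp_all

lemma of_int_power_3:
  assumes "(3 :: 'a::comm_ring_1) = 0"
  shows "(of_int n :: 'a) ^ 3 = of_int n"
proof (rule of_int_power_if_of_nat)
  show "(of_nat n :: 'a) ^ 3 = of_nat n" for n
  proof (induction n)
    case (Suc n)
    show ?case
      by (rule congruence_eqI[OF assms Suc.IH, of _ _ 1 "of_nat n ^ 2 + of_nat n"])
         (simp add: algebra_simps power_expand)
  qed simp
qed simp

lemma of_int_power_5:
  assumes "(5 :: 'a::comm_ring_1) = 0"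
  shows "(of_int n :: 'a) ^ 5 = of_int n"
proof (rule of_int_power_if_of_nat)
  show "(of_nat n :: 'a) ^ 5 = of_nat n" for n
  proof (induction n)
    case (Suc n)
    show ?case
      by (rule congruence_eqI[OF assms Suc.IH, of _ _ 1 "of_nat n ^ 4 + 2 * of_nat n ^ 3 + 2 * of_nat n ^ 2 + of_nat n"])
         (simp add: algebra_simps power_expand)
  qed simp
qed simp

text \<open>With \<open>lam 3 = lam 1\<close> the moment equation becomes
  \<open>nabla h + h = w^2\<close> for \<open>h = y + L\<close>, and \<open>w^2\<close> lies in the
  kernel of \<open>nabla\<close>.\<close>

lemma three_equation:
  fixes F :: "'a::comm_ring_1 fps"
  assumes p: "(3 :: 'a) = 0" and F: "psi * F = eis 2 1 + lam 1"
  shows "(8 * of_nat n - 1) * (8 * of_nat n) * F $ n = 0"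
proof -
  have p': "(3 :: 'a fps) = 0" using p by (simp flip: fps_numeral_fps_const)
  define x y L dx dy dL :: "'a fps" where "x = eis 1 1" and "y = eis 2 1" and "L = lam 1"
    and "dx = fps_XD x" and "dy = fps_XD y" and "dL = fps_XD L"
  define w where "w = x - 4 * y"
  have dw: "fps_XD w = dx - 4 * dy" by (simp add: w_def dx_def dy_def fps_XD_mult)
  have L3: "lam 3 = L" unfolding L_def
    by (rule lam_cong) (use of_int_power_3[OF p, of "int (2 * j + 1)" for j] in \<open>simp only: of_int_of_nat_eq of_nat_power power_one_right\<close>)
  have e1: "5 * (8 * dL - (1 + 8 * w) * L + L) = 2 * (2 * dx - 4 * dy - 2 * x + 8 * y + 4 * x ^ 2 - 16 * y ^ 2) - 20 * w ^ 2"
    using arg_cong[OF lam_1_equation_2, of "of_int_fps :: _ \<Rightarrow> 'a fps"]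
    unfolding w_def dx_def dy_def dL_def L_def x_def y_def by (simp add: L3[unfolded L_def])
  \<comment> \<open>Modulo 3, \<open>2 n^2 + n\<close> takes only the values 0 and 1.\<close>
  have "of_int 0 * fps_XD (fps_XD (fps_XD psi)) + of_int 1 * fps_XD (fps_XD psi) + of_int (- 1) * fps_XD psi = (0 :: 'a fps)"
  proof (rule psi_power_relation)
    fix n :: int
    define z where "z = (of_int n :: 'a)"
    have "(2 * z ^ 2 + z) ^ 2 - (2 * z ^ 2 + z) = 0"
      by (rule congruence_eqI[OF p of_int_power_3[OF p, of n, folded z_def], of _ _ "4 * z + 4" "z ^ 2 + z"])
        (simp add: algebra_simps power_expand)
    then show "(of_int (0 * (2 * n ^ 2 + n) ^ 3 + 1 * (2 * n ^ 2 + n) ^ 2 + - 1 * (2 * n ^ 2 + n)) :: 'a) = 0"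
      by (simp add: z_def)
  qed
  \<comment> \<open>From \<open>\<theta> psi = w psi\<close> the second derivative is
    \<open>(\<theta> w + w^2) psi\<close>.\<close>
  then have "psi * (dx - 4 * dy + w ^ 2 - w) = 0"
    unfolding psi_XD' x_def[symmetric] y_def[symmetric] w_def[symmetric] fps_XD_mult dw
    by (simp add: algebra_simps power_expand)
  then have e2: "dx - 4 * dy + w ^ 2 = w" unfolding psi_mult_eq_0_iff by simp
  have k: "nabla (y + L) + (y + L) = w ^ 2"
  proof (rule congruence_eqI[OF p'])
    \<comment> \<open>The factor 2 inverts 5 modulo 3; adding \<open>e2\<close> turns the
      derivatives left on the right into \<open>w^2\<close>.\<close>
    show "2 * (5 * (8 * dL - (1 + 8 * w) * L + L)) + w = 2 * (2 * (2 * dx - 4 * dy - 2 * x + 8 * y + 4 * x ^ 2 - 16 * y ^ 2) - 20 * w ^ 2) + (dx - 4 * dy + w ^ 2)"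
      by (simp only: e1 e2)
    show "nabla (y + L) + (y + L) - w ^ 2 = 1 * (2 * (5 * (8 * dL - (1 + 8 * w) * L + L)) + w - (2 * (2 * (2 * dx - 4 * dy - 2 * x + 8 * y + 4 * x ^ 2 - 16 * y ^ 2) - 20 * w ^ 2) + (dx - 4 * dy + w ^ 2)))
      + 3 * (- 4 * dy - 24 * dL + 24 * x * L - 224 * y ^ 2 - 96 * y * L - 8 * x ^ 2 + 3 * dx - 3 * x + 12 * y + 104 * x * y)"
      unfolding nabla_def fps_XD_simps x_def[symmetric] y_def[symmetric] dy_def[symmetric] dL_def[symmetric]
      unfolding w_def by (simp add: algebra_simps power_expand)
  qed
  \<comment> \<open>\<open>e2\<close> replaces \<open>\<theta> w\<close> by \<open>w - w^2\<close>,
    so \<open>16 w \<theta> w - (1 + 8 w) w^2\<close> becomes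
    \<open>15 w^2 - 24 w^3\<close>.\<close>
  have n: "nabla (w ^ 2) = 0"
  proof (rule congruence_eqI[OF p' e2])
    have dw2: "fps_XD (w ^ 2) = 2 * w * (dx - 4 * dy)"
      by (simp add: power2_eq_square fps_XD_mult dw)
    show "nabla (w ^ 2) - 0 = (16 * w) * (dx - 4 * dy + w ^ 2 - w) + 3 * (5 * w ^ 2 - 8 * w ^ 3)"
      unfolding nabla_def w_def[unfolded x_def y_def, symmetric] dw2
      by (simp add: algebra_simps power_expand)
  qed
  have "psi * XD8 (XD8 F + F) = 0"
    using n unfolding k[symmetric] y_def L_def F[symmetric] nabla_psi distrib_left[symmetric] .
  then have "XD8 (XD8 F + F) = 0" unfolding psi_mult_eq_0_iff .
  then have "XD8 (XD8 F + F) $ n = 0" by simp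
  then show ?thesis by (simp add: XD8_nth algebra_simps)
qed

text \<open>In characteristic 5 Ramanujan's equations for \<open>x\<close> and \<open>y\<close> lose
  the weight-four series, so \<open>\<theta>\<close> maps polynomials in \<open>x\<close>,
  \<open>y\<close> to such polynomials. Eliminating \<open>M\<close> gives
  \<open>nabla (nabla h) - h = V\<close> for \<open>h = y + L\<close>, and
  \<open>nabla (nabla V)\<close> is a multiple of a cubic that vanishes because of the exponents of
  \<open>psi\<close>.\<close>

lemma five_equation:
  fixes F :: "'a::comm_ring_1 fps"
  assumes p: "(5 :: 'a) = 0" and F: "psi * F = eis 2 1 + lam 1"
  shows "(8 * of_nat n - 1) ^ 2 * ((8 * of_nat n - 1) ^ 2 - 1) * F $ n = 0"
proof -
  have p': "(5 :: 'a fps) = 0" using p by (simp flip: fps_numeral_fps_const)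
  define x y a b L M dL dM :: "'a fps" where "x = eis 1 1" and "y = eis 2 1" and "a = eis 1 3" and "b = eis 2 3"
    and "L = lam 1" and "M = lam 3" and "dL = fps_XD L" and "dM = fps_XD M"
  note fold = x_def[symmetric] y_def[symmetric] a_def[symmetric] b_def[symmetric] L_def[symmetric]
    M_def[symmetric]
  have L5: "lam 5 = L" unfolding L_def
    by (rule lam_cong) (use of_int_power_5[OF p, of "int (2 * j + 1)" for j] in \<open>simp only: of_int_of_nat_eq of_nat_power power_one_right\<close>)
  have dx: "fps_XD x = x + 3 * x ^ 2"
  proof (rule congruence_eqI[OF p'])
    show "6 * fps_XD x = x - 12 * x ^ 2 + 5 * a"
      using arg_cong[OF ramanujan_int(1), of "of_int_fps :: _ \<Rightarrow> 'a fps"] unfolding x_def a_def by simp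
    show "fps_XD x - (x + 3 * x ^ 2) = 1 * (6 * fps_XD x - (x - 12 * x ^ 2 + 5 * a)) + 5 * (a - fps_XD x - 3 * x ^ 2)"
      by (simp add: algebra_simps)
  qed
  have dy: "fps_XD y = 2 * y + y ^ 2"
  proof (rule congruence_eqI[OF p'])
    show "3 * fps_XD y = y - 12 * y ^ 2 + 5 * b"
      using arg_cong[OF ramanujan_int(2), of "of_int_fps :: _ \<Rightarrow> 'a fps"] unfolding y_def b_def by simp
    show "fps_XD y - (2 * y + y ^ 2) = 2 * (3 * fps_XD y - (y - 12 * y ^ 2 + 5 * b)) + 5 * (2 * b - fps_XD y - 5 * y ^ 2)"
      by (simp add: algebra_simps)
  qed
  \<comment> \<open>As \<open>4 b = - b\<close> modulo 5, the level relation eliminates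
    \<open>a\<close>.\<close>
  have ab: "a = b + 2 * (x - 2 * y) ^ 2 + (x - 2 * y)"
  proof (rule congruence_eqI[OF p'])
    show "a + 4 * b = 12 * (x - 2 * y) ^ 2 + (x - 2 * y)"
      using arg_cong[OF eis_level_relation_int, of "of_int_fps :: _ \<Rightarrow> 'a fps"]
      unfolding x_def y_def a_def b_def by simp
    show "a - (b + 2 * (x - 2 * y) ^ 2 + (x - 2 * y)) = 1 * (a + 4 * b - (12 * (x - 2 * y) ^ 2 + (x - 2 * y))) + 5 * (2 * (x - 2 * y) ^ 2 - b)"
      by (simp add: algebra_simps)
  qed
  have nabla: "nabla h = 3 * fps_XD h + 4 * h + 2 * (x + y) * h" for h
    by (rule congruence_eqI[OF p' refl[of 0], of _ _ 1 "fps_XD h - 2 * x * h + 6 * y * h - h"])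
       (simp add: nabla_def fold[unfolded One_nat_def] algebra_simps)
  define w where "w = x - 4 * y"
  have e1: "3 * (8 * dL - (1 + 8 * w) * L + M) = 2 * (a - 4 * b - w) - 12 * w ^ 2"
    using arg_cong[OF lam_1_equation_1, of "of_int_fps :: _ \<Rightarrow> 'a fps"]
    unfolding w_def dL_def x_def y_def a_def b_def L_def M_def by simp
  have e3: "63 * (8 * dM - (1 + 8 * w) * M + L) = 8 * (6 * fps_XD a - 12 * fps_XD b - 2 * a + 8 * b - 4 * x + 16 * y + 48 * x * a - 192 * y * b)
      - 126 * (a - 4 * b - w) + 756 * w ^ 2 - 1008 * w * (a - 4 * b) + 2016 * w ^ 3"
    using arg_cong[OF lam_3_equation, of "of_int_fps :: _ \<Rightarrow> 'a fps"]
    unfolding w_def dM_def x_def y_def a_def b_def M_def L5[symmetric] by simp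
  have n1: "nabla L = 4 * a + 4 * b + (x + y) + (x + y) ^ 2 - M"
    by (rule congruence_eqI[OF p' e1, of _ _ 2 "- 9 * dL + 2 * L + 10 * x * L - 38 * y * L - M - 4 * b - x + 3 * y - 5 * x ^ 2 + 38 * x * y - 77 * y ^ 2"])
       (simp add: nabla w_def dL_def power_expand algebra_simps)
  have n3: "nabla M = fps_XD a + 3 * fps_XD b + a + b + 3 * x + 3 * y + 2 * x * a + 2 * y * b + 2 * x ^ 2 + 4 * x * y + 2 * y ^ 2
      + 4 * x * b + 4 * y * a + 2 * x ^ 3 + x ^ 2 * y + x * y ^ 2 + 2 * y ^ 3 - L"
    by (rule congruence_eqI[OF p' e3, of _ _ 2 "- 201 * dM + 26 * M + 202 * x * M - 806 * y * M - 25 * L + 19 * fps_XD a - 39 * fps_XD b - 57 * a + 227 * b + 37 * x - 151 * y - 250 * x * a - 7066 * y * b + 302 * x ^ 2 - 2420 * x * y + 4838 * y ^ 2 + 1612 * x * b + 1612 * y * a + 806 * x ^ 3 - 9677 * x ^ 2 * y + 38707 * x * y ^ 2 - 51610 * y ^ 3"])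
       (simp add: nabla w_def dM_def power_expand algebra_simps)
  note XD = fps_XD_mult dx dy power_expand
  define V where "V = 2 * x ^ 2 + 2 * y + 2 * x ^ 3 + x ^ 2 * y + 4 * x * y ^ 2 + 4 * y ^ 3 + y ^ 2"
  \<comment> \<open>\<open>M\<close> cancels, and \<open>b\<close> with its derivative survives only
    with coefficients divisible by 5, so \<open>V\<close> involves \<open>x\<close> and
    \<open>y\<close> alone.\<close>
  have V: "nabla (nabla (y + L)) - (y + L) = V"
    unfolding nabla_linear n1 n3
    by (rule congruence_eqI[OF p' refl[of 0], of _ _ 1 "- 64 * x * y - 52 * x ^ 2 * y + 6 * y + 118 * y ^ 2 + 50 * y ^ 3 - 9 * x * y ^ 2 + 4 * fps_XD b + 26 * x ^ 2 + 32 * x ^ 3 + 6 * x + 6 * b + 2 * x * b + 2 * y * b"])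
       (simp add: nabla n3 V_def XD algebra_simps ab)
  have V1: "nabla V = (x ^ 3 + 3 * x ^ 4 + 4 * x ^ 3 * y + 3 * x * y ^ 2 + 4 * x ^ 2 * y ^ 2 + y ^ 2 + y ^ 3 + 4 * y ^ 4 + 4 * x * y)"
    by (rule congruence_eqI[OF p' refl[of 0], of _ _ 1 "4 * x ^ 2 + 13 * x ^ 3 + 11 * x ^ 4 + 4 * x ^ 2 * y + 4 * x ^ 3 * y + 15 * x * y ^ 2 + 9 * x ^ 2 * y ^ 2 + 4 * y + 5 * y ^ 2 + 8 * x * y ^ 3 + 19 * y ^ 3 + 8 * y ^ 4"])
       (simp add: nabla V_def XD algebra_simps)
  \<comment> \<open>The first factor is the cubic shown to be zero in \<open>cub\<close>.\<close>
  have V2: "nabla (nabla V) = (3 * x ^ 3 + 2 * x ^ 2 * y + x * y ^ 2 + y ^ 3 + x ^ 2 + x * y + 4 * y ^ 2 + 4 * y) * (4 * y + y ^ 2 + 3 * x + 2 * x * y + 3 * x ^ 2)"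
    unfolding V1
    by (rule congruence_eqI[OF p' refl[of 0], of _ _ 1 "2 * x ^ 3 + 13 * x ^ 4 + 21 * x ^ 5 + 11 * x ^ 3 * y + 22 * x ^ 4 * y + 11 * x * y ^ 2 + 19 * x ^ 2 * y ^ 2 + 18 * x ^ 3 * y ^ 2 + 8 * x * y + 5 * x ^ 2 * y + 2 * x * y ^ 3 + 5 * x ^ 2 * y ^ 3 + 2 * y ^ 3 + 23 * y ^ 4 + 11 * y ^ 5 + x * y ^ 4"])
       (simp add: nabla XD algebra_simps)
  \<comment> \<open>The polynomial is \<open>T (T - 1) (T - 3)\<close>: modulo 5,
    \<open>2 n^2 + n\<close> takes only the values 0, 1, 3.\<close>
  have "of_int 1 * fps_XD (fps_XD (fps_XD psi)) + of_int (- 4) * fps_XD (fps_XD psi) + of_int 3 * fps_XD psi = (0 :: 'a fps)"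
  proof (rule psi_power_relation)
    fix n :: int
    define z where "z = (of_int n :: 'a)"
    have "(2 * z ^ 2 + z) ^ 3 - 4 * (2 * z ^ 2 + z) ^ 2 + 3 * (2 * z ^ 2 + z) = 0"
      by (rule congruence_eqI[OF p of_int_power_5[OF p, of n, folded z_def], of _ _ "8 * z + 12" "2 * z ^ 2 + 3 * z - 2 * z ^ 4 - 3 * z ^ 3"])
        (simp add: algebra_simps power_expand)
    then show "(of_int (1 * (2 * n ^ 2 + n) ^ 3 + - 4 * (2 * n ^ 2 + n) ^ 2 + 3 * (2 * n ^ 2 + n)) :: 'a) = 0"
      by (simp add: z_def)
  qed
  note h = this
  \<comment> \<open>\<open>u\<close> is the logarithmic derivative of \<open>psi\<close> modulo 5,
    \<open>u1\<close> and \<open>u2\<close> its derivatives; the third derivative of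
    \<open>psi\<close> is \<open>(u^3 + 3 u u1 + u2) psi\<close>.\<close>
  define u u1 u2 where "u = x + y" and "u1 = x + 3 * x ^ 2 + 2 * y + y ^ 2" and "u2 = x + 4 * x ^ 2 + 3 * x ^ 3 + 4 * y + y ^ 2 + 2 * y ^ 3"
  have psi': "fps_XD psi = u * (psi :: 'a fps)"
    by (rule congruence_eqI[OF p' psi_XD', of _ _ 1 "- y * psi"]) (simp add: u_def fold[unfolded One_nat_def] algebra_simps)
  have u: "fps_XD u = u1" by (simp add: u_def u1_def dx dy)
  have u1: "fps_XD u1 = u2"
    unfolding u1_def u2_def
    by (rule congruence_eqI[OF p' refl[of 0], of _ _ 1 "x ^ 2 + 3 * x ^ 3 + y ^ 2"]) (simp add: XD algebra_simps)
  have "psi * (u ^ 3 + 3 * u * u1 + u2 - 4 * u ^ 2 - 4 * u1 + 3 * u) = 0"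
    using h unfolding psi' fps_XD_mult fps_XD_simps u u1 by (simp add: algebra_simps power_expand)
  then have "u ^ 3 + 3 * u * u1 + u2 - 4 * u ^ 2 - 4 * u1 + 3 * u = 0" unfolding psi_mult_eq_0_iff .
  then have cub: "(3 * x ^ 3 + 2 * x ^ 2 * y + x * y ^ 2 + y ^ 3 + x ^ 2 + x * y + 4 * y ^ 2 + 4 * y) = 0"
    by (rule congruence_eqI[OF p', of _ _ _ _ 1 "- 2 * x ^ 3 - 2 * x ^ 2 * y - x * y ^ 2 - y ^ 3 + 2 * x ^ 2 + y ^ 2 + y"]) (simp add: u_def u1_def u2_def algebra_simps power_expand)
  have "nabla (nabla V) = 0" unfolding V2 cub by simp
  then have "psi * XD8 (XD8 (XD8 (XD8 F) - F)) = 0"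
    unfolding V[symmetric] y_def L_def F[symmetric] nabla_psi right_diff_distrib[symmetric] .
  then have "XD8 (XD8 (XD8 (XD8 F) - F)) = 0" unfolding psi_mult_eq_0_iff .
  then have "XD8 (XD8 (XD8 (XD8 F) - F)) $ n = 0" by simp
  then show ?thesis by (simp add: XD8_nth algebra_simps power2_eq_square)
qed

section \<open>Generating functions of partitions\<close>

definition partitions_in :: "nat set \<Rightarrow> nat \<Rightarrow> nat multiset set" where
  "partitions_in S N = {P. set_mset P \<subseteq> S \<and> (\<forall>i\<in>#P. odd i \<longrightarrow> count P i = 1) \<and> sum_mset P = N}"

lemma size_le_sum_mset: "0 \<notin># P \<Longrightarrow> size P \<le> (sum_mset P :: nat)"
  by (induction P) auto

lemma finite_partitions_in:
  assumes "finite S" "0 \<notin> S"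
  shows "finite (partitions_in S N)"
proof (rule finite_subset)
  show "partitions_in S N \<subseteq> mset ` {xs. set xs \<subseteq> S \<and> length xs \<le> N}"
  proof
    fix P assume P: "P \<in> partitions_in S N"
    obtain xs where "mset xs = P" using ex_mset by blast
    moreover have "0 \<notin># P" using P assms(2) by (auto simp: partitions_in_def)
    ultimately show "P \<in> mset ` {xs. set xs \<subseteq> S \<and> length xs \<le> N}"
      using P size_le_sum_mset[of P] by (auto simp: partitions_in_def intro!: image_eqI[of _ _ xs])
  qed
  show "finite (mset ` {xs. set xs \<subseteq> S \<and> length xs \<le> N})"
    using finite_lists_length_le[OF assms(1)] by simp
qed

lemma partitions_in_insert_remove:
  assumes "P \<in> partitions_in (insert s S) N" "s \<in># P" "s \<notin> S"
  obtains Q where "P = add_mset s Q" "s \<le> N" "Q \<in> partitions_in (if odd s then S else insert s S) (N - s)"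
proof -
  obtain Q where Q: "P = add_mset s Q" using assms(2) by (meson mset_add)
  have *: "count P i = 1" if "i \<in># P" "odd i" for i
    using assms(1) that by (auto simp: partitions_in_def)
  have "count Q i = 1" if "i \<in># Q" "odd i" for i
    using *[of i] that by (auto simp: Q count_eq_zero_iff split: if_splits)
  moreover have "s \<notin># Q" if "odd s" using *[OF assms(2) that] by (simp add: Q count_eq_zero_iff)
  ultimately show ?thesis
    using assms(1) by (intro that[OF Q]) (auto simp: partitions_in_def Q)
qed

text \<open>Either \<open>s\<close> is absent or one copy is removed; for odd \<open>s\<close> no
  second copy may remain, so the rest lies over \<open>S\<close>.\<close>

lemma partitions_in_insert:
  assumes "s \<notin> S"
  shows "partitions_in (insert s S) N = partitions_in S N \<union>
    (if s \<le> N then add_mset s ` partitions_in (if odd s then S else insert s S) (N - s) else {})"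
    (is "_ = _ \<union> ?A")
proof (intro subset_antisym subsetI)
  fix P assume P: "P \<in> partitions_in (insert s S) N"
  show "P \<in> partitions_in S N \<union> ?A"
  proof (cases "s \<in># P")
    case True
    then obtain Q where "P = add_mset s Q" "s \<le> N" "Q \<in> partitions_in (if odd s then S else insert s S) (N - s)"
      by (rule partitions_in_insert_remove[OF P _ assms])
    then show ?thesis by (intro UnI2) simp
  next
    case False
    with P show ?thesis by (auto simp: partitions_in_def)
  qed
next
  fix P assume "P \<in> partitions_in S N \<union> ?A"
  then show "P \<in> partitions_in (insert s S) N"
    using assms by (auto simp: partitions_in_def count_eq_zero_iff split: if_splits)
qed

text \<open>With \<open>-q\<close> for \<open>q\<close>, an odd part used at most once gives
  \<open>1 + (-q)^s = 1 - q^s\<close>, and an even part a geometric series.\<close>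

definition part_factor :: "nat \<Rightarrow> rat fps" where
  "part_factor s = (if odd s then 1 - fps_X ^ s else inverse (1 - fps_X ^ s))"

text \<open>Division by \<open>1 - q^s\<close> as a recursion in the degree, matching the removal of
  one part \<open>s\<close>.\<close>

lemma fps_mult_inverse_nth:
  fixes G :: "rat fps"
  assumes "s > 0"
  shows "(G * inverse (1 - fps_X ^ s)) $ N = G $ N + (if s \<le> N then (G * inverse (1 - fps_X ^ s)) $ (N - s) else 0)"
proof -
  define H where "H = G * inverse (1 - fps_X ^ s)"
  have "inverse (1 - fps_X ^ s) * (1 - fps_X ^ s) = (1 :: rat fps)"
    by (rule inverse_mult_eq_1) (use assms in simp)
  moreover have "H - fps_X ^ s * H = G * (inverse (1 - fps_X ^ s) * (1 - fps_X ^ s))"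
    unfolding mult.assoc[symmetric] H_def[symmetric] by (simp add: algebra_simps)
  ultimately have "G = H - fps_X ^ s * H" by simp
  then have "G $ N = (H - fps_X ^ s * H) $ N" by (rule arg_cong)
  then show ?thesis unfolding H_def[symmetric] by (simp add: fps_X_power_mult_nth)
qed

lemma prod_part_factor_nth:
  assumes "finite S" "0 \<notin> S"
  shows "(\<Prod>s\<in>S. part_factor s) $ N = (- 1) ^ N * of_nat (card (partitions_in S N))"
  using assms
proof (induction S arbitrary: N)
  case empty
  have "partitions_in {} N = (if N = 0 then {{#}} else {})" by (auto simp: partitions_in_def)
  then show ?case by simp
next
  case (insert s S)
  then have s: "s > 0" "0 \<notin> S" "0 \<notin> insert s S" by auto
  have disj: "partitions_in S N \<inter> add_mset s ` A = {}" for A N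
    using insert.hyps(2) by (auto simp: partitions_in_def)
  have c: "card (partitions_in (insert s S) N) = card (partitions_in S N) +
      (if s \<le> N then card (partitions_in (if odd s then S else insert s S) (N - s)) else 0)" for N
  proof -
    have "finite (partitions_in (if odd s then S else insert s S) (N - s))"
      using finite_partitions_in insert.hyps(1) s by auto
    then show ?thesis
      unfolding partitions_in_insert[OF insert.hyps(2)]
      using finite_partitions_in[OF insert.hyps(1) s(2)] disj
      by (simp add: card_Un_disjoint card_image inj_on_def)
  qed
  define G where "G = (\<Prod>s\<in>S. part_factor s)"
  have G: "G $ N = (- 1) ^ N * of_nat (card (partitions_in S N))" for N
    unfolding G_def by (rule insert.IH) (use s in simp)
  have pr: "(\<Prod>s\<in>insert s S. part_factor s) = G * part_factor s"
    using insert.hyps by (simp add: G_def mult.commute)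
  have sgn: "(- 1) ^ N = (if odd s then - 1 else 1) * (- 1 :: rat) ^ (N - s)" if "s \<le> N" for N
  proof -
    have "(- 1 :: rat) ^ N = (- 1) ^ s * (- 1) ^ (N - s)" using that by (simp flip: power_add)
    then show ?thesis by simp
  qed
  show ?case
  proof (cases "odd s")
    case True
    have "(G * part_factor s) $ N = G $ N - (if s \<le> N then G $ (N - s) else 0)"
      using True by (simp add: part_factor_def right_diff_distrib fps_X_power_mult_right_nth not_less[symmetric])
    then show ?thesis unfolding pr c G
      using True sgn[of N] by (cases "s \<le> N") (simp_all add: algebra_simps)
  next
    case False
    \<comment> \<open>For even \<open>s\<close> the coefficient at \<open>N\<close> refers to the
      same series at \<open>N - s\<close>, hence a second induction.\<close>
    have "(G * part_factor s) $ N = (- 1) ^ N * of_nat (card (partitions_in (insert s S) N))" for N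
    proof (induction N rule: less_induct)
      case (less N)
      show ?case
        using fps_mult_inverse_nth[OF s(1), of G N] False s(1) less.IH[of "N - s"] sgn[of N] unfolding c[of N]
        by (simp add: part_factor_def G algebra_simps)
    qed
    then show ?thesis unfolding pr .
  qed
qed

text \<open>\<open>q^s / (1 - q^s)^2 = \<Sum> m q^(m s)\<close> weights a partition by the
  multiplicity of \<open>s\<close>. In the proof, deleting one \<open>s\<close> lowers the
  multiplicity by one, which is the recursion \<open>cN\<close>.\<close>

lemma smallest_part_part_factor_nth:
  assumes "finite S" "0 \<notin> S" "s \<notin> S" "even s" "s > 0"
  shows "(fps_X ^ s * inverse ((1 - fps_X ^ s) ^ 2) * (\<Prod>s\<in>S. part_factor s)) $ N
    = (- 1) ^ N * of_nat (\<Sum>P\<in>partitions_in (insert s S) N. count P s)"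
proof (induction N rule: less_induct)
  case (less N)
  define c where "c N = (\<Sum>P\<in>partitions_in (insert s S) N. count P s)" for N
  have f: "finite (partitions_in (insert s S) N)" "finite (partitions_in S N)" for N
    using finite_partitions_in assms by auto
  have cN: "c N = (if s \<le> N then card (partitions_in (insert s S) (N - s)) + c (N - s) else 0)"
  proof -
    have 0: "(\<Sum>P\<in>partitions_in S N. count P s) = 0"
      by (rule sum.neutral) (use assms(3) in \<open>auto simp: partitions_in_def count_eq_zero_iff\<close>)
    have 1: "partitions_in S N \<inter> add_mset s ` A = {}" for A
      using assms(3) by (auto simp: partitions_in_def)
    have 2: "(\<Sum>P\<in>add_mset s ` partitions_in (insert s S) M. count P s) = card (partitions_in (insert s S) M) + c M" for M
      unfolding c_def by (subst sum.reindex) (auto simp: sum.distrib sum_Suc inj_on_def)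
    show ?thesis
      unfolding c_def[of N] partitions_in_insert[OF assms(3), of N]
      using 0 1 2 assms(4) f by (simp add: sum.union_disjoint)
  qed
  define H where "H = (\<Prod>s\<in>S. part_factor s) * inverse (1 - fps_X ^ s)"
  have H: "H = (\<Prod>s\<in>insert s S. part_factor s)"
    using assms by (simp add: H_def part_factor_def mult.commute)
  have Hn: "H $ N = (- 1) ^ N * of_nat (card (partitions_in (insert s S) N))" for N
    unfolding H by (rule prod_part_factor_nth) (use assms in auto)
  have T: "fps_X ^ s * inverse ((1 - fps_X ^ s) ^ 2) * (\<Prod>s\<in>S. part_factor s) = (fps_X ^ s * H) * inverse (1 - fps_X ^ s)"
    by (simp add: H_def power2_eq_square fps_inverse_mult mult_ac)
  have sgn: "(- 1) ^ N = (- 1 :: rat) ^ (N - s)" if "s \<le> N"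
  proof -
    have "(- 1 :: rat) ^ N = (- 1) ^ s * (- 1) ^ (N - s)" using that by (simp flip: power_add)
    then show ?thesis using assms(4) by simp
  qed
  have "(fps_X ^ s * H * inverse (1 - fps_X ^ s)) $ N
      = (if s \<le> N then (- 1) ^ (N - s) * of_nat (card (partitions_in (insert s S) (N - s))) + (- 1) ^ (N - s) * of_nat (c (N - s)) else 0)"
    using less.IH[of "N - s"] assms(5) unfolding fps_mult_inverse_nth[OF assms(5), of "fps_X ^ s * H" N] T c_def[symmetric]
    by (simp add: fps_X_power_mult_nth Hn)
  then show ?case
    unfolding T c_def[symmetric] cN using sgn by (simp add: algebra_simps)
qed

text \<open>The partitions are sorted by their smallest part \<open>2 n\<close>; parts of a
  partition of \<open>N\<close> are at most \<open>N\<close>, so the bound \<open>2 B\<close>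
  excludes none.\<close>

lemma fpart_nth:
  assumes "N \<le> B"
  shows "fpart B $ N = (- 1) ^ N * of_nat (M2spt N)"
proof -
  define A where "A n = {P \<in> partitions_in {2 * n..2 * B} N. 2 * n \<in># P}" for n
  have pr: "(\<Prod>k\<in>{n<..B}. (1 - fps_X ^ (2 * k - 1)) * inverse (1 - fps_X ^ (2 * k))) = (\<Prod>s\<in>{2 * n<..2 * B}. part_factor s)" for n
  proof (cases "n \<le> B")
    case True
    then show ?thesis
    proof (induction B rule: dec_induct)
      case (step B)
      have "{n<..Suc B} = insert (Suc B) {n<..B}" "{2 * n<..2 * Suc B} = insert (2 * B + 2) (insert (2 * B + 1) {2 * n<..2 * B})"
        using step.hyps by auto
      with step.IH show ?case by (simp add: part_factor_def mult_ac)
    qed simp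
  qed simp
  have MinA: "Min (set_mset P) = 2 * n" if "P \<in> A n" for P n
    using that by (intro Min_eqI) (auto simp: A_def partitions_in_def)
  have "M2_partitions N = (\<Union>n\<in>{1..B}. A n)"
  proof (intro subset_antisym subsetI)
    fix P assume P: "P \<in> M2_partitions N"
    define m where "m = Min (set_mset P)"
    have m: "m \<in># P" using P by (auto simp: m_def M2_partitions_def)
    obtain n where n: "m = 2 * n" using P by (auto simp: M2_partitions_def m_def elim: evenE)
    have le: "i \<le> N" "m \<le> i" if "i \<in># P" for i
      using P that sum_mset.remove[OF that] by (auto simp: M2_partitions_def m_def)
    have "P \<in> A n" using P m le assms unfolding n by (force simp: A_def M2_partitions_def partitions_in_def)
    moreover have "n \<in> {1..B}" using P m le[OF m] assms by (auto simp: n M2_partitions_def)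
    ultimately show "P \<in> (\<Union>n\<in>{1..B}. A n)" by blast
  next
    fix P assume "P \<in> (\<Union>n\<in>{1..B}. A n)"
    then obtain n where n: "n \<in> {1..B}" "P \<in> A n" by blast
    with MinA[OF n(2)] show "P \<in> M2_partitions N"
      by (auto simp: A_def M2_partitions_def partitions_in_def)
  qed
  moreover have fin: "finite (A n)" if "n \<in> {1..B}" for n
    using that finite_partitions_in[of "{2 * n..2 * B}" N] by (simp add: A_def)
  moreover have "A i \<inter> A j = {}" if "i \<noteq> j" for i j
    using MinA[of _ i] MinA[of _ j] that by fastforce
  ultimately have "M2spt N = (\<Sum>n=1..B. \<Sum>P\<in>A n. count P (Min (set_mset P)))"
    unfolding M2spt_def by (simp add: sum.UNION_disjoint)
  also have "\<dots> = (\<Sum>n=1..B. \<Sum>P\<in>partitions_in {2 * n..2 * B} N. count P (2 * n))"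
  proof (rule sum.cong[OF refl])
    fix n assume n: "n \<in> {1..B}"
    have "(\<Sum>P\<in>A n. count P (Min (set_mset P))) = (\<Sum>P\<in>A n. count P (2 * n))"
      by (rule sum.cong[OF refl]) (simp add: MinA)
    also have "\<dots> = (\<Sum>P\<in>partitions_in {2 * n..2 * B} N. count P (2 * n))"
      by (rule sum.mono_neutral_left) (use n finite_partitions_in[of "{2 * n..2 * B}" N] in \<open>auto simp: A_def count_eq_zero_iff\<close>)
    finally show "(\<Sum>P\<in>A n. count P (Min (set_mset P))) = (\<Sum>P\<in>partitions_in {2 * n..2 * B} N. count P (2 * n))" .
  qed
  finally have M: "M2spt N = (\<Sum>n=1..B. \<Sum>P\<in>partitions_in {2 * n..2 * B} N. count P (2 * n))" .
  have "fpart B $ N = (\<Sum>n=1..B. (- 1) ^ N * of_nat (\<Sum>P\<in>partitions_in {2 * n..2 * B} N. count P (2 * n)))"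
    unfolding fpart_def pr fps_sum_nth
  proof (rule sum.cong[OF refl])
    fix n assume n: "n \<in> {1..B}"
    then have "{2 * n..2 * B} = insert (2 * n) {2 * n<..2 * B}" by auto
    then show "(fps_X ^ (2 * n) * inverse ((1 - fps_X ^ (2 * n)) ^ 2) * (\<Prod>s\<in>{2 * n<..2 * B}. part_factor s)) $ N =
        (- 1) ^ N * of_nat (\<Sum>P\<in>partitions_in {2 * n..2 * B} N. count P (2 * n))"
      using smallest_part_part_factor_nth[of "{2 * n<..2 * B}" "2 * n" N] n by simp
  qed
  then show ?thesis unfolding M by (simp add: sum_distrib_left)
qed

definition M2spt_series :: "'a::comm_ring_1 fps" where
  "M2spt_series = Abs_fps (\<lambda>n. (- 1) ^ n * of_nat (M2spt n))"

lemma psi_mult_M2spt_series: "psi * M2spt_series = eis 2 1 + (lam 1 :: 'a::comm_ring_1 fps)"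
proof -
  have M: "of_int_fps M2spt_series = (M2spt_series :: 'b::comm_ring_1 fps)"
    by (rule fps_ext) (simp add: M2spt_series_def)
  have "psi * M2spt_series = eis 2 1 + (lam 1 :: rat fps)"
    by (rule psi_mult_limit) (simp add: fpart_nth M2spt_series_def)
  then have "psi * M2spt_series = eis 2 1 + (lam 1 :: int fps)"
    unfolding of_int_fps_eq_iff[symmetric] by (simp add: M)
  from arg_cong[OF this, of "of_int_fps :: _ \<Rightarrow> 'a fps"] show ?thesis by (simp add: M)
qed

text \<open>\<open>k\<close> certifies that the factor \<open>m\<close> supplied by the differential
  equation is a unit.\<close>

lemma M2spt_mod_CHAR:
  assumes "m * ((- 1) ^ N * (of_nat (M2spt N) :: 'a)) = 0" "k * m = (1 :: 'a :: comm_ring_1)"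
  shows "M2spt N mod CHAR('a) = 0"
proof -
  have "of_nat (M2spt N) = k * m * ((- 1) ^ N * (- 1) ^ N) * (of_nat (M2spt N) :: 'a)"
    using assms(2) by (simp flip: power_add)
  also have "\<dots> = k * (- 1) ^ N * (m * ((- 1) ^ N * (of_nat (M2spt N) :: 'a)))" by (simp only: mult_ac)
  finally have "(of_nat (M2spt N) :: 'a) = 0" unfolding assms(1) by simp
  then show ?thesis by (simp add: of_nat_eq_0_iff_char_dvd flip: dvd_eq_mod_eq_0)
qed

theorem theorem1p3:
  fixes n :: nat
  shows "M2spt (3 * n + 1) mod 3 = 0 \<and> M2spt (5 * n + 1) mod 5 = 0 \<and> M2spt (5 * n + 3) mod 5 = 0"
proof (intro conjI)
  have p3: "(3 :: 3) = 0" and p5: "(5 :: 5) = 0" by simp_all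
  have r3: "(of_nat (3 * n + r) :: 3) = of_nat r" and r5: "(of_nat (5 * n + r) :: 5) = of_nat r" for r
    by (simp_all add: p3 p5)
  \<comment> \<open>The factor \<open>(8 n - 1) (8 n)\<close> is nonzero modulo 3 only in the class
    of 1, where \<open>7 * 8\<close> is 2, with inverse 2.\<close>
  have "M2spt (3 * n + 1) mod CHAR(3) = 0"
    by (rule M2spt_mod_CHAR[of "(8 * 1 - 1) * (8 * 1)" _ 2])
       (use three_equation[OF p3 psi_mult_M2spt_series, of "3 * n + 1"] in \<open>simp_all only: r3 M2spt_series_def fps_nth_Abs_fps of_nat_1 mult.assoc, simp\<close>)
  then show "M2spt (3 * n + 1) mod 3 = 0" by simp
  \<comment> \<open>The quartic factor is nonzero modulo 5 only in the classes of 1 and 3; in both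
    it is 2, with inverse 3.\<close>
  have "M2spt (5 * n + 1) mod CHAR(5) = 0"
    by (rule M2spt_mod_CHAR[of "(8 * 1 - 1) ^ 2 * ((8 * 1 - 1) ^ 2 - 1)" _ 3])
       (use five_equation[OF p5 psi_mult_M2spt_series, of "5 * n + 1"] in \<open>simp_all only: r5 M2spt_series_def fps_nth_Abs_fps of_nat_1 mult.assoc, simp\<close>)
  then show "M2spt (5 * n + 1) mod 5 = 0" by simp
  have "M2spt (5 * n + 3) mod CHAR(5) = 0"
    by (rule M2spt_mod_CHAR[of "(8 * 3 - 1) ^ 2 * ((8 * 3 - 1) ^ 2 - 1)" _ 3])
       (use five_equation[OF p5 psi_mult_M2spt_series, of "5 * n + 3"] in \<open>simp_all only: r5 M2spt_series_def fps_nth_Abs_fps of_nat_numeral mult.assoc, simp\<close>)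
  then show "M2spt (5 * n + 3) mod 5 = 0" by simp
qed

end
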